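(* Let $\phi\in C^3(\overline\Omega\setminus(\overline{\Gamma_{\rm sonic}}\cup\overline{\Gamma_{\rm shock}}\cup\{\mathcal C\}))\cap C^1(\overline\Omega)$ be a nonconstant solution of the elliptic equation $$a_{11}\phi_{\xi\xi}+2a_{12}\phi_{\xi\eta}+a_{22}\phi_{\eta\eta}=0\qquad\text{in }\Omega,$$ where $a_{ij}\in C^1(\overline\Omega\setminus(\overline{\Gamma_{\rm sonic}}\cup\overline{\Gamma_{\rm shock}}\cup\{\mathcal C\}))$, $i,j=1,2$. Assume that the equation is uniformly elliptic near the wedge corner $\mathcal C$ and strictly elliptic in $\Omega\cup\Gamma_{\rm wedge}^0$, and that $\phi_\nu:=D\phi\cdot\nu=0$ on $\Gamma_{\rm wedge}$, where $\nu$ is the unit normal. Let $\boldsymbol\gamma:=(\sin\tilde\sigma,\cos\tilde\sigma)$ for $\tilde\sigma\in(\sigma,\pi)$. If $$\phi_{\boldsymbol\gamma}:=D\phi\cdot\boldsymbol\gamma\ge 0\qquad\text{on }\Gamma_{\rm shock}\cup\Gamma_{\rm sonic},$$ then $$\phi_{\boldsymbol\gamma}>0\qquad\text{in }(\Omega\cup\Gamma_{\rm wedge})\setminus\{\mathcal C\}.$$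
   Context: Data. Fix $\gamma>1$, a wedge parameter $\sigma\in(0,\pi)$, $\theta_{\rm w}=\pi-\sigma$, and densities $\rho_1>\rho_0>0$. Put $c_0^2=\rho_0^{\gamma-1}$, $c_1^2=\rho_1^{\gamma-1}$ (with $c_0,c_1>0$), $\xi_1=\sqrt{\frac{2\rho_1^2(c_1^2-c_0^2)}{(\gamma-1)(\rho_1^2-\rho_0^2)}}$, $u_1=\frac{\rho_1-\rho_0}{\rho_1}\xi_1>0$, and assume $u_1<c_1$. One has $0<\xi_1-u_1<c_1$. Geometry (coordinates $(\xi,\eta)\in\mathbb R^2$). $W=\{(\xi,\eta):\eta<0,\ \xi<\eta\cot\theta_{\rm w}\}$ is the solid wedge, with faces $\{(\xi,0):\xi<0\}$ and $\{t(\cos\sigma,-\sin\sigma):t>0\}$ and corner $\mathcal C=(0,0)$; $\Lambda=\mathbb R^2\setminus\overline W$. Let $P_1=(\xi_1,\eta_1)$ with $\eta_1=\sqrt{c_1^2-(\xi_1-u_1)^2}$. $\Gamma_{\rm sonic}$ is the open arc of the circle with center $(u_1,0)$ and radius $c_1$ running in the upper half plane from $P_1$ to $(u_1-c_1,0)$. $\Gamma_{\rm shock}$ is a curve, $C^1$ up to its endpoints, joining $P_1$ to a point $P_2$ of the face $\{t(\cos\sigma,-\sin\sigma):t>0\}$. $\Gamma_{\rm wedge}\subset\partial\Lambda$ is the part of the wedge boundary from $(u_1-c_1,0)$ through $\mathcal C$ to $P_2$, and $\Gamma_{\rm wedge}^0$ is the relative interior of $\Gamma_{\rm wedge}$. $\Omega\subset\Lambda$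 is the bounded open domain (connected) bounded by $\Gamma_{\rm shock}$, $\Gamma_{\rm sonic}$ and $\Gamma_{\rm wedge}$; $\mathcal C$ is at positive distance from $\Gamma_{\rm shock}\cup\Gamma_{\rm sonic}$. Ellipticity. With $a_{21}=a_{12}$, strict ellipticity means that the matrix $(a_{ij})$ is positive definite at each point of $\Omega\cup\Gamma_{\rm wedge}^0$ other than $\mathcal C$ (where the coefficients need not be defined); uniform ellipticity near $\mathcal C$ means that for some $r,\lambda>0$, $\lambda|\mathbf y|^2\le\sum a_{ij}y_iy_j\le\lambda^{-1}|\mathbf y|^2$ for all $\mathbf y\in\mathbb R^2$ at all points of $\Omega$ at distance less than $r$ from $\mathcal C$. *)

theory Defs
  imports "HOL-Analysis.Analysis"
begin

section \<open>Spaces of functions that are smooth up to part of the boundary\<close>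

text \<open>
  Here \<open>U\<close> is open and \<open>U \<subseteq> S \<subseteq> closure U\<close>.  A derivative at a boundary point is the limit of the
  derivatives at points of \<open>U\<close>; values of functions outside \<open>closure U\<close> play no role.
\<close>

definition pderiv_upto ::
    "(real \<times> real) set \<Rightarrow> real \<times> real \<Rightarrow> (real \<times> real \<Rightarrow> real) \<Rightarrow> real \<times> real \<Rightarrow> real" where
  "pderiv_upto U v f x =
     (if x \<in> U then frechet_derivative f (at x) v
      else Lim (at x within U) (\<lambda>y. frechet_derivative f (at y) v))"

abbreviation d_xi :: "(real \<times> real) set \<Rightarrow> (real \<times> real \<Rightarrow> real) \<Rightarrow> real \<times> real \<Rightarrow> real" where
  "d_xi U \<equiv> pderiv_upto U (1, 0)"

abbreviation d_eta :: "(real \<times> real) set \<Rightarrow> (real \<times> real \<Rightarrow> real) \<Rightarrow> real \<times> real \<Rightarrow> real" where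
  "d_eta U \<equiv> pderiv_upto U (0, 1)"

definition grad_upto ::
    "(real \<times> real) set \<Rightarrow> (real \<times> real \<Rightarrow> real) \<Rightarrow> real \<times> real \<Rightarrow> real \<times> real" where
  "grad_upto U f x = (d_xi U f x, d_eta U f x)"

text \<open>
  \<open>Ck_upto k U S f\<close> says that \<open>f \<in> C\<^sup>k(S)\<close>: all partial derivatives of \<open>f\<close> in \<open>U\<close> up to order \<open>k\<close>
  exist and extend continuously to \<open>S\<close>.  If the limit in \<open>pderiv_upto\<close> does not exist at some point
  of \<open>S\<close>, the arbitrary value of \<open>Lim\<close> there violates the continuity requirement.
\<close>

primrec Ck_upto ::
    "nat \<Rightarrow> (real \<times> real) set \<Rightarrow> (real \<times> real) set \<Rightarrow> (real \<times> real \<Rightarrow> real) \<Rightarrow> bool" where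
  "Ck_upto 0 U S f \<longleftrightarrow> continuous_on S f"
| "Ck_upto (Suc k) U S f \<longleftrightarrow>
     continuous_on S f \<and> (\<forall>x\<in>U. f differentiable at x) \<and>
     Ck_upto k U S (d_xi U f) \<and> Ck_upto k U S (d_eta U f)"


section \<open>Ellipticity\<close>

definition quad_form ::
    "(real \<times> real \<Rightarrow> real) \<Rightarrow> (real \<times> real \<Rightarrow> real) \<Rightarrow> (real \<times> real \<Rightarrow> real) \<Rightarrow>
     real \<times> real \<Rightarrow> real \<times> real \<Rightarrow> real" where
  "quad_form a11 a12 a22 x y =
     a11 x * (fst y)\<^sup>2 + 2 * a12 x * fst y * snd y + a22 x * (snd y)\<^sup>2"

definition strictly_elliptic_on ::
    "(real \<times> real) set \<Rightarrow> (real \<times> real \<Rightarrow> real) \<Rightarrow> (real \<times> real \<Rightarrow> real) \<Rightarrow> (real \<times> real \<Rightarrow> real) \<Rightarrow> bool"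
where
  "strictly_elliptic_on S a11 a12 a22 \<longleftrightarrow>
     (\<forall>x\<in>S. \<forall>y. y \<noteq> 0 \<longrightarrow> quad_form a11 a12 a22 x y > 0)"

definition uniformly_elliptic_near ::
    "real \<times> real \<Rightarrow> (real \<times> real) set \<Rightarrow>
     (real \<times> real \<Rightarrow> real) \<Rightarrow> (real \<times> real \<Rightarrow> real) \<Rightarrow> (real \<times> real \<Rightarrow> real) \<Rightarrow> bool" where
  "uniformly_elliptic_near p U a11 a12 a22 \<longleftrightarrow>
     (\<exists>r>0. \<exists>l>0. \<forall>x\<in>U. dist x p < r \<longrightarrow>
        (\<forall>y. l * (norm y)\<^sup>2 \<le> quad_form a11 a12 a22 x y \<and>
             quad_form a11 a12 a22 x y \<le> inverse l * (norm y)\<^sup>2))"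


section \<open>The data of the shock diffraction problem\<close>

definition sound_speed :: "real \<Rightarrow> real \<Rightarrow> real" where
  "sound_speed gm rho = sqrt (rho powr (gm - 1))"

definition xi1 :: "real \<Rightarrow> real \<Rightarrow> real \<Rightarrow> real" where
  "xi1 gm rho0 rho1 =
     sqrt (2 * rho1\<^sup>2 * ((sound_speed gm rho1)\<^sup>2 - (sound_speed gm rho0)\<^sup>2) /
           ((gm - 1) * (rho1\<^sup>2 - rho0\<^sup>2)))"

definition u1 :: "real \<Rightarrow> real \<Rightarrow> real \<Rightarrow> real" where
  "u1 gm rho0 rho1 = (rho1 - rho0) / rho1 * xi1 gm rho0 rho1"

definition eta1 :: "real \<Rightarrow> real \<Rightarrow> real \<Rightarrow> real" where
  "eta1 gm rho0 rho1 =
     sqrt ((sound_speed gm rho1)\<^sup>2 - (xi1 gm rho0 rho1 - u1 gm rho0 rho1)\<^sup>2)"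

definition P1 :: "real \<Rightarrow> real \<Rightarrow> real \<Rightarrow> real \<times> real" where
  "P1 gm rho0 rho1 = (xi1 gm rho0 rho1, eta1 gm rho0 rho1)"


section \<open>The geometry\<close>

abbreviation corner :: "real \<times> real" where
  "corner \<equiv> (0, 0)"

definition wedge :: "real \<Rightarrow> (real \<times> real) set" where
  "wedge sg = {(xi, eta). eta < 0 \<and> xi < eta * cot (pi - sg)}"

definition Lam :: "real \<Rightarrow> (real \<times> real) set" where
  "Lam sg = - closure (wedge sg)"

definition lower_face :: "real \<Rightarrow> (real \<times> real) set" where
  "lower_face sg = {t *\<^sub>R (cos sg, - sin sg) | t. t > 0}"

definition sonic_foot :: "real \<Rightarrow> real \<Rightarrow> real \<Rightarrow> real \<times> real" where
  "sonic_foot gm rho0 rho1 = (u1 gm rho0 rho1 - sound_speed gm rho1, 0)"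

text \<open>
  The upper half circle is a graph over the \<open>\<xi>\<close>-axis, and \<open>P1\<close> lies on it to the right of the
  center; so the open arc from \<open>P1\<close> to \<open>sonic_foot\<close> consists of its points to the left of \<open>P1\<close>.
\<close>

definition Gamma_sonic :: "real \<Rightarrow> real \<Rightarrow> real \<Rightarrow> (real \<times> real) set" where
  "Gamma_sonic gm rho0 rho1 =
     {(xi, eta). (xi, eta) \<in> sphere (u1 gm rho0 rho1, 0) (sound_speed gm rho1) \<and>
                 eta > 0 \<and> xi < xi1 gm rho0 rho1}"

text \<open>
  \<open>S\<close> is a simple regular curve without its endpoints \<open>p\<close> and \<open>q\<close>, and is \<open>C\<^sup>1\<close> up to them.
  The derivatives at \<open>0\<close> and \<open>1\<close> are two-sided, which is no restriction: \<open>g\<close> may be continued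
  linearly beyond \<open>[0,1]\<close>.
\<close>

definition open_C1_arc :: "(real \<times> real) set \<Rightarrow> real \<times> real \<Rightarrow> real \<times> real \<Rightarrow> bool" where
  "open_C1_arc S p q \<longleftrightarrow>
     (\<exists>g. arc g \<and> g C1_differentiable_on {0..1} \<and>
          (\<forall>t\<in>{0..1}. vector_derivative g (at t) \<noteq> 0) \<and>
          pathstart g = p \<and> pathfinish g = q \<and> S = g ` {0<..<1})"

text \<open>The part of the boundary of the wedge from \<open>p\<close> through the corner to \<open>q\<close>, endpoints included.\<close>

definition Gamma_wedge :: "real \<times> real \<Rightarrow> real \<times> real \<Rightarrow> (real \<times> real) set" where
  "Gamma_wedge p q = closed_segment p corner \<union> closed_segment corner q"

text \<open>Interior relative to the wedge boundary (which is not the convex-geometric \<open>rel_interior\<close>).\<close>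

definition Gamma_wedge_interior :: "real \<Rightarrow> real \<times> real \<Rightarrow> real \<times> real \<Rightarrow> (real \<times> real) set" where
  "Gamma_wedge_interior sg p q =
     (top_of_set (frontier (Lam sg))) interior_of (Gamma_wedge p q)"

text \<open>
  The unit normal to the wedge boundary pointing into \<open>Lam sg\<close>; it is meaningful only on the two
  faces, not at the corner.
\<close>

definition wedge_normal :: "real \<Rightarrow> real \<times> real \<Rightarrow> real \<times> real" where
  "wedge_normal sg x = (if snd x = 0 then (0, 1) else (sin sg, cos sg))"

end

theory Submission
  imports Defs
begin

text \<open>
  Any function \<open>G\<close> of the gradient \<open>D\<phi>\<close> that is affine or a squared distance satisfies an elliptic
  differential inequality \<open>\<bar>\<Sum> a\<^sub>i\<^sub>j G\<^sub>i\<^sub>j\<bar> \<le> K \<bar>DG\<bar>\<close> wherever its differential in the gradient variable does not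
  vanish, because in the plane the equation recovers \<open>D\<^sup>2\<phi>\<close> from \<open>DG\<close>.  So Hopf's lemma is
  available.  Applied to \<open>\<phi>\<^sub>\<gamma>\<close>, which vanishes at the corner, it gives \<open>\<phi>\<^sub>\<gamma> > 0\<close> in \<open>\<Omega>\<close> and on the
  two open faces.

  The end points of \<open>\<Gamma>wedge\<close>, where nothing is assumed about ellipticity, are covered because the
  hypotheses turn out to be contradictory.  The gradient takes the two faces into two rays of the half plane
  \<open>{y. y \<bullet> \<gamma> \<ge> 0}\<close>; comparing with the squared distance to a point off the image shows that the
  image of a neighbourhood of the corner contains no small gradient with \<open>\<phi>\<^sub>\<eta> > 0\<close>.  Hence
  \<open>\<phi>\<^sub>\<eta> \<le> 0\<close> near the corner, so \<open>\<phi>\<^sub>\<eta>\<^sub>\<eta> \<le> 0\<close> and \<open>\<phi>\<^sub>\<xi>\<^sub>\<xi> \<ge> 0\<close> on the upper face, and \<open>\<phi>\<^sub>\<xi>\<close>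
  increases along it to its value \<open>0\<close> at the corner, although \<open>\<phi>\<^sub>\<gamma> > 0\<close> forces \<open>\<phi>\<^sub>\<xi> > 0\<close> there.
\<close>

section \<open>Calculus in the plane\<close>

text \<open>The equation and the two components of \<open>DG\<close> form a linear system for the
  three second derivatives of the potential. Its determinant is the quadratic form of the
  coefficients at the outer gradient turned by a right angle. This is why ellipticity enters, why
  the outer gradient must not vanish, and why the centre of a squared distance has to lie off the
  image of the gradient map. Third derivatives occur in the trace of the Hessian of \<open>G\<close>
  only through the differentiated equation.

  The obstacle is the corner: the potential is only continuously differentiable there, so neither
  second derivatives nor Hopf's lemma can be used at it. Directional derivatives alone only place
  the image of the gradient map in a half plane. Distances to arbitrary centres detect a boundary
  point of the image wherever it lies. As the small upper half disc contains vectors with negative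
  component along \<open>\<gamma>\<close>, which are never attained, it is not filled by the image
  of a neighbourhood of the corner, and is therefore missed altogether.\<close>

abbreviation lin :: "real \<Rightarrow> real \<Rightarrow> real \<times> real \<Rightarrow> real" where
  "lin a b \<equiv> \<lambda>h. a * fst h + b * snd h"

lemma has_derivative_lin_line:
  assumes "(g has_derivative lin a b) (at (x + s *\<^sub>R d) within T)"
    and "\<And>t. t \<in> I \<Longrightarrow> x + t *\<^sub>R d \<in> T"
  shows "((\<lambda>t. g (x + t *\<^sub>R d)) has_real_derivative lin a b d) (at s within I)"
proof -
  have 1: "((\<lambda>t. x + t *\<^sub>R d) has_derivative (\<lambda>t. t *\<^sub>R d)) (at s within I)"
    by (auto intro!: derivative_eq_intros)
  have "((\<lambda>t. g (x + t *\<^sub>R d)) has_derivative (\<lambda>t. lin a b (t *\<^sub>R d))) (at s within I)"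
    by (rule has_derivative_in_compose[OF 1 has_derivative_subset[OF assms(1)]]) (use assms(2) in auto)
  then show ?thesis
    by (rule has_derivative_imp_has_field_derivative) (simp add: algebra_simps)
qed

text \<open>Schwarz's theorem. The second difference of \<open>g\<close> over a small square,
  expanded by the mean value theorem in either order of the variables, equals \<open>h * h\<close>
  times each mixed derivative at some point of the square; continuity at \<open>x\<close> brings the
  two values together.\<close>

lemma mixed_partials_eq:
  assumes "open U" and "x \<in> U"
    and g: "\<And>y. y \<in> U \<Longrightarrow> (g has_derivative lin (g1 y) (g2 y)) (at y)"
    and g1: "\<And>y. y \<in> U \<Longrightarrow> (g1 has_derivative lin (g11 y) (g12 y)) (at y)"
    and g2: "\<And>y. y \<in> U \<Longrightarrow> (g2 has_derivative lin (g21 y) (g22 y)) (at y)"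
    and cont: "continuous_on U g12" "continuous_on U g21"
  shows "g12 x = g21 x"
proof (rule ccontr)
  assume ne: "g12 x \<noteq> g21 x"
  have "isCont g12 x" "isCont g21 x"
    using cont assms(1,2) continuous_on_eq_continuous_at by blast+
  then have "(\<lambda>y. g12 y) \<midarrow>x\<rightarrow> g12 x" "(\<lambda>y. g21 y) \<midarrow>x\<rightarrow> g21 x"
    by (auto simp: isCont_def)
  define e where "e = \<bar>g12 x - g21 x\<bar> / 2"
  have "e > 0" using ne by (simp add: e_def)
  obtain d1 where d1: "d1 > 0" "\<And>y. dist y x < d1 \<Longrightarrow> dist (g12 y) (g12 x) < e"
    using \<open>isCont g12 x\<close> \<open>e > 0\<close> unfolding continuous_at_eps_delta by blast
  obtain d2 where d2: "d2 > 0" "\<And>y. dist y x < d2 \<Longrightarrow> dist (g21 y) (g21 x) < e"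
    using \<open>isCont g21 x\<close> \<open>e > 0\<close> unfolding continuous_at_eps_delta by blast
  obtain d3 where d3: "d3 > 0" "ball x d3 \<subseteq> U"
    using assms(1,2) open_contains_ball by blast
  \<comment> \<open>A point of the square of side \<open>h\<close> has distance at most
    \<open>2 * h\<close> from \<open>x\<close>, hence the factor 3.\<close>
  define h where "h = min d1 (min d2 d3) / 3"
  have h: "h > 0" using d1 d2 d3 by (simp add: h_def)
  have near: "dist (x + (a, b)) x < min d1 (min d2 d3)" if "0 \<le> a" "a \<le> h" "0 \<le> b" "b \<le> h" for a b
  proof -
    have "dist (x + (a, b)) x = norm (a, b)" by (simp add: dist_norm)
    also have "\<dots> \<le> norm a + norm b" by (rule norm_Pair_le)
    also have "\<dots> \<le> 2 * h" using that by simp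
    also have "\<dots> < min d1 (min d2 d3)" using d1(1) d2(1) d3(1) by (simp add: h_def min_def)
    finally show ?thesis .
  qed
  have inU: "x + (a, b) \<in> U" if "0 \<le> a" "a \<le> h" "0 \<le> b" "b \<le> h" for a b
    using near[OF that] d3 by (auto simp: dist_commute)
  have line1: "((\<lambda>t. k (x + (t, b))) has_real_derivative k1 (x + (a, b))) (at a)"
    if "\<And>y. y \<in> U \<Longrightarrow> (k has_derivative lin (k1 y) (k2 y)) (at y)" "0 \<le> a" "a \<le> h" "0 \<le> b" "b \<le> h"
    for k k1 k2 :: "real \<times> real \<Rightarrow> real" and a b
    using has_derivative_lin_line[of k "k1 (x + (a, b))" "k2 (x + (a, b))" "x + (0, b)" a "(1,0)" UNIV UNIV]
      that(1)[OF inU[OF that(2-5)]]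
    by (simp add: scaleR_prod_def add.assoc)
  have line2: "((\<lambda>t. k (x + (a, t))) has_real_derivative k2 (x + (a, b))) (at b)"
    if "\<And>y. y \<in> U \<Longrightarrow> (k has_derivative lin (k1 y) (k2 y)) (at y)" "0 \<le> a" "a \<le> h" "0 \<le> b" "b \<le> h"
    for k k1 k2 :: "real \<times> real \<Rightarrow> real" and a b
    using has_derivative_lin_line[of k "k1 (x + (a, b))" "k2 (x + (a, b))" "x + (a, 0)" b "(0,1)" UNIV UNIV]
      that(1)[OF inU[OF that(2-5)]]
    by (simp add: scaleR_prod_def add.assoc)
  let ?D = "g (x + (h, h)) - g (x + (h, 0)) - (g (x + (0, h)) - g (x + (0, 0)))"
  have "\<exists>a. 0 < a \<and> a < h \<and> (g (x + (h, h)) - g (x + (h, 0))) - (g (x + (0, h)) - g (x + (0, 0)))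
           = (h - 0) * (g1 (x + (a, h)) - g1 (x + (a, 0)))"
    by (rule MVT2[OF h, of "\<lambda>t. g (x + (t, h)) - g (x + (t, 0))"])
       (use h in \<open>auto intro!: DERIV_diff line1 g\<close>)
  then obtain a where a: "0 < a" "a < h" "?D = h * (g1 (x + (a, h)) - g1 (x + (a, 0)))" by auto
  have "\<exists>b. 0 < b \<and> b < h \<and> g1 (x + (a, h)) - g1 (x + (a, 0)) = (h - 0) * g12 (x + (a, b))"
    by (rule MVT2[OF h, of "\<lambda>t. g1 (x + (a, t))"]) (use h a in \<open>auto intro!: line2 g1\<close>)
  then obtain b where b: "0 < b" "b < h" "?D = h * (h * g12 (x + (a, b)))" using a(3) by auto
  have "\<exists>b. 0 < b \<and> b < h \<and> (g (x + (h, h)) - g (x + (0, h))) - (g (x + (h, 0)) - g (x + (0, 0)))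
           = (h - 0) * (g2 (x + (h, b)) - g2 (x + (0, b)))"
    by (rule MVT2[OF h, of "\<lambda>t. g (x + (h, t)) - g (x + (0, t))"])
       (use h in \<open>auto intro!: DERIV_diff line2 g\<close>)
  then obtain b' where b': "0 < b'" "b' < h" "?D = h * (g2 (x + (h, b')) - g2 (x + (0, b')))"
    by (auto simp: algebra_simps)
  have "\<exists>a. 0 < a \<and> a < h \<and> g2 (x + (h, b')) - g2 (x + (0, b')) = (h - 0) * g21 (x + (a, b'))"
    by (rule MVT2[OF h, of "\<lambda>t. g2 (x + (t, b'))"]) (use h b' in \<open>auto intro!: line1 g2\<close>)
  then obtain a' where a': "0 < a'" "a' < h" "?D = h * (h * g21 (x + (a', b')))" using b'(3) by auto
  have "g12 (x + (a, b)) = g21 (x + (a', b'))"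
    using b(3) a'(3) h by simp
  moreover have "dist (g12 (x + (a, b))) (g12 x) < e"
    by (rule d1(2)) (use near[of a b] a b in simp)
  moreover have "dist (g21 (x + (a', b'))) (g21 x) < e"
    by (rule d2(2)) (use near[of a' b'] a' b' in simp)
  ultimately show False
    using ne e_def[symmetric] unfolding dist_real_def
    by (smt (verit, del_insts) field_sum_of_halves)
qed

text \<open>The second derivatives are assumed at the single point \<open>x\<close> only. Were the
  one along \<open>(a, b)\<close> negative, the slope \<open>k\<close> would be negative just to the
  right of 0, and the mean value theorem would take \<open>v\<close> below its minimum.\<close>

lemma local_min_second_derivative:
  assumes "open U" and "x \<in> U"
    and v: "\<And>y. y \<in> U \<Longrightarrow> (v has_derivative lin (v1 y) (v2 y)) (at y)"
    and v1: "(v1 has_derivative lin h11 h12) (at x)"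
    and v2: "(v2 has_derivative lin h12 h22) (at x)"
    and min: "\<And>y. y \<in> U \<Longrightarrow> v x \<le> v y"
  shows "v1 x = 0" and "v2 x = 0" and "h11 * a\<^sup>2 + 2 * h12 * a * b + h22 * b\<^sup>2 \<ge> 0"
proof -
  have "lin (v1 x) (v2 x) = (\<lambda>h. 0)"
    by (rule differential_zero_maxmin[OF assms(2,1) v[OF assms(2)]]) (use min in auto)
  from fun_cong[OF this, of "(1,0)"] fun_cong[OF this, of "(0,1)"]
  show 0: "v1 x = 0" "v2 x = 0" by auto
  have zero: "(0, 0) = (0 :: real \<times> real)" by (simp add: zero_prod_def)
  show "h11 * a\<^sup>2 + 2 * h12 * a * b + h22 * b\<^sup>2 \<ge> 0"
  proof (rule ccontr)
    assume neg: "\<not> ?thesis"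
    define k where "k = (\<lambda>t. v1 (x + t *\<^sub>R (a, b)) * a + v2 (x + t *\<^sub>R (a, b)) * b)"
    have *: "(k has_real_derivative (lin h11 h12 (a, b) * a + lin h12 h22 (a, b) * b)) (at 0)"
      unfolding k_def
      by (intro DERIV_add DERIV_cmult_right has_derivative_lin_line[where T = UNIV])
         (use v1 v2 in \<open>auto simp: zero\<close>)
    have "lin h11 h12 (a, b) * a + lin h12 h22 (a, b) * b < 0"
      using neg by (simp add: algebra_simps power2_eq_square)
    from DERIV_neg_dec_right[OF * this] obtain d where d: "d > 0" "\<And>h. h > 0 \<Longrightarrow> h < d \<Longrightarrow> k h < k 0"
      by auto
    have k0: "k 0 = 0" by (simp add: k_def 0 zero)
    have "\<forall>\<^sub>F t in at 0. x + t *\<^sub>R (a, b) \<in> U"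
      by (rule topological_tendstoD[OF _ assms(1)]) (use assms(2) in \<open>auto intro!: tendsto_eq_intros simp: zero\<close>)
    then obtain r where r: "r > 0" "\<And>t. t \<noteq> 0 \<Longrightarrow> \<bar>t\<bar> < r \<Longrightarrow> x + t *\<^sub>R (a, b) \<in> U"
      unfolding eventually_at by (auto simp: dist_real_def)
    have r': "x + t *\<^sub>R (a, b) \<in> U" if "0 \<le> t" "t < r" for t
      using r(2)[of t] that assms(2) by (cases "t = 0") (auto simp: zero)
    define s where "s = min d r / 2"
    have s: "0 < s" "s < d" "s < r" using d r by (auto simp: s_def)
    have "\<exists>c. 0 < c \<and> c < s \<and> v (x + s *\<^sub>R (a, b)) - v (x + 0 *\<^sub>R (a, b)) = (s - 0) * k c"
    proof (rule MVT2[OF s(1)])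
      fix c assume c: "0 \<le> c" "c \<le> s"
      have "((\<lambda>t. v (x + t *\<^sub>R (a, b))) has_real_derivative
          lin (v1 (x + c *\<^sub>R (a, b))) (v2 (x + c *\<^sub>R (a, b))) (a, b)) (at c)"
        by (rule has_derivative_lin_line[where T = UNIV]) (use v r' c s in auto)
      then show "((\<lambda>t. v (x + t *\<^sub>R (a, b))) has_real_derivative k c) (at c)"
        by (simp add: k_def)
    qed
    then obtain c where c: "0 < c" "c < s" "v (x + s *\<^sub>R (a, b)) - v x = s * k c" by (auto simp: zero)
    have "s * k c < 0" using d(2)[of c] c s k0 by (simp add: mult_pos_neg)
    moreover have "v x \<le> v (x + s *\<^sub>R (a, b))" using min r'[of s] s by auto
    ultimately show False using c by simp
  qed
qed

text \<open>This turns limits of derivatives into derivatives at boundary points. After subtraction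
  of its linear part at \<open>x\<close>, the function \<open>g\<close> has a differential of norm
  at most \<open>e\<close> near \<open>x\<close>; on the convex set \<open>U\<close> it is then
  Lipschitz with constant \<open>e\<close>, and this estimate passes to limits in
  \<open>T\<close>.\<close>

lemma has_derivative_lin_extend:
  assumes "convex U" and "U \<subseteq> T" and "T \<subseteq> closure U" and "x \<in> T"
    and cont: "continuous_on T g" "continuous_on T g1" "continuous_on T g2"
    and g: "\<And>y. y \<in> U \<Longrightarrow> (g has_derivative lin (g1 y) (g2 y)) (at y)"
  shows "(g has_derivative lin (g1 x) (g2 x)) (at x within T)"
proof (unfold has_derivative_within_alt, intro conjI allI impI)
  show "bounded_linear (lin (g1 x) (g2 x))"
    by (intro bounded_linear_add bounded_linear_const_mult bounded_linear_fst bounded_linear_snd)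
  fix e :: real assume "e > 0"
  obtain d1 where d1: "d1 > 0" "\<And>y. y \<in> T \<Longrightarrow> dist y x < d1 \<Longrightarrow> dist (g1 y) (g1 x) < e / 2"
    using cont(2) \<open>x \<in> T\<close> \<open>e > 0\<close> unfolding continuous_on_iff by (meson half_gt_zero)
  obtain d2 where d2: "d2 > 0" "\<And>y. y \<in> T \<Longrightarrow> dist y x < d2 \<Longrightarrow> dist (g2 y) (g2 x) < e / 2"
    using cont(3) \<open>x \<in> T\<close> \<open>e > 0\<close> unfolding continuous_on_iff by (meson half_gt_zero)
  define d where "d = min d1 d2"
  have "d > 0" using d1 d2 by (simp add: d_def)
  define k where "k = (\<lambda>y. g y - lin (g1 x) (g2 x) y)"
  have kcont: "continuous_on T k"
    unfolding k_def by (intro continuous_intros cont)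
  have bound: "norm (k y - k z) \<le> e * norm (y - z)" if "y \<in> U \<inter> ball x d" "z \<in> U \<inter> ball x d" for y z
  proof (rule differentiable_bound[of "U \<inter> ball x d" k "\<lambda>y. lin (g1 y - g1 x) (g2 y - g2 x)"])
    show "convex (U \<inter> ball x d)" using assms(1) by (simp add: convex_Int)
    fix w assume w: "w \<in> U \<inter> ball x d"
    have "(g has_derivative lin (g1 w) (g2 w)) (at w within U \<inter> ball x d)"
      using g w has_derivative_at_withinI by blast
    then show "(k has_derivative lin (g1 w - g1 x) (g2 w - g2 x)) (at w within U \<inter> ball x d)"
      unfolding k_def by (auto intro!: derivative_eq_intros simp: algebra_simps)
    have "w \<in> T" "dist w x < d1" "dist w x < d2" using w assms(2) by (auto simp: d_def dist_commute)
    then have *: "\<bar>g1 w - g1 x\<bar> \<le> e / 2" "\<bar>g2 w - g2 x\<bar> \<le> e / 2"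
      using d1(2)[of w] d2(2)[of w] by (auto simp: dist_real_def)
    show "onorm (lin (g1 w - g1 x) (g2 w - g2 x)) \<le> e"
    proof (rule onorm_bound)
      fix h :: "real \<times> real"
      have "norm (lin (g1 w - g1 x) (g2 w - g2 x) h)
          \<le> \<bar>g1 w - g1 x\<bar> * \<bar>fst h\<bar> + \<bar>g2 w - g2 x\<bar> * \<bar>snd h\<bar>"
        by (metis abs_mult abs_triangle_ineq real_norm_def)
      also have "\<dots> \<le> e / 2 * norm h + e / 2 * norm h"
        using * norm_fst_le[of "fst h" "snd h"] norm_snd_le[of "snd h" "fst h"] \<open>e > 0\<close>
        by (intro add_mono mult_mono) auto
      finally show "norm (lin (g1 w - g1 x) (g2 w - g2 x) h) \<le> e * norm h" by simp
    qed (use \<open>e > 0\<close> in simp)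
  qed (use that in auto)
  have approx: "\<exists>f. (\<forall>n. f n \<in> U \<inter> ball x d) \<and> f \<longlonglongrightarrow> y" if "y \<in> T" "y \<in> ball x d" for y
  proof -
    have "y \<in> closure U \<inter> ball x d" using that assms(3) by auto
    then have "y \<in> closure (U \<inter> ball x d)"
      using open_Int_closure_subset[of "ball x d" U] by (auto simp: Int_commute)
    then show ?thesis unfolding closure_sequential .
  qed
  show "\<exists>d>0. \<forall>y\<in>T. norm (y - x) < d \<longrightarrow> norm (g y - g x - lin (g1 x) (g2 x) (y - x)) \<le> e * norm (y - x)"
  proof (intro exI[of _ d] conjI ballI impI \<open>d > 0\<close>)
    fix y assume y: "y \<in> T" "norm (y - x) < d"
    then have yb: "y \<in> ball x d" by (simp add: dist_norm norm_minus_commute)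
    obtain f where f: "\<And>n. f n \<in> U \<inter> ball x d" "f \<longlonglongrightarrow> y" using approx[OF y(1) yb] by auto
    obtain f' where f': "\<And>n. f' n \<in> U \<inter> ball x d" "f' \<longlonglongrightarrow> x"
      using approx[OF \<open>x \<in> T\<close>] \<open>d > 0\<close> by auto
    have "(\<lambda>n. k (f n)) \<longlonglongrightarrow> k y"
      by (rule continuous_on_tendsto_compose[OF kcont f(2) y(1)]) (use f assms(2) in \<open>auto intro!: always_eventually\<close>)
    moreover have "(\<lambda>n. k (f' n)) \<longlonglongrightarrow> k x"
      by (rule continuous_on_tendsto_compose[OF kcont f'(2) \<open>x \<in> T\<close>]) (use f' assms(2) in \<open>auto intro!: always_eventually\<close>)
    ultimately have "(\<lambda>n. norm (k (f n) - k (f' n))) \<longlonglongrightarrow> norm (k y - k x)"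
      by (intro tendsto_intros)
    moreover have "(\<lambda>n. e * norm (f n - f' n)) \<longlonglongrightarrow> e * norm (y - x)"
      by (intro tendsto_intros f f')
    ultimately have "norm (k y - k x) \<le> e * norm (y - x)"
      by (rule LIMSEQ_le) (use bound f f' in blast)
    then show "norm (g y - g x - lin (g1 x) (g2 x) (y - x)) \<le> e * norm (y - x)"
      by (simp add: k_def algebra_simps)
  qed
qed

lemma continuous_ge_on_closure_subset:
  fixes g :: "'a::metric_space \<Rightarrow> real"
  assumes "continuous_on S g" and "x \<in> S" and "x \<in> closure V" and "V \<subseteq> S"
    and "\<And>y. y \<in> V \<Longrightarrow> m \<le> g y"
  shows "m \<le> g x"
proof -
  obtain f where f: "\<And>n. f n \<in> V" "f \<longlonglongrightarrow> x"
    using assms(3) unfolding closure_sequential by blast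
  have "(\<lambda>n. g (f n)) \<longlonglongrightarrow> g x"
    by (rule continuous_on_tendsto_compose[OF assms(1) f(2) assms(2)])
       (use f assms(4) in \<open>auto intro!: always_eventually\<close>)
  then show ?thesis
    by (rule LIMSEQ_le_const) (use f assms(5) in auto)
qed

section \<open>Hopf's lemma\<close>

text \<open>Completing the square writes the coefficient matrix as a combination, with positive
  weights \<open>a11 x\<close> and \<open>a22 x - d * a12 x\<close>, of the rank one matrices of
  \<open>(1, d)\<close> and \<open>(0, 1)\<close>. Each of these pairs with a nonnegative Hessian to
  a nonnegative number.\<close>

lemma trace_mult_nonneg:
  assumes psd: "\<And>a b. h11 * a\<^sup>2 + 2 * h12 * a * b + h22 * b\<^sup>2 \<ge> (0::real)"
    and pos: "\<And>y. y \<noteq> 0 \<Longrightarrow> quad_form a11 a12 a22 x y > 0"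
  shows "a11 x * h11 + 2 * a12 x * h12 + a22 x * h22 \<ge> 0"
proof -
  have a11: "a11 x > 0" using pos[of "(1, 0)"] by (simp add: quad_form_def zero_prod_def)
  define d where "d = a12 x / a11 x"
  have a12: "a12 x = d * a11 x" using a11 by (simp add: d_def)
  have "a22 x - d * a12 x > 0"
    using pos[of "(- d, 1)"] a11 unfolding quad_form_def a12
    by (simp add: zero_prod_def power2_eq_square algebra_simps)
  moreover have "h22 \<ge> 0" using psd[of 0 1] by simp
  moreover have "h11 + 2 * h12 * d + h22 * d\<^sup>2 \<ge> 0" using psd[of 1 d] by simp
  ultimately have "a11 x * (h11 + 2 * h12 * d + h22 * d\<^sup>2) + (a22 x - d * a12 x) * h22 \<ge> 0"
    using a11 by simp
  also have "a11 x * (h11 + 2 * h12 * d + h22 * d\<^sup>2) + (a22 x - d * a12 x) * h22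
      = a11 x * h11 + 2 * a12 x * h12 + a22 x * h22"
    unfolding a12 by (simp add: algebra_simps power2_eq_square)
  finally show ?thesis .
qed

lemma norm_pair_squared: "(norm (y :: real \<times> real))\<^sup>2 = (fst y)\<^sup>2 + (snd y)\<^sup>2"
  by (cases y) (simp add: norm_Pair)

text \<open>Comparison with the barrier \<open>E\<close> on the annulus between the radii
  \<open>R / 2\<close> and \<open>R\<close>. The conclusion is a growth rate along the radius at
  \<open>x0\<close>, not a normal derivative, because \<open>v\<close> is only assumed continuous on
  the circle; so it serves interior and boundary points alike.\<close>

lemma hopf_boundary_point:
  fixes v :: "real \<times> real \<Rightarrow> real"
  assumes "R > 0" and "dist c x0 = R"
    and cont: "continuous_on (cball c R) v"
    and v: "\<And>x. x \<in> ball c R \<Longrightarrow> (v has_derivative lin (v1 x) (v2 x)) (at x)"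
    and v1: "\<And>x. x \<in> ball c R \<Longrightarrow> (v1 has_derivative lin (h11 x) (h12 x)) (at x)"
    and v2: "\<And>x. x \<in> ball c R \<Longrightarrow> (v2 has_derivative lin (h12 x) (h22 x)) (at x)"
    and "l > 0" "K \<ge> 0" "L \<ge> 0"
    and ell: "\<And>x y. x \<in> ball c R \<Longrightarrow> l * (norm y)\<^sup>2 \<le> quad_form a11 a12 a22 x y"
    and tr: "\<And>x. x \<in> ball c R \<Longrightarrow> a11 x + a22 x \<le> L"
    and super: "\<And>x. x \<in> ball c R \<Longrightarrow>
      a11 x * h11 x + 2 * a12 x * h12 x + a22 x * h22 x \<le> K * (\<bar>v1 x\<bar> + \<bar>v2 x\<bar>)"
    and gt: "\<And>x. x \<in> ball c R \<Longrightarrow> m < v x"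
  shows "\<exists>k>0. \<forall>s\<in>{0..1/2}. m + k * s \<le> v (x0 + s *\<^sub>R (c - x0))"
proof -
  \<comment> \<open>The operator applied to \<open>E\<close> has a leading part of at least
    \<open>M\<^sup>2 * (l * R\<^sup>2) * E\<close>, because the radius is at least
    \<open>R / 2\<close> on the annulus. This has to beat \<open>2 * M * L\<close> from the trace
    and \<open>4 * M * K * R\<close> from the gradient term.\<close>
  define M where "M = (2 * L + 4 * K * R) / (l * R\<^sup>2) + 1"
  have "l * R\<^sup>2 > 0" using \<open>R > 0\<close> \<open>l > 0\<close> by simp
  have M0: "M > 0" unfolding M_def using \<open>R > 0\<close> \<open>l > 0\<close> \<open>K \<ge> 0\<close> \<open>L \<ge> 0\<close>
    by (intro add_nonneg_pos divide_nonneg_pos) auto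
  have "(2 * L + 4 * K * R) / (l * R\<^sup>2) * (l * R\<^sup>2) = 2 * L + 4 * K * R"
    using \<open>l * R\<^sup>2 > 0\<close> by (metis less_numeral_extra(3) nonzero_eq_divide_eq)
  then have "M * (l * R\<^sup>2) = 2 * L + 4 * K * R + l * R\<^sup>2"
    unfolding M_def by (simp only: distrib_right mult_1)
  then have M: "M * (l * R\<^sup>2) > 2 * L + 4 * K * R" using \<open>l * R\<^sup>2 > 0\<close> by linarith
  define E where "E = (\<lambda>x::real \<times> real. exp (- M * ((fst x - fst c)\<^sup>2 + (snd x - snd c)\<^sup>2)))"
  have E: "E x = exp (- M * (dist c x)\<^sup>2)" for x
    unfolding E_def dist_commute[of c] dist_norm norm_pair_squared by (simp add: power2_commute)
  have "\<exists>x\<in>cball c (R/2). \<forall>y\<in>cball c (R/2). v x \<le> v y"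
    by (rule continuous_attains_inf) (use \<open>R > 0\<close> in \<open>auto intro: continuous_on_subset[OF cont]\<close>)
  then obtain z where z: "z \<in> cball c (R/2)" "\<And>y. y \<in> cball c (R/2) \<Longrightarrow> v z \<le> v y" by blast
  \<comment> \<open>The gap between \<open>v\<close> and \<open>m\<close> on the inner disc. As
    \<open>E\<close> is at most 1, it keeps \<open>v - e * E\<close> above \<open>g0\<close> on the
    inner circle; on the outer circle \<open>E\<close> is constant and the weak inequality for
    \<open>v\<close> suffices.\<close>
  define e where "e = v z - m"
  have "z \<in> ball c R" using z(1) \<open>R > 0\<close> by auto
  then have e: "e > 0" using gt[of z] by (simp add: e_def)
  have ge: "m \<le> v x" if "x \<in> cball c R" for x
  proof (rule continuous_ge_on_closure[of "ball c R" v x])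
    show "continuous_on (closure (ball c R)) v" using cont \<open>R > 0\<close> by simp
    show "x \<in> closure (ball c R)" using that \<open>R > 0\<close> by simp
    show "m \<le> v y" if "y \<in> ball c R" for y using gt[OF that] by simp
  qed
  define A where "A = cball c R - ball c (R/2)"
  define g where "g = (\<lambda>x. v x - e * E x)"
  define g0 where "g0 = m - e * exp (- M * R\<^sup>2)"
  have "compact A" unfolding A_def by (simp add: compact_diff)
  moreover have "x0 \<in> A" using assms(1,2) by (simp add: A_def)
  moreover have "continuous_on A g"
    unfolding g_def E_def A_def by (intro continuous_intros continuous_on_subset[OF cont]) auto
  ultimately obtain x where x: "x \<in> A" "\<And>y. y \<in> A \<Longrightarrow> g x \<le> g y"
    using continuous_attains_inf[of A g] by blast
  have "g x \<ge> g0"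
  proof (rule ccontr)
    assume "\<not> g0 \<le> g x"
    then have neg: "g x < g0" by simp
    have dx: "R / 2 \<le> dist c x" "dist c x \<le> R" using x(1) by (auto simp: A_def)
    have "dist c x \<noteq> R"
      using ge[of x] dx neg by (auto simp: g_def g0_def E)
    moreover have "dist c x \<noteq> R / 2"
    proof
      assume *: "dist c x = R / 2"
      have "e * E x \<le> e * 1" using e M0 by (intro mult_left_mono) (auto simp: E)
      moreover have "e * exp (- M * R\<^sup>2) > 0" using e by simp
      moreover have "v z \<le> v x" using z(2)[of x] * by simp
      ultimately show False using neg by (simp add: g_def g0_def e_def)
    qed
    ultimately have xU: "x \<in> ball c R - cball c (R/2)" using dx by auto
    let ?y1 = "fst x - fst c" and ?y2 = "snd x - snd c"
    define E1 where "E1 = (\<lambda>x::real \<times> real. - 2 * M * (fst x - fst c) * E x)"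
    define E2 where "E2 = (\<lambda>x::real \<times> real. - 2 * M * (snd x - snd c) * E x)"
    have dE: "(E has_derivative lin (E1 y) (E2 y)) (at y)" for y
      unfolding E_def E1_def E2_def
      by (auto intro!: derivative_eq_intros simp: algebra_simps)
    have dE1: "(E1 has_derivative lin ((4 * M\<^sup>2 * ?y1\<^sup>2 - 2 * M) * E x) (4 * M\<^sup>2 * ?y1 * ?y2 * E x)) (at x)"
      unfolding E1_def
      by (rule derivative_eq_intros dE refl | simp add: E1_def E2_def fun_eq_iff algebra_simps power2_eq_square)+
    have dE2: "(E2 has_derivative lin (4 * M\<^sup>2 * ?y1 * ?y2 * E x) ((4 * M\<^sup>2 * ?y2\<^sup>2 - 2 * M) * E x)) (at x)"
      unfolding E2_def
      by (rule derivative_eq_intros dE refl | simp add: E1_def E2_def fun_eq_iff algebra_simps power2_eq_square)+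
    define H11 where "H11 = h11 x - e * ((4 * M\<^sup>2 * ?y1\<^sup>2 - 2 * M) * E x)"
    define H12 where "H12 = h12 x - e * (4 * M\<^sup>2 * ?y1 * ?y2 * E x)"
    define H22 where "H22 = h22 x - e * ((4 * M\<^sup>2 * ?y2\<^sup>2 - 2 * M) * E x)"
    have dg: "(g has_derivative lin (v1 y - e * E1 y) (v2 y - e * E2 y)) (at y)" if "y \<in> ball c R" for y
      unfolding g_def
      by (rule derivative_eq_intros v dE that refl | simp add: fun_eq_iff algebra_simps)+
    have d1: "((\<lambda>y. v1 y - e * E1 y) has_derivative lin H11 H12) (at x)"
      unfolding H11_def H12_def
      by (rule derivative_eq_intros v1 dE1 refl | use xU in \<open>simp add: fun_eq_iff algebra_simps\<close>)+
    have d2: "((\<lambda>y. v2 y - e * E2 y) has_derivative lin H12 H22) (at x)"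
      unfolding H22_def H12_def
      by (rule derivative_eq_intros v2 dE2 refl | use xU in \<open>simp add: fun_eq_iff algebra_simps\<close>)+
    have "open (ball c R - cball c (R/2))" by (simp add: open_Diff)
    note lm = local_min_second_derivative[OF this xU dg d1 d2]
    have le: "g x \<le> g y" if "y \<in> ball c R - cball c (R/2)" for y
      by (rule x(2)) (use that in \<open>auto simp: A_def\<close>)
    \<comment> \<open>At an interior minimum of \<open>g\<close> the gradient of \<open>v\<close> is
      that of \<open>e * E\<close>. So the right side of \<open>super\<close> is a multiple of
      \<open>e * E x\<close> as well, and this factor cancels.\<close>
    have g1: "v1 x = e * E1 x" and g2: "v2 x = e * E2 x" using lm(1,2) le by auto
    have xb: "x \<in> ball c R" using xU by simp
    have pos: "quad_form a11 a12 a22 x y > 0" if "y \<noteq> 0" for y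
    proof -
      have "0 < l * (norm y)\<^sup>2" using that \<open>l > 0\<close> by simp
      also note ell[OF xb, of y]
      finally show ?thesis .
    qed
    have "a11 x * H11 + 2 * a12 x * H12 + a22 x * H22 \<ge> 0"
      by (rule trace_mult_nonneg[OF _ pos]) (use lm(3) le in auto)
    then have "e * (E x * (4 * M\<^sup>2 * quad_form a11 a12 a22 x (?y1, ?y2) - 2 * M * (a11 x + a22 x)))
        \<le> a11 x * h11 x + 2 * a12 x * h12 x + a22 x * h22 x"
      unfolding H11_def H12_def H22_def quad_form_def by (simp add: algebra_simps)
    also have "\<dots> \<le> K * (\<bar>v1 x\<bar> + \<bar>v2 x\<bar>)" by (rule super[OF xb])
    also have "\<dots> = e * (E x * (2 * M * K * (\<bar>?y1\<bar> + \<bar>?y2\<bar>)))"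
    proof -
      have "E x > 0" by (simp add: E)
      then have "\<bar>e * (- 2 * M * y * E x)\<bar> = e * (E x * (2 * M * \<bar>y\<bar>))" for y
        using e M0 by (simp add: abs_mult)
      then show ?thesis unfolding g1 g2 E1_def E2_def by (simp add: distrib_left)
    qed
    finally have "4 * M\<^sup>2 * quad_form a11 a12 a22 x (?y1, ?y2) - 2 * M * (a11 x + a22 x)
        \<le> 2 * M * K * (\<bar>?y1\<bar> + \<bar>?y2\<bar>)"
      using e by (simp add: E)
    moreover have "2 * M * K * (\<bar>?y1\<bar> + \<bar>?y2\<bar>) \<le> 2 * M * K * (2 * R)"
    proof (rule mult_left_mono)
      have "\<bar>?y1\<bar> \<le> dist x c" "\<bar>?y2\<bar> \<le> dist x c"
        using dist_fst_le[of x c] dist_snd_le[of x c] by (auto simp: dist_real_def)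
      then show "\<bar>?y1\<bar> + \<bar>?y2\<bar> \<le> 2 * R" using dx(2) by (simp add: dist_commute)
    qed (use M0 \<open>K \<ge> 0\<close> in simp)
    moreover have "2 * M * (a11 x + a22 x) \<le> 2 * M * L"
      using tr[OF xb] M0 by simp
    moreover have "M\<^sup>2 * (l * R\<^sup>2) \<le> 4 * M\<^sup>2 * quad_form a11 a12 a22 x (?y1, ?y2)"
    proof -
      have "norm (?y1, ?y2) = dist c x"
        by (subst dist_commute) (cases x, cases c, simp add: dist_norm)
      then have "(R/2)\<^sup>2 \<le> (norm (?y1, ?y2))\<^sup>2"
        using dx(1) \<open>R > 0\<close> by (intro power_mono) auto
      then have "l * (R/2)\<^sup>2 \<le> l * (norm (?y1, ?y2))\<^sup>2" using \<open>l > 0\<close> by simp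
      also note ell[OF xb, of "(?y1, ?y2)"]
      finally have "4 * M\<^sup>2 * (l * (R/2)\<^sup>2) \<le> 4 * M\<^sup>2 * quad_form a11 a12 a22 x (?y1, ?y2)"
        by (intro mult_left_mono) auto
      then show ?thesis by (simp add: power_divide)
    qed
    ultimately have "M * (M * (l * R\<^sup>2)) \<le> M * (2 * L + 4 * K * R)"
      by (simp add: algebra_simps power2_eq_square)
    then show False using M M0 by simp
  qed
  then have gA: "g0 \<le> g y" if "y \<in> A" for y using x(2)[OF that] by simp
  show ?thesis
  proof (intro exI[of _ "e * (exp (- M * R\<^sup>2) * (M * R\<^sup>2))"] conjI ballI)
    show "e * (exp (- M * R\<^sup>2) * (M * R\<^sup>2)) > 0" using e M0 \<open>R > 0\<close> by simp
    fix s :: real assume s: "s \<in> {0..1/2}"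
    let ?y = "x0 + s *\<^sub>R (c - x0)"
    have "dist c ?y = norm ((1 - s) *\<^sub>R (c - x0))" by (simp add: dist_norm algebra_simps)
    also have "\<dots> = (1 - s) * R" using s assms(2) by (simp add: dist_norm)
    finally have dy: "dist c ?y = (1 - s) * R" .
    have "?y \<in> A" using s \<open>R > 0\<close> by (auto simp: A_def dy mult_le_cancel_right1)
    then have "v ?y \<ge> m + e * (E ?y - exp (- M * R\<^sup>2))"
      using gA by (auto simp: g_def g0_def algebra_simps)
    moreover have "E ?y - exp (- M * R\<^sup>2) \<ge> exp (- M * R\<^sup>2) * (M * R\<^sup>2) * s"
    proof -
      \<comment> \<open>The exponent gained at distance \<open>(1 - s) * R\<close> is
        \<open>M * R\<^sup>2\<close> times \<open>1 - (1 - s)\<^sup>2\<close>, which is at least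
        \<open>s\<close>.\<close>
      have "s * s \<le> s * 1" using s by (intro mult_left_mono) auto
      then have "M * R\<^sup>2 * s \<le> M * R\<^sup>2 * (2 * s - s * s)"
        using M0 by (intro mult_left_mono) auto
      also have "\<dots> \<le> exp (M * R\<^sup>2 * (2 * s - s * s)) - 1"
        using exp_ge_add_one_self[of "M * R\<^sup>2 * (2 * s - s * s)"] by linarith
      finally have "exp (- M * R\<^sup>2) * (M * R\<^sup>2 * s) \<le> exp (- M * R\<^sup>2) * (exp (M * R\<^sup>2 * (2 * s - s * s)) - 1)"
        by (intro mult_left_mono) auto
      also have "\<dots> = E ?y - exp (- M * R\<^sup>2)"
        unfolding E dy right_diff_distrib exp_add[symmetric]
        by (simp add: algebra_simps power2_eq_square)
      finally show ?thesis by (simp add: mult.assoc)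
    qed
    then have "e * (exp (- M * R\<^sup>2) * (M * R\<^sup>2) * s) \<le> e * (E ?y - exp (- M * R\<^sup>2))"
      using e by simp
    ultimately show "m + e * (exp (- M * R\<^sup>2) * (M * R\<^sup>2)) * s \<le> v ?y" by (simp add: mult.assoc)
  qed
qed

text \<open>The smaller eigenvalue is the determinant divided by the larger one, which is at most
  the trace. Separate bounds \<open>d\<close> and \<open>T\<close> let one constant serve a whole
  neighbourhood.\<close>

lemma quad_form_ge:
  assumes "a11 x > 0" and "d > 0" and "d \<le> a11 x * a22 x - (a12 x)\<^sup>2" and "a11 x + a22 x \<le> T"
  shows "d / T * (norm y)\<^sup>2 \<le> quad_form a11 a12 a22 x y"
proof -
  have "a11 x * a22 x > 0" using assms(2,3) by (smt (verit) zero_le_power2)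
  then have "a22 x > 0" using assms(1) by (simp add: zero_less_mult_iff)
  then have tr: "a11 x + a22 x > 0" using assms(1) by simp
  \<comment> \<open>Cayley--Hamilton: \<open>tr(A) A = A\<^sup>2 + det(A) I\<close>.\<close>
  have "(a11 x + a22 x) * quad_form a11 a12 a22 x y
      = (a11 x * fst y + a12 x * snd y)\<^sup>2 + (a12 x * fst y + a22 x * snd y)\<^sup>2
        + (a11 x * a22 x - (a12 x)\<^sup>2) * (norm y)\<^sup>2"
    unfolding quad_form_def norm_pair_squared by (simp add: algebra_simps power2_eq_square)
  also have "\<dots> \<ge> d * (norm y)\<^sup>2"
    using mult_right_mono[OF assms(3), of "(norm y)\<^sup>2"]
    by (smt (verit) zero_le_power2)
  finally have *: "d * (norm y)\<^sup>2 \<le> (a11 x + a22 x) * quad_form a11 a12 a22 x y" .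
  moreover have "0 \<le> d * (norm y)\<^sup>2" using assms(2) by simp
  ultimately have "0 \<le> quad_form a11 a12 a22 x y"
    using tr by (smt (verit) mult_pos_neg)
  then have "(a11 x + a22 x) * quad_form a11 a12 a22 x y \<le> T * quad_form a11 a12 a22 x y"
    using assms(4) by (rule mult_right_mono[rotated])
  with * have "d * (norm y)\<^sup>2 \<le> T * quad_form a11 a12 a22 x y" by simp
  then show ?thesis using tr assms(4) by (simp add: field_simps)
qed

lemma continuous_on_locally_less:
  fixes g :: "'a::metric_space \<Rightarrow> real"
  assumes "continuous_on S g" and "x \<in> S" and "g x < c"
  shows "\<exists>e>0. \<forall>y\<in>S. dist y x < e \<longrightarrow> g y < c"
proof -
  obtain e where "e > 0" "\<And>y. y \<in> S \<Longrightarrow> dist y x < e \<Longrightarrow> dist (g y) (g x) < c - g x"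
    using assms unfolding continuous_on_iff by (meson diff_gt_0_iff_gt)
  then show ?thesis by (intro exI[of _ e]) (force simp: dist_real_def)
qed

text \<open>The list gives one radius and one constant for all the functions of the locale
  \<open>hodograph\<close> that enter the estimates.\<close>

lemma continuous_on_locally_bounded:
  fixes fs :: "('a::metric_space \<Rightarrow> real) list"
  assumes "\<forall>f\<in>set fs. continuous_on S f" and x: "x \<in> S"
  shows "\<exists>C>0. \<exists>e>0. \<forall>y\<in>S. dist y x < e \<longrightarrow> (\<forall>f\<in>set fs. \<bar>f y\<bar> \<le> C)"
  using assms(1)
proof (induction fs)
  case Nil
  show ?case by (auto intro: exI[of _ "1::real"])
next
  case (Cons f fs)
  then obtain C e where C: "C > 0" "e > 0"
    "\<And>y g. y \<in> S \<Longrightarrow> dist y x < e \<Longrightarrow> g \<in> set fs \<Longrightarrow> \<bar>g y\<bar> \<le> C" by auto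
  have "continuous_on S (\<lambda>y. \<bar>f y\<bar>)" using Cons.prems by (auto intro!: continuous_intros)
  from continuous_on_locally_less[OF this x, of "\<bar>f x\<bar> + 1"]
  obtain e' where e': "e' > 0" "\<And>y. y \<in> S \<Longrightarrow> dist y x < e' \<Longrightarrow> \<bar>f y\<bar> < \<bar>f x\<bar> + 1" by auto
  show ?case
  proof (intro exI conjI ballI impI)
    show "max C (\<bar>f x\<bar> + 1) > 0" using C by simp
    show "min e e' > 0" using C e' by simp
    fix y g assume "y \<in> S" "dist y x < min e e'" "g \<in> set (f # fs)"
    then show "\<bar>g y\<bar> \<le> max C (\<bar>f x\<bar> + 1)" using C(3)[of y g] e'(2)[of y] by force
  qed
qed

lemma mult_between:
  fixes x y A :: real
  assumes "\<bar>x\<bar> \<le> A"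
  shows "x * y \<le> A * \<bar>y\<bar>" and "- (A * \<bar>y\<bar>) \<le> x * y"
  using mult_right_mono[OF assms, of "\<bar>y\<bar>"] by (auto simp flip: abs_mult)

lemma derivative_ge_of_linear_growth:
  fixes h :: "real \<Rightarrow> real"
  assumes "(h has_real_derivative D) (at 0 within {0..b})" and "b > 0"
    and "\<And>s. s \<in> {0..b} \<Longrightarrow> h 0 + k * s \<le> h s"
  shows "k \<le> D"
proof (rule tendsto_lowerbound)
  show "((\<lambda>y. (h y - h 0) / (y - 0)) \<longlongrightarrow> D) (at 0 within {0..b})"
    using assms(1) by (simp add: has_field_derivative_iff)
  show "\<forall>\<^sub>F y in at 0 within {0..b}. k \<le> (h y - h 0) / (y - 0)"
    unfolding eventually_at_filter
    by (rule always_eventually) (use assms(3) in \<open>auto simp: le_divide_eq field_simps\<close>)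
  show "at 0 within {0..b} \<noteq> bot"
    using assms(2) by (simp add: at_within_Icc_at_right)
qed

section \<open>Functions of the gradient of a solution\<close>

text \<open>The potential itself does not occur. \<open>p\<close>, \<open>q\<close> are its first
  derivatives, \<open>r\<close>, \<open>s\<close>, \<open>t\<close> the second ones and
  \<open>r1\<close>, \<open>s1\<close>, \<open>t1\<close>, \<open>t2\<close> the third ones, ordered
  by increasing number of derivatives in \<open>\<eta>\<close>; \<open>b11\<close>,
  \<open>c11\<close> and so on are the two derivatives of the coefficients. The symmetry of mixed
  derivatives is encoded by the repeated names.\<close>

locale hodograph =
  fixes \<Omega> S :: "(real \<times> real) set"
    and p q r s t r1 s1 t1 t2 :: "real \<times> real \<Rightarrow> real"
    and a11 a12 a22 b11 b12 b22 c11 c12 c22 :: "real \<times> real \<Rightarrow> real"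
  assumes open_\<Omega>: "open \<Omega>" and \<Omega>_S: "\<Omega> \<subseteq> S" and S_closure: "S \<subseteq> closure \<Omega>"
    and dp: "x \<in> \<Omega> \<Longrightarrow> (p has_derivative lin (r x) (s x)) (at x)"
    and dq: "x \<in> \<Omega> \<Longrightarrow> (q has_derivative lin (s x) (t x)) (at x)"
    and dr: "x \<in> \<Omega> \<Longrightarrow> (r has_derivative lin (r1 x) (s1 x)) (at x)"
    and ds: "x \<in> \<Omega> \<Longrightarrow> (s has_derivative lin (s1 x) (t1 x)) (at x)"
    and dt: "x \<in> \<Omega> \<Longrightarrow> (t has_derivative lin (t1 x) (t2 x)) (at x)"
    and da11: "x \<in> \<Omega> \<Longrightarrow> (a11 has_derivative lin (b11 x) (c11 x)) (at x)"
    and da12: "x \<in> \<Omega> \<Longrightarrow> (a12 has_derivative lin (b12 x) (c12 x)) (at x)"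
    and da22: "x \<in> \<Omega> \<Longrightarrow> (a22 has_derivative lin (b22 x) (c22 x)) (at x)"
    and cont: "continuous_on S p" "continuous_on S q" "continuous_on S r" "continuous_on S s"
      "continuous_on S t" "continuous_on S a11" "continuous_on S a12" "continuous_on S a22"
      "continuous_on S b11" "continuous_on S b12" "continuous_on S b22"
      "continuous_on S c11" "continuous_on S c12" "continuous_on S c22"
    and eq_\<Omega>: "x \<in> \<Omega> \<Longrightarrow> a11 x * r x + 2 * a12 x * s x + a22 x * t x = 0"
begin

lemma eq: "a11 x * r x + 2 * a12 x * s x + a22 x * t x = 0" if x: "x \<in> S" for x
proof -
  obtain f where f: "\<And>n. f n \<in> \<Omega>" "f \<longlonglongrightarrow> x"
    using subsetD[OF S_closure x] unfolding closure_sequential by blast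
  let ?g = "\<lambda>x. a11 x * r x + 2 * a12 x * s x + a22 x * t x"
  have "continuous_on S ?g" by (intro continuous_intros cont)
  then have "(\<lambda>n. ?g (f n)) \<longlonglongrightarrow> ?g x"
    by (rule continuous_on_tendsto_compose[OF _ f(2) x]) (use f \<Omega>_S in \<open>auto intro!: always_eventually\<close>)
  moreover have "(\<lambda>n. ?g (f n)) = (\<lambda>n. 0)" using f eq_\<Omega> by auto
  ultimately show ?thesis by (simp add: LIMSEQ_const_iff)
qed

lemma differentiated_eq:
  assumes "x \<in> \<Omega>"
  shows "a11 x * r1 x + 2 * a12 x * s1 x + a22 x * t1 x = - (b11 x * r x + 2 * b12 x * s x + b22 x * t x)"
    and "a11 x * s1 x + 2 * a12 x * t1 x + a22 x * t2 x = - (c11 x * r x + 2 * c12 x * s x + c22 x * t x)"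
proof -
  let ?g = "\<lambda>x. a11 x * r x + 2 * a12 x * s x + a22 x * t x"
  let ?g1 = "a11 x * r1 x + 2 * a12 x * s1 x + a22 x * t1 x + (b11 x * r x + 2 * b12 x * s x + b22 x * t x)"
  let ?g2 = "a11 x * s1 x + 2 * a12 x * t1 x + a22 x * t2 x + (c11 x * r x + 2 * c12 x * s x + c22 x * t x)"
  have "(?g has_derivative lin ?g1 ?g2) (at x)"
    by (rule derivative_eq_intros da11[OF assms] da12[OF assms] da22[OF assms]
        dr[OF assms] ds[OF assms] dt[OF assms] refl | simp add: fun_eq_iff algebra_simps)+
  moreover have "(?g has_derivative (\<lambda>h. 0)) (at x)"
    by (rule has_derivative_transform_within_open[of "\<lambda>x. 0" _ _ _ \<Omega>]) (use open_\<Omega> assms eq_\<Omega> in auto)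
  ultimately have "lin ?g1 ?g2 = (\<lambda>h. 0)" by (rule has_derivative_unique)
  from fun_cong[OF this, of "(1,0)"] fun_cong[OF this, of "(0,1)"]
  show "a11 x * r1 x + 2 * a12 x * s1 x + a22 x * t1 x = - (b11 x * r x + 2 * b12 x * s x + b22 x * t x)"
    and "a11 x * s1 x + 2 * a12 x * t1 x + a22 x * t2 x = - (c11 x * r x + 2 * c12 x * s x + c22 x * t x)"
    by auto
qed

text \<open>
  With \<open>k = 0\<close> this is a directional derivative of the potential; with \<open>k = 1\<close> it is, up to a
  constant, half the squared distance of the gradient from \<open>(- g1, - g2)\<close>.
\<close>

definition G :: "real \<Rightarrow> real \<Rightarrow> real \<Rightarrow> real \<times> real \<Rightarrow> real" where
  "G k g1 g2 x = g1 * p x + g2 * q x + k / 2 * ((p x)\<^sup>2 + (q x)\<^sup>2)"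

definition G1 :: "real \<Rightarrow> real \<Rightarrow> real \<Rightarrow> real \<times> real \<Rightarrow> real" where
  "G1 k g1 g2 x = (g1 + k * p x) * r x + (g2 + k * q x) * s x"

definition G2 :: "real \<Rightarrow> real \<Rightarrow> real \<Rightarrow> real \<times> real \<Rightarrow> real" where
  "G2 k g1 g2 x = (g1 + k * p x) * s x + (g2 + k * q x) * t x"

definition H11 :: "real \<Rightarrow> real \<Rightarrow> real \<Rightarrow> real \<times> real \<Rightarrow> real" where
  "H11 k g1 g2 x = (g1 + k * p x) * r1 x + (g2 + k * q x) * s1 x + k * ((r x)\<^sup>2 + (s x)\<^sup>2)"

definition H12 :: "real \<Rightarrow> real \<Rightarrow> real \<Rightarrow> real \<times> real \<Rightarrow> real" where
  "H12 k g1 g2 x = (g1 + k * p x) * s1 x + (g2 + k * q x) * t1 x + k * (s x * (r x + t x))"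

definition H22 :: "real \<Rightarrow> real \<Rightarrow> real \<Rightarrow> real \<times> real \<Rightarrow> real" where
  "H22 k g1 g2 x = (g1 + k * p x) * t1 x + (g2 + k * q x) * t2 x + k * ((s x)\<^sup>2 + (t x)\<^sup>2)"

lemma dG:
  assumes "x \<in> \<Omega>"
  shows "(G k g1 g2 has_derivative lin (G1 k g1 g2 x) (G2 k g1 g2 x)) (at x)"
proof -
  have "((\<lambda>x. g1 * p x + g2 * q x + k / 2 * ((p x)\<^sup>2 + (q x)\<^sup>2))
      has_derivative lin (G1 k g1 g2 x) (G2 k g1 g2 x)) (at x)"
    by (rule derivative_eq_intros dp[OF assms] dq[OF assms] refl
      | simp add: G1_def G2_def fun_eq_iff algebra_simps)+
  then show ?thesis by (simp add: G_def[abs_def])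
qed

lemma dG1:
  assumes "x \<in> \<Omega>"
  shows "(G1 k g1 g2 has_derivative lin (H11 k g1 g2 x) (H12 k g1 g2 x)) (at x)"
proof -
  have "((\<lambda>x. (g1 + k * p x) * r x + (g2 + k * q x) * s x)
      has_derivative lin (H11 k g1 g2 x) (H12 k g1 g2 x)) (at x)"
    by (rule derivative_eq_intros dp[OF assms] dq[OF assms] dr[OF assms] ds[OF assms] refl
      | simp add: H11_def H12_def fun_eq_iff algebra_simps power2_eq_square)+
  then show ?thesis by (simp add: G1_def[abs_def])
qed

lemma dG2:
  assumes "x \<in> \<Omega>"
  shows "(G2 k g1 g2 has_derivative lin (H12 k g1 g2 x) (H22 k g1 g2 x)) (at x)"
proof -
  have "((\<lambda>x. (g1 + k * p x) * s x + (g2 + k * q x) * t x)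
      has_derivative lin (H12 k g1 g2 x) (H22 k g1 g2 x)) (at x)"
    by (rule derivative_eq_intros dp[OF assms] dq[OF assms] ds[OF assms] dt[OF assms] refl
      | simp add: H12_def H22_def fun_eq_iff algebra_simps power2_eq_square)+
  then show ?thesis by (simp add: G2_def[abs_def])
qed

lemma continuous_G: "continuous_on S (G k g1 g2)"
  unfolding G_def[abs_def] by (intro continuous_intros cont)

lemma continuous_G1: "continuous_on S (G1 k g1 g2)"
  unfolding G1_def[abs_def] by (intro continuous_intros cont)

lemma continuous_G2: "continuous_on S (G2 k g1 g2)"
  unfolding G2_def[abs_def] by (intro continuous_intros cont)

text \<open>
  In two dimensions the Hessian of the potential is determined by the equation together with the
  gradient of \<open>G\<close>, as long as the differential of the outer function does not vanish.
\<close>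

lemma hessian_from_gradient:
  fixes k g1 g2 x
  assumes "x \<in> \<Omega>"
  defines "u \<equiv> g1 + k * p x" and "w \<equiv> g2 + k * q x"
  shows "quad_form a11 a12 a22 x (w, - u) * r x
      = (a22 x * u - 2 * a12 x * w) * G1 k g1 g2 x - a22 x * w * G2 k g1 g2 x"
    and "quad_form a11 a12 a22 x (w, - u) * s x = a11 x * w * G1 k g1 g2 x + a22 x * u * G2 k g1 g2 x"
    and "quad_form a11 a12 a22 x (w, - u) * t x
      = (a11 x * w - 2 * a12 x * u) * G2 k g1 g2 x - a11 x * u * G1 k g1 g2 x"
proof -
  have e: "a11 x * r x = - 2 * a12 x * s x - a22 x * t x" using eq_\<Omega>[OF assms(1)] by simp
  have "quad_form a11 a12 a22 x (w, - u) * r x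
      = w\<^sup>2 * (a11 x * r x) - 2 * a12 x * w * u * r x + a22 x * u\<^sup>2 * r x"
    by (simp add: quad_form_def algebra_simps)
  then show "quad_form a11 a12 a22 x (w, - u) * r x
      = (a22 x * u - 2 * a12 x * w) * G1 k g1 g2 x - a22 x * w * G2 k g1 g2 x"
    unfolding e G1_def G2_def u_def[symmetric] w_def[symmetric]
    by (simp add: algebra_simps power2_eq_square)
  have "a11 x * w * G1 k g1 g2 x + a22 x * u * G2 k g1 g2 x
      = w * u * (a11 x * r x) + a11 x * w\<^sup>2 * s x + a22 x * u * (u * s x + w * t x)"
    unfolding G1_def G2_def u_def[symmetric] w_def[symmetric]
    by (simp add: algebra_simps power2_eq_square)
  then show "quad_form a11 a12 a22 x (w, - u) * s x = a11 x * w * G1 k g1 g2 x + a22 x * u * G2 k g1 g2 x"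
    unfolding e by (simp add: quad_form_def algebra_simps power2_eq_square)
  have e': "a22 x * t x = - 2 * a12 x * s x - a11 x * r x" using e by simp
  have "quad_form a11 a12 a22 x (w, - u) * t x
      = u\<^sup>2 * (a22 x * t x) - 2 * a12 x * w * u * t x + a11 x * w\<^sup>2 * t x"
    by (simp add: quad_form_def algebra_simps)
  then show "quad_form a11 a12 a22 x (w, - u) * t x
      = (a11 x * w - 2 * a12 x * u) * G2 k g1 g2 x - a11 x * u * G1 k g1 g2 x"
    unfolding e' G1_def G2_def u_def[symmetric] w_def[symmetric]
    by (simp add: algebra_simps power2_eq_square)
qed

text \<open>Third derivatives appear in exactly the combinations of \<open>differentiated_eq\<close>
  and can be traded for second ones. What remains is linear in the second derivatives, except for
  the term with factor \<open>k\<close>, which is quadratic.\<close>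

lemma trace_hessian_G:
  assumes "x \<in> \<Omega>"
  shows "a11 x * H11 k g1 g2 x + 2 * a12 x * H12 k g1 g2 x + a22 x * H22 k g1 g2 x
    = - (g1 + k * p x) * (b11 x * r x + 2 * b12 x * s x + b22 x * t x)
      - (g2 + k * q x) * (c11 x * r x + 2 * c12 x * s x + c22 x * t x)
      + k * (a11 x * ((r x)\<^sup>2 + (s x)\<^sup>2) + 2 * a12 x * (s x * (r x + t x)) + a22 x * ((s x)\<^sup>2 + (t x)\<^sup>2))"
proof -
  have "a11 x * H11 k g1 g2 x + 2 * a12 x * H12 k g1 g2 x + a22 x * H22 k g1 g2 x
    = (g1 + k * p x) * (a11 x * r1 x + 2 * a12 x * s1 x + a22 x * t1 x)
      + (g2 + k * q x) * (a11 x * s1 x + 2 * a12 x * t1 x + a22 x * t2 x)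
      + k * (a11 x * ((r x)\<^sup>2 + (s x)\<^sup>2) + 2 * a12 x * (s x * (r x + t x)) + a22 x * ((s x)\<^sup>2 + (t x)\<^sup>2))"
    unfolding H11_def H12_def H22_def by (simp add: algebra_simps)
  then show ?thesis unfolding differentiated_eq[OF assms] by (simp add: algebra_simps)
qed

text \<open>Supplies the hypotheses of \<open>hopf_boundary_point\<close> near a point of
  \<open>S\<close>, boundary points included, since everything involved is continuous on
  \<open>S\<close>. The second derivatives are controlled by the gradient of \<open>G\<close>
  through \<open>hessian_from_gradient\<close>; in the quadratic terms one factor is estimated by
  the constant \<open>C\<close>, which makes them linear.\<close>

lemma local_bounds:
  assumes x0: "x0 \<in> S"
    and ell: "\<And>y. y \<noteq> 0 \<Longrightarrow> quad_form a11 a12 a22 x0 y > 0"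
    and ne: "(g1 + k * p x0, g2 + k * q x0) \<noteq> 0"
  shows "\<exists>e>0. \<exists>l>0. \<exists>K\<ge>0. \<exists>L\<ge>0. \<forall>x\<in>\<Omega> \<inter> ball x0 e.
      (\<forall>y. l * (norm y)\<^sup>2 \<le> quad_form a11 a12 a22 x y) \<and> a11 x + a22 x \<le> L \<and>
      a11 x * H11 k g1 g2 x + 2 * a12 x * H12 k g1 g2 x + a22 x * H22 k g1 g2 x
        \<le> K * (\<bar>G1 k g1 g2 x\<bar> + \<bar>G2 k g1 g2 x\<bar>)"
proof -
  have "\<exists>C>0. \<exists>e>0. \<forall>y\<in>S. dist y x0 < e \<longrightarrow>
      (\<forall>f\<in>set [p, q, r, s, t, a11, a12, a22, b11, b12, b22, c11, c12, c22]. \<bar>f y\<bar> \<le> C)"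
    by (rule continuous_on_locally_bounded[OF _ x0]) (use cont in auto)
  then obtain C e1 where C0: "C > 0" and e1: "e1 > 0"
    and bd: "\<And>y f. y \<in> S \<Longrightarrow> dist y x0 < e1 \<Longrightarrow>
      f \<in> set [p, q, r, s, t, a11, a12, a22, b11, b12, b22, c11, c12, c22] \<Longrightarrow> \<bar>f y\<bar> \<le> C"
    by blast
  define det where "det = (\<lambda>x. a11 x * a22 x - (a12 x)\<^sup>2)"
  define N where "N = (\<lambda>x. (g1 + k * p x)\<^sup>2 + (g2 + k * q x)\<^sup>2)"
  have a0: "a11 x0 > 0" using ell[of "(1, 0)"] by (simp add: quad_form_def zero_prod_def)
  have "quad_form a11 a12 a22 x0 (- a12 x0, a11 x0) > 0"
    using ell[of "(- a12 x0, a11 x0)"] a0 by (simp add: zero_prod_def)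
  also have "quad_form a11 a12 a22 x0 (- a12 x0, a11 x0) = a11 x0 * det x0"
    by (simp add: quad_form_def det_def algebra_simps power2_eq_square)
  finally have det0: "det x0 > 0" using a0 by (simp add: zero_less_mult_iff)
  have N0: "N x0 > 0" using ne unfolding N_def zero_prod_def by (auto simp: sum_power2_gt_zero_iff)
  have "continuous_on S (\<lambda>x. - a11 x)" "continuous_on S (\<lambda>x. - det x)" "continuous_on S (\<lambda>x. - N x)"
    unfolding det_def N_def by (intro continuous_intros cont)+
  note cc = this
  obtain e2 where e2: "e2 > 0" "\<And>y. y \<in> S \<Longrightarrow> dist y x0 < e2 \<Longrightarrow> a11 y > 0"
    using continuous_on_locally_less[OF cc(1) x0, of 0] a0 by auto
  obtain e3 where e3: "e3 > 0" "\<And>y. y \<in> S \<Longrightarrow> dist y x0 < e3 \<Longrightarrow> det x0 / 2 < det y"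
    using continuous_on_locally_less[OF cc(2) x0, of "- det x0 / 2"] det0 by auto
  obtain e4 where e4: "e4 > 0" "\<And>y. y \<in> S \<Longrightarrow> dist y x0 < e4 \<Longrightarrow> N x0 / 2 < N y"
    using continuous_on_locally_less[OF cc(3) x0, of "- N x0 / 2"] N0 by auto
  \<comment> \<open>\<open>l\<close> is a determinant bound over a trace bound, as in
    \<open>quad_form_ge\<close>; \<open>n\<close> bounds from below the form by which
    \<open>hessian_from_gradient\<close> divides; \<open>D\<close> bounds the components of the
    outer gradient. In \<open>K\<close> the first factor estimates the trace by the second
    derivatives, the second factor these by the gradient of \<open>G\<close>.\<close>
  define l where "l = det x0 / 2 / (2 * C)"
  define n where "n = l * (N x0 / 2)"
  define D where "D = \<bar>g1\<bar> + \<bar>g2\<bar> + \<bar>k\<bar> * C"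
  define K where "K = (4 * C * D + 6 * \<bar>k\<bar> * C\<^sup>2) * (9 * C * D / n)"
  have l0: "l > 0" using det0 C0 by (simp add: l_def)
  have n0: "n > 0" using l0 N0 by (simp add: n_def)
  have D0: "D \<ge> 0" using C0 by (simp add: D_def)
  have K0: "K \<ge> 0" using C0 D0 n0 by (simp add: K_def)
  have main: "(\<forall>y. l * (norm y)\<^sup>2 \<le> quad_form a11 a12 a22 x y) \<and> a11 x + a22 x \<le> 2 * C \<and>
      a11 x * H11 k g1 g2 x + 2 * a12 x * H12 k g1 g2 x + a22 x * H22 k g1 g2 x
        \<le> K * (\<bar>G1 k g1 g2 x\<bar> + \<bar>G2 k g1 g2 x\<bar>)"
    if x: "x \<in> \<Omega> \<inter> ball x0 (min (min e1 e2) (min e3 e4))" for x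
  proof (intro conjI allI)
    have xS: "x \<in> S" and d: "dist x x0 < e1" "dist x x0 < e2" "dist x x0 < e3" "dist x x0 < e4"
      using x \<Omega>_S by (auto simp: dist_commute)
    have b: "\<bar>p x\<bar> \<le> C" "\<bar>q x\<bar> \<le> C" "\<bar>r x\<bar> \<le> C" "\<bar>s x\<bar> \<le> C" "\<bar>t x\<bar> \<le> C"
      "\<bar>a11 x\<bar> \<le> C" "\<bar>a12 x\<bar> \<le> C" "\<bar>a22 x\<bar> \<le> C" "\<bar>b11 x\<bar> \<le> C" "\<bar>b12 x\<bar> \<le> C" "\<bar>b22 x\<bar> \<le> C"
      "\<bar>c11 x\<bar> \<le> C" "\<bar>c12 x\<bar> \<le> C" "\<bar>c22 x\<bar> \<le> C"
      by (rule bd[OF xS d(1)]; simp)+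
    show tr: "a11 x + a22 x \<le> 2 * C" using b(6,8) by linarith
    show q: "l * (norm y)\<^sup>2 \<le> quad_form a11 a12 a22 x y" for y
      unfolding l_def
      by (rule quad_form_ge[where ?a11.0 = a11 and ?a12.0 = a12 and ?a22.0 = a22, OF _ _ _ tr])
         (use e2(2)[OF xS d(2)] e3(2)[OF xS d(3)] det0 in \<open>auto simp: det_def\<close>)
    define u where "u = g1 + k * p x"
    define w where "w = g2 + k * q x"
    define Q where "Q = quad_form a11 a12 a22 x (w, - u)"
    define W where "W = \<bar>G1 k g1 g2 x\<bar> + \<bar>G2 k g1 g2 x\<bar>"
    define Z where "Z = \<bar>r x\<bar> + \<bar>s x\<bar> + \<bar>t x\<bar>"
    have "n \<le> l * N x" using e4(2)[OF xS d(4)] l0 by (simp add: n_def)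
    also have "\<dots> = l * (norm (w, - u))\<^sup>2"
      by (simp add: N_def norm_pair_squared flip: u_def w_def)
    also have "\<dots> \<le> Q" unfolding Q_def by (rule q)
    finally have nQ: "n \<le> Q" .
    have kp: "\<bar>k * p x\<bar> \<le> \<bar>k\<bar> * C" "\<bar>k * q x\<bar> \<le> \<bar>k\<bar> * C"
      using b(1,2) by (auto simp: abs_mult intro: mult_left_mono)
    have uw: "\<bar>u\<bar> \<le> D" "\<bar>w\<bar> \<le> D" using kp unfolding u_def w_def D_def
      by (auto intro: order_trans[OF abs_triangle_ineq])
    have CD: "\<bar>a * z\<bar> \<le> C * D" if "\<bar>a\<bar> \<le> C" "\<bar>z\<bar> \<le> D" for a z
      using that by (simp add: abs_mult mult_mono)
    have rst: "n * \<bar>z\<bar> \<le> 3 * C * D * W"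
      if "Q * z = c1 * G1 k g1 g2 x + c2 * G2 k g1 g2 x" "\<bar>c1\<bar> \<le> 3 * C * D" "\<bar>c2\<bar> \<le> 3 * C * D" for z c1 c2
    proof -
      have "n * \<bar>z\<bar> \<le> Q * \<bar>z\<bar>" using nQ by (rule mult_right_mono) simp
      also have "\<dots> = \<bar>Q * z\<bar>" using nQ n0 by (simp add: abs_mult)
      also have "\<dots> \<le> \<bar>c1 * G1 k g1 g2 x\<bar> + \<bar>c2 * G2 k g1 g2 x\<bar>"
        unfolding that(1) by (rule abs_triangle_ineq)
      also have "\<dots> \<le> 3 * C * D * \<bar>G1 k g1 g2 x\<bar> + 3 * C * D * \<bar>G2 k g1 g2 x\<bar>"
        unfolding abs_mult by (intro add_mono mult_right_mono that) auto
      also have "\<dots> = 3 * C * D * W" by (simp add: W_def algebra_simps)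
      finally show ?thesis .
    qed
    have xO: "x \<in> \<Omega>" using x by simp
    note h = hessian_from_gradient[OF xO, where k=k and ?g1.0=g1 and ?g2.0=g2,
        folded u_def w_def, folded Q_def]
    have CD0: "0 \<le> C * D" using C0 D0 by simp
    note pr = CD[OF b(6) uw(1)] CD[OF b(6) uw(2)] CD[OF b(7) uw(1)] CD[OF b(7) uw(2)]
      CD[OF b(8) uw(1)] CD[OF b(8) uw(2)]
    have CD3: "\<bar>y\<bar> \<le> 3 * C * D" if "\<bar>y\<bar> \<le> C * D" for y using that CD0 by simp
    have CD3': "\<bar>y - 2 * z * z'\<bar> \<le> 3 * C * D" if "\<bar>y\<bar> \<le> C * D" "\<bar>z * z'\<bar> \<le> C * D" for y z z'
      using that by (simp add: mult.assoc)
    have "n * \<bar>r x\<bar> \<le> 3 * C * D * W"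
      by (rule rst[of _ "a22 x * u - 2 * a12 x * w" "- (a22 x * w)"])
         (use h(1) in simp, rule CD3'[OF pr(5,4)], use CD3[OF pr(6)] in simp)
    moreover have "n * \<bar>s x\<bar> \<le> 3 * C * D * W"
      by (rule rst[OF h(2)]) (rule CD3[OF pr(2)], rule CD3[OF pr(5)])
    moreover have "n * \<bar>t x\<bar> \<le> 3 * C * D * W"
      by (rule rst[of _ "- (a11 x * u)" "a11 x * w - 2 * a12 x * u"])
         (use h(3) in simp, use CD3[OF pr(1)] in simp, rule CD3'[OF pr(2,3)])
    ultimately have "n * Z \<le> 9 * C * D * W" by (simp add: Z_def distrib_left)
    then have Z: "Z \<le> 9 * C * D / n * W" using n0 by (simp add: field_simps)
    have Z0: "Z \<ge> 0" by (simp add: Z_def)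
    have lin3: "\<bar>a * r x + 2 * b * s x + c * t x\<bar> \<le> 2 * C * Z"
      if "\<bar>a\<bar> \<le> C" "\<bar>b\<bar> \<le> C" "\<bar>c\<bar> \<le> C" for a b c
    proof -
      have "0 \<le> C * \<bar>r x\<bar>" "0 \<le> C * \<bar>t x\<bar>" using C0 by auto
      then show ?thesis
        using mult_between[OF that(1), of "r x"] mult_between[OF that(2), of "s x"]
          mult_between[OF that(3), of "t x"]
        unfolding abs_le_iff Z_def distrib_left by (simp add: mult.assoc)
    qed
    have t12: "\<bar>- u * y\<bar> \<le> D * (2 * C * Z)" "\<bar>w * y\<bar> \<le> D * (2 * C * Z)" if "\<bar>y\<bar> \<le> 2 * C * Z" for y
      using uw that D0 by (auto simp: abs_mult intro!: mult_mono)
    have sq: "a * (y * z) \<le> C\<^sup>2 * \<bar>y\<bar>" "- (C\<^sup>2 * \<bar>y\<bar>) \<le> a * (y * z)" if "\<bar>a\<bar> \<le> C" "\<bar>z\<bar> \<le> C" for a y z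
    proof -
      have "\<bar>a\<bar> * \<bar>z\<bar> \<le> C * C" using that C0 by (intro mult_mono) auto
      then have "(\<bar>a\<bar> * \<bar>z\<bar>) * \<bar>y\<bar> \<le> (C * C) * \<bar>y\<bar>" by (rule mult_right_mono) simp
      then have "\<bar>a * (y * z)\<bar> \<le> C\<^sup>2 * \<bar>y\<bar>" by (simp add: abs_mult power2_eq_square ac_simps)
      then show "a * (y * z) \<le> C\<^sup>2 * \<bar>y\<bar>" "- (C\<^sup>2 * \<bar>y\<bar>) \<le> a * (y * z)" by linarith+
    qed
    let ?T = "a11 x * ((r x)\<^sup>2 + (s x)\<^sup>2) + 2 * a12 x * (s x * (r x + t x)) + a22 x * ((s x)\<^sup>2 + (t x)\<^sup>2)"
    have "?T = a11 x * (r x * r x) + a11 x * (s x * s x) + 2 * (a12 x * (s x * r x)) + 2 * (a12 x * (s x * t x))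
        + a22 x * (s x * s x) + a22 x * (t x * t x)"
      by (simp add: algebra_simps power2_eq_square)
    then have "\<bar>?T\<bar> \<le> C\<^sup>2 * \<bar>r x\<bar> + 6 * (C\<^sup>2 * \<bar>s x\<bar>) + C\<^sup>2 * \<bar>t x\<bar>"
      using sq[OF b(6) b(3), of "r x"] sq[OF b(6) b(4), of "s x"] sq[OF b(7) b(3), of "s x"]
        sq[OF b(7) b(5), of "s x"] sq[OF b(8) b(4), of "s x"] sq[OF b(8) b(5), of "t x"]
      unfolding abs_le_iff by simp
    moreover have "0 \<le> C\<^sup>2 * \<bar>r x\<bar>" "0 \<le> C\<^sup>2 * \<bar>t x\<bar>" by auto
    moreover have "6 * C\<^sup>2 * Z = 6 * (C\<^sup>2 * \<bar>r x\<bar>) + 6 * (C\<^sup>2 * \<bar>s x\<bar>) + 6 * (C\<^sup>2 * \<bar>t x\<bar>)"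
      by (simp add: Z_def distrib_left)
    ultimately have "\<bar>?T\<bar> \<le> 6 * C\<^sup>2 * Z" by linarith
    then have T: "\<bar>k * ?T\<bar> \<le> \<bar>k\<bar> * (6 * C\<^sup>2 * Z)"
      unfolding abs_mult by (rule mult_left_mono) simp
    have "a11 x * H11 k g1 g2 x + 2 * a12 x * H12 k g1 g2 x + a22 x * H22 k g1 g2 x
        = - u * (b11 x * r x + 2 * b12 x * s x + b22 x * t x)
          - w * (c11 x * r x + 2 * c12 x * s x + c22 x * t x) + k * ?T"
      unfolding trace_hessian_G[OF xO] u_def w_def ..
    also have "\<dots> \<le> D * (2 * C * Z) + D * (2 * C * Z) + \<bar>k\<bar> * (6 * C\<^sup>2 * Z)"
      using t12(1)[OF lin3[OF b(9-11)]] t12(2)[OF lin3[OF b(12-14)]] T by linarith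
    also have "\<dots> = (4 * C * D + 6 * \<bar>k\<bar> * C\<^sup>2) * Z" by (simp add: algebra_simps)
    also have "\<dots> \<le> (4 * C * D + 6 * \<bar>k\<bar> * C\<^sup>2) * (9 * C * D / n * W)"
      using Z C0 D0 by (intro mult_left_mono) auto
    also have "\<dots> = K * W" by (simp add: K_def)
    finally show "a11 x * H11 k g1 g2 x + 2 * a12 x * H12 k g1 g2 x + a22 x * H22 k g1 g2 x
        \<le> K * (\<bar>G1 k g1 g2 x\<bar> + \<bar>G2 k g1 g2 x\<bar>)" unfolding W_def .
  qed
  show ?thesis
    by (rule exI[of _ "min (min e1 e2) (min e3 e4)"], intro conjI,
        use e1 e2 e3 e4 in simp, rule exI[of _ l], intro conjI l0,
        rule exI[of _ K], intro conjI K0, rule exI[of _ "2 * C"], intro conjI ballI main,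
        use C0 in simp)
       (use main in blast)+
qed

text \<open>The strong minimum principle. If points near \<open>z\<close> were not minimal, a disc
  about one of them, free of minimum points inside, would touch the minimum set at some
  \<open>x0\<close>; Hopf's lemma would give a positive derivative at a point where the gradient
  vanishes. In the form of openness it also serves \<open>small_gradient_sign\<close>, where the
  domain may be disconnected.\<close>

lemma open_minimum_set:
  assumes "open U" and "U \<subseteq> \<Omega>"
    and ell: "\<And>x y. x \<in> U \<Longrightarrow> y \<noteq> 0 \<Longrightarrow> quad_form a11 a12 a22 x y > 0"
    and ge: "\<And>x. x \<in> U \<Longrightarrow> m \<le> G k g1 g2 x"
    and ne: "\<And>x. x \<in> U \<Longrightarrow> G k g1 g2 x = m \<Longrightarrow> (g1 + k * p x, g2 + k * q x) \<noteq> 0"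
  shows "open {x \<in> U. G k g1 g2 x = m}"
  unfolding open_contains_ball
proof (intro ballI)
  let ?v = "G k g1 g2"
  fix z assume "z \<in> {x \<in> U. ?v x = m}"
  then have z: "z \<in> U" "?v z = m" by auto
  obtain e where e: "e > 0" "cball z e \<subseteq> U" using \<open>open U\<close> z(1) open_contains_cball by blast
  \<comment> \<open>For \<open>y\<close> within \<open>e / 2\<close> of \<open>z\<close>, the
    nearest minimum point is closer than \<open>e / 2\<close> to \<open>y\<close>, so the disc about
    \<open>y\<close> up to that point stays in \<open>cball z e\<close>.\<close>
  have "y \<in> U \<and> ?v y = m" if y: "y \<in> ball z (e/2)" for y
  proof (rule ccontr)
    assume contra: "\<not> (y \<in> U \<and> ?v y = m)"
    have dyz: "dist y z < e / 2" using y by (simp add: dist_commute)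
    then have "y \<in> cball z e" using e(1) by (simp add: dist_commute)
    then have "y \<in> U" using e by blast
    with contra have vy: "?v y \<noteq> m" by simp
    define A where "A = {x \<in> cball z e. ?v x = m}"
    have "cball z e \<subseteq> S" using e(2) assms(2) \<Omega>_S by blast
    then have "continuous_on (cball z e) ?v" by (rule continuous_on_subset[OF continuous_G])
    then have "closed A" unfolding A_def
      by (intro continuous_closed_preimage_constant) auto
    then have "compact A" unfolding A_def
      by (intro compact_eq_bounded_closed[THEN iffD2] conjI) (auto intro: bounded_subset[OF bounded_cball])
    moreover have "z \<in> A" using z e by (simp add: A_def)
    ultimately have "\<exists>x\<in>A. \<forall>x'\<in>A. dist y x \<le> dist y x'"
      by (intro continuous_attains_inf continuous_intros) auto
    then obtain x0 where x0: "x0 \<in> A" "\<And>x. x \<in> A \<Longrightarrow> dist y x0 \<le> dist y x" by blast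
    define d where "d = dist y x0"
    have d0: "d > 0" using vy x0(1) by (auto simp: d_def A_def)
    have dle: "d < e / 2" using x0(2)[OF \<open>z \<in> A\<close>] dyz by (simp add: d_def)
    have inball: "x \<in> U \<and> m < ?v x" if "x \<in> ball y d" for x
    proof -
      have "dist z x \<le> dist z y + dist y x" by (rule dist_triangle)
      then have xc: "x \<in> cball z e" using that dle dyz by (simp add: dist_commute)
      then have "x \<in> U" using e by blast
      moreover have "?v x \<noteq> m"
      proof
        assume "?v x = m"
        then have "x \<in> A" using xc by (simp add: A_def)
        then show False using x0(2) that by (fastforce simp: d_def)
      qed
      ultimately show ?thesis using ge[of x] by simp
    qed
    have x0U: "x0 \<in> U" and v0: "?v x0 = m" using x0(1) e(2) by (auto simp: A_def)
    obtain e' l K L where e': "e' > 0" and l: "l > 0" "K \<ge> 0" "L \<ge> 0"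
      and b: "\<And>x. x \<in> \<Omega> \<inter> ball x0 e' \<Longrightarrow>
        (\<forall>y. l * (norm y)\<^sup>2 \<le> quad_form a11 a12 a22 x y) \<and> a11 x + a22 x \<le> L \<and>
        a11 x * H11 k g1 g2 x + 2 * a12 x * H12 k g1 g2 x + a22 x * H22 k g1 g2 x
          \<le> K * (\<bar>G1 k g1 g2 x\<bar> + \<bar>G2 k g1 g2 x\<bar>)"
      using local_bounds[of x0 g1 k g2, OF _ ell[OF x0U] ne[OF x0U v0]] x0U assms(2) \<Omega>_S by blast
    \<comment> \<open>A smaller disc, internally tangent at \<open>x0\<close> to the disc of radius
      \<open>d\<close> about \<open>y\<close>, lies where the estimates from
      \<open>local_bounds\<close> hold.\<close>
    define R where "R = min (d/2) (e'/2)"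
    have R: "R > 0" "R \<le> d / 2" "R \<le> e' / 2" using d0 e' by (auto simp: R_def)
    define c where "c = x0 + (R / d) *\<^sub>R (y - x0)"
    have ny: "norm (y - x0) = d" by (simp add: d_def dist_norm)
    have dc: "dist c x0 = R" using R d0 by (simp add: c_def dist_norm ny)
    have "c - y = (R / d - 1) *\<^sub>R (y - x0)" by (simp add: c_def algebra_simps)
    then have "dist c y = \<bar>R / d - 1\<bar> * d" by (simp add: dist_norm ny)
    also have "\<bar>R / d - 1\<bar> = 1 - R / d" using R d0 by (simp add: field_simps)
    also have "(1 - R / d) * d = d - R" using d0 by (simp add: left_diff_distrib)
    finally have dcy: "dist c y = d - R" .
    have sub: "x \<in> \<Omega> \<inter> ball x0 e'" "m < ?v x" if "x \<in> ball c R" for x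
    proof -
      have "dist y x \<le> dist y c + dist c x" by (rule dist_triangle)
      then have "x \<in> ball y d" using that dcy by (simp add: dist_commute)
      then have "x \<in> U" "m < ?v x" using inball by auto
      moreover have "dist x0 x \<le> dist x0 c + dist c x" by (rule dist_triangle)
      then have "x \<in> ball x0 e'" using that dc R by (simp add: dist_commute)
      ultimately show "x \<in> \<Omega> \<inter> ball x0 e'" "m < ?v x" using assms(2) by auto
    qed
    have "cball c R \<subseteq> cball z e"
    proof
      fix x assume "x \<in> cball c R"
      moreover have "dist z x \<le> dist z y + dist y c + dist c x"
        by (meson add_right_mono dist_triangle order_trans)
      ultimately show "x \<in> cball z e" using dcy dyz dle by (simp add: dist_commute)
    qed
    then have cont_v: "continuous_on (cball c R) ?v"
      using \<open>continuous_on (cball z e) ?v\<close> continuous_on_subset by blast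
    have "\<exists>\<kappa>>0. \<forall>s\<in>{0..1/2}. m + \<kappa> * s \<le> ?v (x0 + s *\<^sub>R (c - x0))"
      by (rule hopf_boundary_point[OF R(1) dc cont_v dG dG1 dG2 l, where ?a11.0 = a11 and ?a12.0 = a12 and ?a22.0 = a22])
         (use sub b in blast)+
    then obtain \<kappa> where \<kappa>: "\<kappa> > 0" "\<And>s. s \<in> {0..1/2} \<Longrightarrow> m + \<kappa> * s \<le> ?v (x0 + s *\<^sub>R (c - x0))"
      by blast
    have x0\<Omega>: "x0 \<in> \<Omega>" using x0U assms(2) by blast
    note lm = local_min_second_derivative(1,2)[OF assms(1) x0U dG dG1[OF x0\<Omega>] dG2[OF x0\<Omega>]]
    have G0: "G1 k g1 g2 x0 = 0" "G2 k g1 g2 x0 = 0"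
      using lm ge v0 assms(2) by blast+
    have "((\<lambda>s. ?v (x0 + s *\<^sub>R (c - x0))) has_real_derivative lin (G1 k g1 g2 x0) (G2 k g1 g2 x0) (c - x0))
        (at 0 within {0..1/2})"
      by (rule has_derivative_lin_line[where T = UNIV]) (use dG[OF x0\<Omega>] in auto)
    then have "\<kappa> \<le> lin (G1 k g1 g2 x0) (G2 k g1 g2 x0) (c - x0)"
      by (rule derivative_ge_of_linear_growth) (use \<kappa> v0 in auto)
    then show False using G0 \<kappa>(1) by simp
  qed
  then show "\<exists>e>0. ball z e \<subseteq> {x \<in> U. ?v x = m}" using e(1) by (intro exI[of _ "e/2"]) auto
qed

definition half_ball :: "real \<times> real \<Rightarrow> real \<times> real \<Rightarrow> real \<Rightarrow> (real \<times> real) set" where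
  "half_ball x0 \<nu> e = {x \<in> ball x0 e. 0 \<le> (x - x0) \<bullet> \<nu>}"

text \<open>Here \<open>\<nu>\<close> points into \<open>\<Omega>\<close>. The diameter of the half
  disc is included in \<open>S\<close>, so that all functions of the locale are continuous up to
  it.\<close>

definition flat_at :: "real \<times> real \<Rightarrow> real \<times> real \<Rightarrow> real \<Rightarrow> bool" where
  "flat_at x0 \<nu> e \<longleftrightarrow> e > 0 \<and> norm \<nu> = 1 \<and> \<Omega> \<inter> ball x0 e = {x \<in> ball x0 e. 0 < (x - x0) \<bullet> \<nu>} \<and>
     half_ball x0 \<nu> e \<subseteq> S"

lemma flat_at_mono: "flat_at x \<nu> e \<Longrightarrow> 0 < e' \<Longrightarrow> e' \<le> e \<Longrightarrow> flat_at x \<nu> e'"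
  unfolding flat_at_def half_ball_def by fastforce

lemma flat_at_derivative:
  assumes "flat_at x0 \<nu> e"
    and "continuous_on S g" "continuous_on S g1" "continuous_on S g2"
    and "\<And>x. x \<in> \<Omega> \<Longrightarrow> (g has_derivative lin (g1 x) (g2 x)) (at x)"
  shows "(g has_derivative lin (g1 x0) (g2 x0)) (at x0 within half_ball x0 \<nu> e)"
proof (rule has_derivative_lin_extend[where U = "\<Omega> \<inter> ball x0 e"])
  have h: "e > 0" "\<Omega> \<inter> ball x0 e = {x \<in> ball x0 e. 0 < (x - x0) \<bullet> \<nu>}" "half_ball x0 \<nu> e \<subseteq> S"
    using assms(1) by (auto simp: flat_at_def)
  have "{x \<in> ball x0 e. 0 < (x - x0) \<bullet> \<nu>} = ball x0 e \<inter> {x. \<nu> \<bullet> x > \<nu> \<bullet> x0}"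
    by (auto simp: inner_diff_right inner_commute[of _ \<nu>])
  then show "convex (\<Omega> \<inter> ball x0 e)"
    unfolding h(2) by (simp add: convex_Int convex_halfspace_gt)
  show "\<Omega> \<inter> ball x0 e \<subseteq> half_ball x0 \<nu> e" unfolding h(2) by (auto simp: half_ball_def)
  show "half_ball x0 \<nu> e \<subseteq> closure (\<Omega> \<inter> ball x0 e)"
  proof
    fix x assume "x \<in> half_ball x0 \<nu> e"
    then have "x \<in> ball x0 e \<inter> closure \<Omega>" using h(3) S_closure by (auto simp: half_ball_def)
    then show "x \<in> closure (\<Omega> \<inter> ball x0 e)"
      using open_Int_closure_subset[of "ball x0 e" \<Omega>] by (auto simp: Int_commute)
  qed
  show "x0 \<in> half_ball x0 \<nu> e" using h(1) by (simp add: half_ball_def)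
  show "continuous_on (half_ball x0 \<nu> e) g" "continuous_on (half_ball x0 \<nu> e) g1"
    "continuous_on (half_ball x0 \<nu> e) g2"
    using assms(2-4) h(3) continuous_on_subset by blast+
qed (use assms(5) in auto)

lemma flat_at_tangential_derivative:
  assumes "flat_at x0 \<nu> e" and "norm \<tau> = 1" and "\<tau> \<bullet> \<nu> = 0"
    and "continuous_on S g" "continuous_on S g1" "continuous_on S g2"
    and "\<And>x. x \<in> \<Omega> \<Longrightarrow> (g has_derivative lin (g1 x) (g2 x)) (at x)"
  shows "((\<lambda>u. g (x0 + u *\<^sub>R \<tau>)) has_real_derivative lin (g1 x0) (g2 x0) \<tau>) (at 0)"
proof -
  have "e > 0" using assms(1) by (simp add: flat_at_def)
  have "((\<lambda>u. g (x0 + u *\<^sub>R \<tau>)) has_real_derivative lin (g1 x0) (g2 x0) \<tau>) (at 0 within {-e<..<e})"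
    by (rule has_derivative_lin_line[where T = "half_ball x0 \<nu> e"])
       (use flat_at_derivative[OF assms(1,4-7)] assms(2,3) in \<open>auto simp: half_ball_def dist_norm\<close>)
  then show ?thesis using \<open>e > 0\<close> by (simp add: at_within_open[of 0 "{-e<..<e}"])
qed

text \<open>The factor \<open>c\<close> is there for Hopf's lemma, whose estimate is parametrised by
  the segment from \<open>x0\<close> to the centre of a disc of that radius.\<close>

lemma flat_at_normal_derivative:
  assumes "flat_at x0 \<nu> e" and "0 < b" and "b * c < e" and "c > 0"
    and "continuous_on S g" "continuous_on S g1" "continuous_on S g2"
    and "\<And>x. x \<in> \<Omega> \<Longrightarrow> (g has_derivative lin (g1 x) (g2 x)) (at x)"
    and "\<And>u. u \<in> {0..b} \<Longrightarrow> g x0 + k * u \<le> g (x0 + u *\<^sub>R (c *\<^sub>R \<nu>))"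
  shows "k \<le> c * lin (g1 x0) (g2 x0) \<nu>"
proof -
  have n: "norm \<nu> = 1" using assms(1) by (simp add: flat_at_def)
  have "((\<lambda>u. g (x0 + u *\<^sub>R (c *\<^sub>R \<nu>))) has_real_derivative lin (g1 x0) (g2 x0) (c *\<^sub>R \<nu>)) (at 0 within {0..b})"
  proof (rule has_derivative_lin_line[where T = "half_ball x0 \<nu> e"])
    show "(g has_derivative lin (g1 x0) (g2 x0)) (at (x0 + 0 *\<^sub>R (c *\<^sub>R \<nu>)) within half_ball x0 \<nu> e)"
      using flat_at_derivative[OF assms(1,5-8)] by simp
    fix u assume u: "u \<in> {0..b}"
    then have "u * c \<le> b * c" using assms(4) by (intro mult_right_mono) auto
    then have "u * c < e" using assms(3) by simp
    then show "x0 + u *\<^sub>R (c *\<^sub>R \<nu>) \<in> half_ball x0 \<nu> e"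
      using u assms(2-4) n by (auto simp: half_ball_def dist_norm)
  qed
  then have "k \<le> lin (g1 x0) (g2 x0) (c *\<^sub>R \<nu>)"
    by (rule derivative_ge_of_linear_growth) (use assms(2,9) in auto)
  then show ?thesis by (simp add: algebra_simps)
qed

text \<open>
  At a boundary minimum the tangential derivatives of both \<open>D\<phi> \<bullet> \<nu>\<close> and \<open>D\<phi> \<bullet> \<gamma>\<close> vanish, so the
  Hessian is a multiple of \<open>\<nu> \<otimes> \<nu>\<close>, and the equation makes it zero, contradicting Hopf's lemma.
\<close>

lemma flat_boundary_not_minimum:
  assumes flat: "flat_at x0 (n1, n2) e"
    and neumann: "\<And>x. x \<in> ball x0 e \<Longrightarrow> (x - x0) \<bullet> (n1, n2) = 0 \<Longrightarrow> (p x, q x) \<bullet> (n1, n2) = 0"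
    and ell: "\<And>y. y \<noteq> 0 \<Longrightarrow> quad_form a11 a12 a22 x0 y > 0"
    and indep: "g1 * n2 - g2 * n1 \<noteq> 0"
    and gt: "\<And>x. x \<in> \<Omega> \<Longrightarrow> m < G 0 g1 g2 x"
  shows "G 0 g1 g2 x0 \<noteq> m"
proof
  let ?w = "G 0 g1 g2"
  let ?n = "(n1, n2)" and ?t = "(n2, - n1)"
  assume w0: "?w x0 = m"
  have h: "e > 0" "norm ?n = 1" "\<Omega> \<inter> ball x0 e = {x \<in> ball x0 e. 0 < (x - x0) \<bullet> ?n}"
    "half_ball x0 ?n e \<subseteq> S"
    using flat by (auto simp: flat_at_def)
  have "x0 \<in> S" using h(1,4) by (auto simp: half_ball_def)
  have nn: "n1\<^sup>2 + n2\<^sup>2 = 1" using h(2) by (simp add: norm_Pair)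
  have t: "norm ?t = 1" "?t \<bullet> ?n = 0" using nn by (auto simp: norm_Pair add.commute)
  have ge: "m \<le> ?w x" if "x \<in> S" for x
    by (rule continuous_ge_on_closure_subset[OF continuous_G that _ \<Omega>_S])
       (use that S_closure gt in \<open>auto intro: less_imp_le\<close>)
  have tang: "x0 + u *\<^sub>R ?t \<in> half_ball x0 ?n e" "x0 + u *\<^sub>R ?t \<in> ball x0 e"
    "(x0 + u *\<^sub>R ?t - x0) \<bullet> ?n = 0" if "\<bar>u\<bar> < e" for u
  proof -
    have "norm (u *\<^sub>R ?t) < e" using that t(1) by (simp only: norm_scaleR)
    moreover have "dist x0 (x0 + v) = norm v" for v by (simp add: dist_norm)
    ultimately show b: "x0 + u *\<^sub>R ?t \<in> ball x0 e" by (simp only: mem_ball)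
    show z: "(x0 + u *\<^sub>R ?t - x0) \<bullet> ?n = 0" using t(2) by (simp only: add_diff_cancel_left' inner_scaleR_left)
    show "x0 + u *\<^sub>R ?t \<in> half_ball x0 ?n e" using b z by (simp add: half_ball_def)
  qed
  have tw: "lin (G1 0 g1 g2 x0) (G2 0 g1 g2 x0) ?t = 0"
  proof (rule DERIV_local_min)
    show "((\<lambda>u. ?w (x0 + u *\<^sub>R ?t)) has_real_derivative lin (G1 0 g1 g2 x0) (G2 0 g1 g2 x0) ?t) (at 0)"
      by (rule flat_at_tangential_derivative[OF flat t continuous_G continuous_G1 continuous_G2 dG])
    show "e > 0" by (rule h(1))
    show "\<forall>u. \<bar>0 - u\<bar> < e \<longrightarrow> ?w (x0 + 0 *\<^sub>R ?t) \<le> ?w (x0 + u *\<^sub>R ?t)"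
    proof (intro allI impI)
      fix u assume "\<bar>0 - u\<bar> < e"
      then have "m \<le> ?w (x0 + u *\<^sub>R ?t)" using tang(1)[of u] h(4) ge by (metis abs_minus diff_0 subsetD)
      then show "?w (x0 + 0 *\<^sub>R ?t) \<le> ?w (x0 + u *\<^sub>R ?t)"
        by (simp only: scaleR_zero_left add_0_right w0)
    qed
  qed
  have tn: "lin (G1 0 n1 n2 x0) (G2 0 n1 n2 x0) ?t = 0"
  proof (rule DERIV_local_const)
    show "((\<lambda>u. G 0 n1 n2 (x0 + u *\<^sub>R ?t)) has_real_derivative lin (G1 0 n1 n2 x0) (G2 0 n1 n2 x0) ?t) (at 0)"
      by (rule flat_at_tangential_derivative[OF flat t continuous_G continuous_G1 continuous_G2 dG])
    show "e > 0" by (rule h(1))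
    have "G 0 n1 n2 (x0 + u *\<^sub>R ?t) = 0" if "\<bar>u\<bar> < e" for u
      using neumann[OF tang(2,3)[OF that]] by (simp add: G_def mult.commute)
    from this this[of 0] h(1)
    show "\<forall>u. \<bar>0 - u\<bar> < e \<longrightarrow> G 0 n1 n2 (x0 + 0 *\<^sub>R ?t) = G 0 n1 n2 (x0 + u *\<^sub>R ?t)" by simp
  qed
  let ?r = "r x0" and ?s = "s x0" and ?u = "t x0"
  have e1: "g1 * (?r * n2 - ?s * n1) + g2 * (?s * n2 - ?u * n1) = 0"
    and e2: "n1 * (?r * n2 - ?s * n1) + n2 * (?s * n2 - ?u * n1) = 0"
    using tw tn by (auto simp: G1_def G2_def algebra_simps)
  \<comment> \<open>By \<open>e1\<close> and \<open>e2\<close> the image of the tangent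
    \<open>?t\<close> under the Hessian is orthogonal to \<open>(g1, g2)\<close> and to the normal.
    These are independent by \<open>indep\<close>, so the image is zero; \<open>f1\<close> and
    \<open>f2\<close> are Cramer's rule.\<close>
  have "(g1 * n2 - g2 * n1) * (?r * n2 - ?s * n1)
      = n2 * (g1 * (?r * n2 - ?s * n1) + g2 * (?s * n2 - ?u * n1))
        - g2 * (n1 * (?r * n2 - ?s * n1) + n2 * (?s * n2 - ?u * n1))" by (simp add: algebra_simps)
  then have f1: "?r * n2 = ?s * n1" using e1 e2 indep by simp
  have "(g1 * n2 - g2 * n1) * (?s * n2 - ?u * n1)
      = g1 * (n1 * (?r * n2 - ?s * n1) + n2 * (?s * n2 - ?u * n1))
        - n1 * (g1 * (?r * n2 - ?s * n1) + g2 * (?s * n2 - ?u * n1))" by (simp add: algebra_simps)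
  then have f2: "?s * n2 = ?u * n1" using e1 e2 indep by simp
  define c where "c = ?r + ?u"
  have r: "?r = c * n1\<^sup>2"
  proof -
    have "?r = ?r * (n1\<^sup>2 + n2\<^sup>2)" unfolding nn by simp
    also have "\<dots> = ?r * n1\<^sup>2 + (?r * n2) * n2" by (simp add: algebra_simps power2_eq_square)
    also have "\<dots> = ?r * n1\<^sup>2 + (?s * n2) * n1" unfolding f1 by simp
    also have "\<dots> = c * n1\<^sup>2" unfolding f2 c_def by (simp add: algebra_simps power2_eq_square)
    finally show ?thesis .
  qed
  have s: "?s = c * n1 * n2"
  proof -
    have "?s = ?s * (n1\<^sup>2 + n2\<^sup>2)" unfolding nn by simp
    also have "\<dots> = (?s * n1) * n1 + (?s * n2) * n2" by (simp add: algebra_simps power2_eq_square)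
    also have "\<dots> = c * n1 * n2" unfolding f1[symmetric] f2 c_def by (simp add: algebra_simps)
    finally show ?thesis .
  qed
  have u: "?u = c * n2\<^sup>2"
  proof -
    have "?u = c * (n1\<^sup>2 + n2\<^sup>2) - ?r" using nn by (simp add: c_def)
    then show ?thesis unfolding r by (simp add: algebra_simps)
  qed
  have "c * quad_form a11 a12 a22 x0 ?n = a11 x0 * ?r + 2 * a12 x0 * ?s + a22 x0 * ?u"
    unfolding r s u by (simp add: quad_form_def algebra_simps)
  also have "\<dots> = 0" by (rule eq[OF \<open>x0 \<in> S\<close>])
  finally have "c = 0" using ell[of ?n] h(2) by fastforce
  then have flat0: "G1 0 g1 g2 x0 = 0" "G2 0 g1 g2 x0 = 0"
    using r s u by (auto simp: G1_def G2_def)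
  have ne: "(g1 + 0 * p x0, g2 + 0 * q x0) \<noteq> 0" using indep by (auto simp: zero_prod_def)
  obtain e' l K L where e': "e' > 0" and l: "l > 0" "K \<ge> 0" "L \<ge> 0"
    and b: "\<And>x. x \<in> \<Omega> \<inter> ball x0 e' \<Longrightarrow>
      (\<forall>y. l * (norm y)\<^sup>2 \<le> quad_form a11 a12 a22 x y) \<and> a11 x + a22 x \<le> L \<and>
      a11 x * H11 0 g1 g2 x + 2 * a12 x * H12 0 g1 g2 x + a22 x * H22 0 g1 g2 x
        \<le> K * (\<bar>G1 0 g1 g2 x\<bar> + \<bar>G2 0 g1 g2 x\<bar>)"
    using local_bounds[OF \<open>x0 \<in> S\<close> ell ne] by blast
  \<comment> \<open>The points of the closed disc of radius \<open>R\<close> tangent to the boundary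
    at \<open>x0\<close> have distance at most \<open>2 * R\<close> from \<open>x0\<close>; the
    factor 3 keeps them inside both neighbourhoods.\<close>
  define R where "R = min e e' / 3"
  have R: "R > 0" "3 * R \<le> e" "3 * R \<le> e'" using h(1) e' by (auto simp: R_def)
  define c where "c = x0 + R *\<^sub>R ?n"
  have dc: "dist c x0 = R" using R h(2) by (simp only: c_def dist_norm add_diff_cancel_left' norm_scaleR)
  have normal: "(x - x0) \<bullet> ?n \<ge> R - dist c x" "dist x0 x \<le> R + dist c x" for x
  proof -
    have "(x - x0) \<bullet> ?n = (x - c) \<bullet> ?n + R * (?n \<bullet> ?n)"
      unfolding c_def inner_diff_left inner_add_left inner_scaleR_left by simp
    also have "?n \<bullet> ?n = 1" using nn by (simp add: power2_eq_square)
    finally have "(x - x0) \<bullet> ?n = (x - c) \<bullet> ?n + R" by simp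
    moreover have "\<bar>(x - c) \<bullet> ?n\<bar> \<le> dist c x"
      using Cauchy_Schwarz_ineq2[of "x - c" ?n] h(2) by (simp add: dist_norm norm_minus_commute)
    ultimately show "(x - x0) \<bullet> ?n \<ge> R - dist c x" by linarith
    show "dist x0 x \<le> R + dist c x" using dist_triangle[of x0 x c] dc by (simp add: dist_commute)
  qed
  have sub: "x \<in> \<Omega> \<inter> ball x0 e'" if "x \<in> ball c R" for x
  proof -
    have "x \<in> ball x0 e" "0 < (x - x0) \<bullet> ?n" using normal[of x] that R by auto
    then have "x \<in> \<Omega>" using h(3) by blast
    then show ?thesis using normal(2)[of x] that R by auto
  qed
  have "cball c R \<subseteq> half_ball x0 ?n e"
  proof
    fix x assume "x \<in> cball c R"
    then show "x \<in> half_ball x0 ?n e" using normal[of x] R unfolding half_ball_def by auto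
  qed
  then have cont_w: "continuous_on (cball c R) ?w"
    using h(4) continuous_on_subset[OF continuous_G] by blast
  have "\<exists>\<kappa>>0. \<forall>s\<in>{0..1/2}. m + \<kappa> * s \<le> ?w (x0 + s *\<^sub>R (c - x0))"
    by (rule hopf_boundary_point[OF R(1) dc cont_w dG dG1 dG2 l, where ?a11.0 = a11 and ?a12.0 = a12 and ?a22.0 = a22])
       (use sub b gt in blast)+
  then obtain \<kappa> where \<kappa>: "\<kappa> > 0" "\<And>s. s \<in> {0..1/2} \<Longrightarrow> m + \<kappa> * s \<le> ?w (x0 + s *\<^sub>R (c - x0))"
    by blast
  have "c - x0 = R *\<^sub>R ?n" by (simp add: c_def)
  then have "\<kappa> \<le> R * lin (G1 0 g1 g2 x0) (G2 0 g1 g2 x0) ?n"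
    using \<kappa>(2) w0 R
    by (intro flat_at_normal_derivative[OF flat, of "1/2" R ?w, OF _ _ _ continuous_G continuous_G1 continuous_G2 dG]) auto
  then show False using \<kappa>(1) unfolding flat0 by simp
qed

text \<open>As \<open>q\<close> vanishes along the face, the mixed derivative is zero at
  \<open>x0\<close> and the equation gives the two pure second derivatives opposite signs. The sign
  of \<open>q\<close> inside decides that of \<open>t x0\<close>.\<close>

lemma flat_boundary_slope:
  assumes flat: "flat_at x0 (0, 1) e"
    and neumann: "\<And>x. x \<in> ball x0 e \<Longrightarrow> (x - x0) \<bullet> (0, 1) = 0 \<Longrightarrow> q x = 0"
    and ell: "\<And>y. y \<noteq> 0 \<Longrightarrow> quad_form a11 a12 a22 x0 y > 0"
    and le: "\<And>x. x \<in> \<Omega> \<inter> ball x0 e \<Longrightarrow> q x \<le> 0"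
  shows "((\<lambda>u. p (x0 + u *\<^sub>R (1, 0))) has_real_derivative r x0) (at 0)" and "r x0 \<ge> 0"
proof -
  have h: "e > 0" "\<Omega> \<inter> ball x0 e = {x \<in> ball x0 e. 0 < (x - x0) \<bullet> (0, 1)}" "half_ball x0 (0, 1) e \<subseteq> S"
    using flat by (auto simp: flat_at_def)
  have "x0 \<in> S" using h(1,3) by (auto simp: half_ball_def)
  have t: "norm (1::real, 0::real) = 1" "(1::real, 0::real) \<bullet> (0, 1) = 0" by (auto simp: norm_Pair)
  show "((\<lambda>u. p (x0 + u *\<^sub>R (1, 0))) has_real_derivative r x0) (at 0)"
    using flat_at_tangential_derivative[OF flat t cont(1,3,4) dp] by simp
  have inb: "x0 + u *\<^sub>R (1, 0) \<in> ball x0 e" if "\<bar>u\<bar> < e" for u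
    using that by (simp add: dist_norm norm_Pair)
  have "lin (s x0) (t x0) (1, 0) = 0"
  proof (rule DERIV_local_const)
    show "((\<lambda>u. q (x0 + u *\<^sub>R (1, 0))) has_real_derivative lin (s x0) (t x0) (1, 0)) (at 0)"
      by (rule flat_at_tangential_derivative[OF flat t cont(2,4,5) dq])
    have "q (x0 + u *\<^sub>R (1, 0)) = 0" if "\<bar>u\<bar> < e" for u
      by (rule neumann[OF inb[OF that]]) simp
    from this this[of 0] h(1)
    show "\<forall>u. \<bar>0 - u\<bar> < e \<longrightarrow> q (x0 + 0 *\<^sub>R (1, 0)) = q (x0 + u *\<^sub>R (1, 0))" by simp
  qed (rule h(1))
  then have s: "s x0 = 0" by simp
  have q0: "q x0 = 0" by (rule neumann) (use h(1) in auto)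
  have "0 \<le> 1 * lin (- s x0) (- t x0) (0, 1)"
  proof (rule flat_at_normal_derivative[OF flat, of "e/2" 1 "\<lambda>x. - q x"])
    show "continuous_on S (\<lambda>x. - q x)" "continuous_on S (\<lambda>x. - s x)" "continuous_on S (\<lambda>x. - t x)"
      by (intro continuous_intros cont)+
    show "((\<lambda>x. - q x) has_derivative lin (- s x) (- t x)) (at x)" if "x \<in> \<Omega>" for x
      by (rule derivative_eq_intros dq[OF that] refl | simp add: fun_eq_iff)+
    fix u assume u: "u \<in> {0..e/2}"
    have "q (x0 + u *\<^sub>R (0, 1)) \<le> 0"
    proof (cases "u = 0")
      case True
      then show ?thesis using q0 by (simp add: zero_prod_def[symmetric])
    next
      case False
      then have "x0 + u *\<^sub>R (0, 1) \<in> {x \<in> ball x0 e. 0 < (x - x0) \<bullet> (0, 1)}"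
        using u h(1) by (auto simp: dist_norm norm_Pair)
      then show ?thesis using le h(2) by blast
    qed
    then show "- q x0 + 0 * u \<le> - q (x0 + u *\<^sub>R (1 *\<^sub>R (0, 1)))" using q0 by simp
  qed (use h(1) in auto)
  then have "t x0 \<le> 0" by simp
  moreover have "a11 x0 > 0" "a22 x0 > 0"
    using ell[of "(1, 0)"] ell[of "(0, 1)"] by (auto simp: quad_form_def zero_prod_def)
  moreover have "a11 x0 * r x0 = - (a22 x0 * t x0)" using eq[OF \<open>x0 \<in> S\<close>] s by simp
  ultimately have "0 \<le> a11 x0 * r x0" by (simp add: mult_nonneg_nonpos)
  then show "r x0 \<ge> 0" using \<open>a11 x0 > 0\<close> by (simp add: zero_le_mult_iff)
qed

definition neumann_face_at :: "real \<times> real \<Rightarrow> real \<times> real \<Rightarrow> bool" where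
  "neumann_face_at x0 \<nu> \<longleftrightarrow> (\<exists>e. flat_at x0 \<nu> e \<and>
     (\<forall>x\<in>ball x0 e. (x - x0) \<bullet> \<nu> = 0 \<longrightarrow> (p x, q x) \<bullet> \<nu> = 0)) \<and>
     (\<forall>y. y \<noteq> 0 \<longrightarrow> quad_form a11 a12 a22 x0 y > 0)"

text \<open>The minimum over the closure is attained neither inside nor, by
  \<open>flat_boundary_not_minimum\<close>, on a face whose normal is independent of
  \<open>(g1, g2)\<close>; at all other points the value is nonnegative by \<open>bdry\<close>. The
  point \<open>c\<close> stands for the corner.\<close>

lemma directional_derivative_positive:
  assumes "connected \<Omega>" and "bounded \<Omega>"
    and contp: "continuous_on (closure \<Omega>) p" and contq: "continuous_on (closure \<Omega>) q"
    and ell: "\<And>x y. x \<in> \<Omega> \<Longrightarrow> y \<noteq> 0 \<Longrightarrow> quad_form a11 a12 a22 x y > 0"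
    and c: "c \<in> closure \<Omega>" "p c = 0" "q c = 0"
    and nonconst: "\<exists>x\<in>\<Omega>. (p x, q x) \<noteq> 0"
    and bdry: "\<And>x. x \<in> closure \<Omega> \<Longrightarrow> x \<in> \<Omega> \<or> 0 \<le> (p x, q x) \<bullet> (g1, g2) \<or>
      (\<exists>n1 n2. neumann_face_at x (n1, n2) \<and> g1 * n2 - g2 * n1 \<noteq> 0)"
    and \<gamma>: "(g1, g2) \<noteq> 0"
  shows "\<And>x. x \<in> closure \<Omega> \<Longrightarrow> 0 \<le> (p x, q x) \<bullet> (g1, g2)"
    and "\<And>x. x \<in> \<Omega> \<Longrightarrow> 0 < (p x, q x) \<bullet> (g1, g2)"
    and "\<And>x n1 n2. neumann_face_at x (n1, n2) \<Longrightarrow> g1 * n2 - g2 * n1 \<noteq> 0 \<Longrightarrow> 0 < (p x, q x) \<bullet> (g1, g2)"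
proof -
  let ?w = "G 0 g1 g2"
  have w: "?w x = (p x, q x) \<bullet> (g1, g2)" for x by (simp add: G_def mult.commute)
  have contw: "continuous_on (closure \<Omega>) ?w"
    unfolding G_def[abs_def] by (intro continuous_intros contp contq)
  have comp: "compact (closure \<Omega>)" using assms(2) by (simp add: compact_closure)
  have "\<exists>x\<in>closure \<Omega>. \<forall>y\<in>closure \<Omega>. ?w x \<le> ?w y"
    by (rule continuous_attains_inf[OF comp _ contw]) (use c(1) in auto)
  then obtain z where z: "z \<in> closure \<Omega>" "\<And>y. y \<in> closure \<Omega> \<Longrightarrow> ?w z \<le> ?w y" by blast
  define m where "m = ?w z"
  have sub: "\<Omega> \<subseteq> closure \<Omega>" by (rule closure_subset)
  have const: "g c = k" if "continuous_on (closure \<Omega>) g" "\<And>y. y \<in> \<Omega> \<Longrightarrow> g y = k"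
    for g :: "real \<times> real \<Rightarrow> real" and k
    by (rule continuous_constant_on_closure[OF that c(1)])
  have gt: "m < ?w x" if x: "x \<in> \<Omega>" for x
  proof (rule ccontr)
    assume "\<not> m < ?w x"
    moreover have ge: "m \<le> ?w y" if "y \<in> \<Omega>" for y using z(2) sub that unfolding m_def by blast
    ultimately have wx: "?w x = m" using ge[OF x] by linarith
    let ?Z = "{x \<in> \<Omega>. ?w x = m}"
    have "open ?Z" by (rule open_minimum_set[OF open_\<Omega> order_refl ell ge]) (use \<gamma> in auto)
    moreover have "closedin (top_of_set \<Omega>) ?Z"
      by (rule continuous_closedin_preimage_constant)
         (rule continuous_on_subset[OF contw sub])
    moreover have "openin (top_of_set \<Omega>) ?Z" using \<open>open ?Z\<close> by (intro open_openin_trans[OF open_\<Omega>]) auto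
    ultimately have "?Z = {} \<or> ?Z = \<Omega>" using assms(1) unfolding connected_clopen by blast
    then have all: "?w y = m" if "y \<in> \<Omega>" for y using x wx that by blast
    \<comment> \<open>A constant directional derivative makes the whole Hessian vanish, by
      \<open>hessian_from_gradient\<close>. The gradient is then constant and equal to its value
      zero at \<open>c\<close>, against \<open>nonconst\<close>.\<close>
    have hess: "r y = 0 \<and> s y = 0 \<and> t y = 0" if y: "y \<in> \<Omega>" for y
    proof -
      have "(?w has_derivative (\<lambda>h. 0)) (at y)"
        by (rule has_derivative_transform_within_open[of "\<lambda>x. m" _ _ _ \<Omega>]) (use open_\<Omega> y all in auto)
      from has_derivative_unique[OF dG[OF y] this]
      have "lin (G1 0 g1 g2 y) (G2 0 g1 g2 y) = (\<lambda>h. 0)" .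
      from fun_cong[OF this, of "(1, 0)"] fun_cong[OF this, of "(0, 1)"]
      have G0: "G1 0 g1 g2 y = 0" "G2 0 g1 g2 y = 0" by auto
      have "quad_form a11 a12 a22 y (g2, - g1) > 0"
        by (rule ell[OF y]) (use \<gamma> in \<open>auto simp: zero_prod_def\<close>)
      then show ?thesis using hessian_from_gradient[OF y, where k=0 and ?g1.0=g1 and ?g2.0=g2] G0 by simp
    qed
    obtain y where y: "y \<in> \<Omega>" "(p y, q y) \<noteq> 0" using nonconst by blast
    have "p y' = p y" if "y' \<in> \<Omega>" for y'
      by (rule has_derivative_zero_unique_connected[OF open_\<Omega> assms(1) _ that y(1)])
         (use dp hess in force)
    then have "p y = 0" using const[OF contp, of "p y"] c(2) by simp
    moreover have "q y' = q y" if "y' \<in> \<Omega>" for y'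
      by (rule has_derivative_zero_unique_connected[OF open_\<Omega> assms(1) _ that y(1)])
         (use dq hess in force)
    then have "q y = 0" using const[OF contq, of "q y"] c(3) by simp
    ultimately show False using y(2) by (simp add: zero_prod_def)
  qed
  have face: "?w x \<noteq> m" if f: "neumann_face_at x (n1, n2)" "g1 * n2 - g2 * n1 \<noteq> 0" for x n1 n2
  proof -
    obtain e where "flat_at x (n1, n2) e"
      "\<And>y. y \<in> ball x e \<Longrightarrow> (y - x) \<bullet> (n1, n2) = 0 \<Longrightarrow> (p y, q y) \<bullet> (n1, n2) = 0"
      "\<And>y. y \<noteq> 0 \<Longrightarrow> quad_form a11 a12 a22 x y > 0"
      using f(1) unfolding neumann_face_at_def by blast
    from flat_boundary_not_minimum[OF this f(2) gt] show ?thesis .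
  qed
  have m0: "m \<ge> 0"
    using bdry[OF z(1)]
  proof (elim disjE exE conjE)
    assume "z \<in> \<Omega>"
    then show ?thesis using gt[of z] by (simp add: m_def)
  next
    assume "0 \<le> (p z, q z) \<bullet> (g1, g2)"
    then show ?thesis unfolding m_def w .
  next
    fix n1 n2 assume "neumann_face_at z (n1, n2)" "g1 * n2 - g2 * n1 \<noteq> 0"
    from face[OF this] show ?thesis by (simp add: m_def)
  qed
  show ge0: "\<And>x. x \<in> closure \<Omega> \<Longrightarrow> 0 \<le> (p x, q x) \<bullet> (g1, g2)"
    using z(2) m0 unfolding m_def w by (meson order_trans)
  show "\<And>x. x \<in> \<Omega> \<Longrightarrow> 0 < (p x, q x) \<bullet> (g1, g2)"
    using gt m0 unfolding w by (meson le_less_trans)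
  fix x n1 n2 assume f: "neumann_face_at x (n1, n2)" "g1 * n2 - g2 * n1 \<noteq> 0"
  obtain e where "e > 0" "half_ball x (n1, n2) e \<subseteq> S"
    using f(1) unfolding neumann_face_at_def flat_at_def by blast
  then have "x \<in> S" by (auto simp: half_ball_def)
  then have "m \<le> ?w x" using z(2) S_closure unfolding m_def by blast
  then show "0 < (p x, q x) \<bullet> (g1, g2)" using face[OF f] m0 unfolding w by linarith
qed

text \<open>
  The image of \<open>D\<close> under the gradient map cannot have a boundary point in the open half disc: near
  such a point one could choose a centre off the image whose distance to the image is attained in
  the interior, against the minimum principle for the squared distance.
\<close>

lemma small_gradient_sign:
  assumes "open D" and "D \<subseteq> \<Omega>" and "bounded D"
    and contp: "continuous_on (closure D) p" and contq: "continuous_on (closure D) q"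
    and ell: "\<And>x y. x \<in> D \<Longrightarrow> y \<noteq> 0 \<Longrightarrow> quad_form a11 a12 a22 x y > 0"
    and bdry: "\<And>x. x \<in> closure D - D \<Longrightarrow> q x \<le> 0 \<or> d \<le> norm (p x, q x)"
    and miss: "norm P < d" "0 < snd P" "\<And>x. x \<in> closure D \<Longrightarrow> (p x, q x) \<noteq> P"
    and x: "x \<in> D" "norm (p x, q x) < d"
  shows "q x \<le> 0"
proof (rule ccontr)
  assume "\<not> q x \<le> 0"
  let ?f = "\<lambda>x. (p x, q x)"
  \<comment> \<open>By \<open>bdry\<close> only points of \<open>D\<close> are mapped into this open
    half disc. It is connected and contains \<open>P\<close> off the image as well as the image of
    \<open>x\<close>, hence also a frontier point of the image.\<close>
  define T where "T = ball (0 :: real \<times> real) d \<inter> {z. snd z > 0}"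
  have T: "z \<in> T \<longleftrightarrow> norm z < d \<and> 0 < snd z" for z by (auto simp: T_def)
  have hs: "{z :: real \<times> real. snd z > 0} = {z. (0, 1) \<bullet> z > 0}"
    by (auto simp: inner_prod_def)
  have "convex T" unfolding T_def hs by (intro convex_Int convex_ball convex_halfspace_gt)
  then have "connected T" by (rule convex_connected)
  have "open T" unfolding T_def hs by (intro open_Int open_ball open_halfspace_gt)
  define F where "F = ?f ` closure D"
  have contf: "continuous_on (closure D) ?f" by (intro continuous_intros contp contq)
  have compD: "compact (closure D)" using assms(3) by (simp add: compact_closure)
  have "compact F" unfolding F_def by (rule compact_continuous_image[OF contf compD])
  then have "closed F" by (rule compact_imp_closed)
  have inD: "y \<in> D" if "y \<in> closure D" "?f y \<in> T" for y
  proof (rule ccontr)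
    assume "y \<notin> D"
    with that(1) have "q y \<le> 0 \<or> d \<le> norm (?f y)" by (intro bdry) simp
    then show False using that(2) unfolding T by simp
  qed
  have "?f x \<in> T \<inter> F" using x \<open>\<not> q x \<le> 0\<close> closure_subset[of D] by (auto simp: T F_def)
  moreover have "P \<in> T" using miss(1,2) unfolding T by blast
  moreover have "P \<notin> F" unfolding F_def using miss(3) by (metis (no_types, lifting) imageE)
  ultimately have "T \<inter> frontier F \<noteq> {}"
    using connected_Int_frontier[OF \<open>connected T\<close>, of F] by blast
  then obtain P1 where P1: "P1 \<in> T" "P1 \<in> frontier F" by blast
  have "P1 \<in> F" using P1(2) frontier_subset_closed[OF \<open>closed F\<close>] by (rule subsetD[rotated])
  obtain e where e: "e > 0" "ball P1 e \<subseteq> T" using \<open>open T\<close> P1(1) open_contains_ball by blast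
  have "P1 \<notin> interior F" using P1(2) by (simp add: frontier_def)
  \<comment> \<open>With the centre \<open>P0\<close> within \<open>e / 2\<close> of
    \<open>P1\<close>, the image points nearest to \<open>P0\<close> are within \<open>e\<close> of
    \<open>P1\<close>. They lie in \<open>T\<close>, so all minimisers of the distance lie in
    \<open>D\<close>.\<close>
  then have "\<not> ball P1 (e/2) \<subseteq> F" using e(1) by (meson half_gt_zero mem_interior)
  then obtain P0 where P0: "dist P1 P0 < e / 2" "P0 \<notin> F" by (auto simp: subset_iff)
  have "\<exists>y\<in>closure D. \<forall>z\<in>closure D. dist (?f y) P0 \<le> dist (?f z) P0"
    by (rule continuous_attains_inf[OF compD])
       (use x closure_subset[of D] in \<open>auto intro!: continuous_intros contf\<close>)
  then obtain x2 where x2: "x2 \<in> closure D" "\<And>z. z \<in> closure D \<Longrightarrow> dist (?f x2) P0 \<le> dist (?f z) P0"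
    by blast
  have "dist (?f x2) P0 \<le> dist P1 P0" using x2(2) \<open>P1 \<in> F\<close> by (auto simp: F_def)
  then have close: "y \<in> D" if "y \<in> closure D" "dist (?f y) P0 = dist (?f x2) P0" for y
  proof -
    have "dist P1 (?f y) \<le> dist P1 P0 + dist P0 (?f y)" by (rule dist_triangle)
    then have "?f y \<in> ball P1 e" using that(2) P0(1) \<open>dist (?f x2) P0 \<le> dist P1 P0\<close>
      by (simp add: dist_commute)
    then show ?thesis using e(2) inD[OF that(1)] by blast
  qed
  obtain c1 c2 where c: "P0 = (c1, c2)" by (cases P0)
  let ?v = "G 1 (- c1) (- c2)"
  have v: "?v y = ((dist (?f y) P0)\<^sup>2 - (c1\<^sup>2 + c2\<^sup>2)) / 2" for y
    unfolding c dist_norm norm_pair_squared G_def by (simp add: power2_eq_square algebra_simps)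
  have veq: "?v y = ?v x2 \<longleftrightarrow> dist (?f y) P0 = dist (?f x2) P0" for y
    unfolding v by simp
  have cl: "D \<subseteq> closure D" by (rule closure_subset)
  let ?Z = "{y \<in> D. ?v y = ?v x2}"
  have opn: "open ?Z"
  proof (rule open_minimum_set[OF assms(1,2) ell])
    show "?v x2 \<le> ?v y" if "y \<in> D" for y
    proof -
      have "(dist (?f x2) P0)\<^sup>2 \<le> (dist (?f y) P0)\<^sup>2"
        using x2(2)[of y] that cl by (intro power_mono) auto
      then show ?thesis unfolding v by simp
    qed
    show "(- c1 + 1 * p y, - c2 + 1 * q y) \<noteq> 0" if "y \<in> D" for y
    proof
      assume "(- c1 + 1 * p y, - c2 + 1 * q y) = 0"
      then have "?f y = P0" by (simp add: c zero_prod_def)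
      then show False using that cl P0(2) unfolding F_def by blast
    qed
  qed
  have Z: "?Z = {y \<in> closure D. dist (?f y) P0 = dist (?f x2) P0}"
  proof (intro set_eqI iffI)
    fix y assume "y \<in> ?Z"
    then show "y \<in> {y \<in> closure D. dist (?f y) P0 = dist (?f x2) P0}"
      using cl veq[of y] by (simp add: subsetD)
  next
    fix y assume "y \<in> {y \<in> closure D. dist (?f y) P0 = dist (?f x2) P0}"
    then show "y \<in> ?Z" using close[of y] veq[of y] by simp
  qed
  have "closed {y \<in> closure D. dist (?f y) P0 = dist (?f x2) P0}"
    by (intro continuous_closed_preimage_constant continuous_intros contf closed_closure)
  then have "closed ?Z" unfolding Z .
  \<comment> \<open>The set of minimisers is open by the minimum principle and closed because it is
    the same in \<open>closure D\<close> as in \<open>D\<close>. Being nonempty and bounded, it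
    cannot be clopen in the plane.\<close>
  then have "?Z = {} \<or> ?Z = UNIV" using opn by (intro clopen[THEN iffD1] conjI)
  moreover have "x2 \<in> ?Z" using close[OF x2(1)] by simp
  ultimately have "?Z = UNIV" by (metis (no_types) empty_iff)
  moreover have "bounded ?Z" by (rule bounded_subset[OF assms(3)]) (rule Collect_restrict)
  ultimately have "bounded (UNIV :: (real \<times> real) set)" by (rule subst)
  then show False by simp
qed

end

lemma has_derivative_pderiv_upto:
  assumes "f differentiable at x" and "x \<in> U"
  shows "(f has_derivative lin (d_xi U f x) (d_eta U f x)) (at x)"
proof -
  let ?D = "frechet_derivative f (at x)"
  have D: "(f has_derivative ?D) (at x)" using assms(1) by (simp add: frechet_derivative_works)
  have l: "linear ?D" by (rule has_derivative_linear[OF D])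
  have "?D h = lin (d_xi U f x) (d_eta U f x) h" for h
  proof -
    have "?D h = ?D (fst h *\<^sub>R (1, 0) + snd h *\<^sub>R (0, 1))" by (cases h) simp
    also have "\<dots> = fst h * ?D (1, 0) + snd h * ?D (0, 1)"
      unfolding linear_add[OF l] linear_scale[OF l] by simp
    finally show ?thesis using assms(2) by (simp add: pderiv_upto_def mult.commute)
  qed
  then have "?D = lin (d_xi U f x) (d_eta U f x)" by (rule ext)
  with D show ?thesis by simp
qed

lemma Ck_upto_continuous_on: "Ck_upto k U S f \<Longrightarrow> continuous_on S f"
  by (cases k) auto

lemma Ck_upto_has_derivative:
  "Ck_upto (Suc k) U S f \<Longrightarrow> x \<in> U \<Longrightarrow> (f has_derivative lin (d_xi U f x) (d_eta U f x)) (at x)"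
  by (intro has_derivative_pderiv_upto) auto

lemma Ck_upto_d_xi: "Ck_upto (Suc k) U S f \<Longrightarrow> Ck_upto k U S (d_xi U f)"
  and Ck_upto_d_eta: "Ck_upto (Suc k) U S f \<Longrightarrow> Ck_upto k U S (d_eta U f)"
  by auto

text \<open>The names shared in the locale are justified by three uses of Schwarz's theorem inside
  \<open>\<Omega>\<close>, one for the second and two for the third derivatives; on the rest of
  \<open>S\<close> only continuity is claimed.\<close>

lemma hodograph_of_solution:
  assumes "open \<Omega>" and sub: "\<Omega> \<subseteq> S" "S \<subseteq> closure \<Omega>"
    and phi: "Ck_upto (Suc (Suc (Suc 0))) \<Omega> S phi"
    and a: "Ck_upto (Suc 0) \<Omega> S a11" "Ck_upto (Suc 0) \<Omega> S a12" "Ck_upto (Suc 0) \<Omega> S a22"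
    and eq: "\<And>x. x \<in> \<Omega> \<Longrightarrow> a11 x * d_xi \<Omega> (d_xi \<Omega> phi) x + 2 * a12 x * d_eta \<Omega> (d_xi \<Omega> phi) x
               + a22 x * d_eta \<Omega> (d_eta \<Omega> phi) x = 0"
  shows "hodograph \<Omega> S (d_xi \<Omega> phi) (d_eta \<Omega> phi)
    (d_xi \<Omega> (d_xi \<Omega> phi)) (d_eta \<Omega> (d_xi \<Omega> phi)) (d_eta \<Omega> (d_eta \<Omega> phi))
    (d_xi \<Omega> (d_xi \<Omega> (d_xi \<Omega> phi))) (d_xi \<Omega> (d_eta \<Omega> (d_xi \<Omega> phi)))
    (d_eta \<Omega> (d_eta \<Omega> (d_xi \<Omega> phi))) (d_eta \<Omega> (d_eta \<Omega> (d_eta \<Omega> phi)))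
    a11 a12 a22 (d_xi \<Omega> a11) (d_xi \<Omega> a12) (d_xi \<Omega> a22) (d_eta \<Omega> a11) (d_eta \<Omega> a12) (d_eta \<Omega> a22)"
proof -
  define p where "p = d_xi \<Omega> phi"
  define q where "q = d_eta \<Omega> phi"
  define r where "r = d_xi \<Omega> p"
  define s where "s = d_eta \<Omega> p"
  define t where "t = d_eta \<Omega> q"
  note p = Ck_upto_d_xi[OF phi, folded p_def] and q = Ck_upto_d_eta[OF phi, folded q_def]
  note r = Ck_upto_d_xi[OF p, folded r_def] and s = Ck_upto_d_eta[OF p, folded s_def]
    and s' = Ck_upto_d_xi[OF q] and t = Ck_upto_d_eta[OF q, folded t_def]
  note dphi = Ck_upto_has_derivative[OF phi, folded p_def q_def]
  note dp = Ck_upto_has_derivative[OF p, folded r_def s_def]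
  note dq' = Ck_upto_has_derivative[OF q, folded t_def]
  note dr = Ck_upto_has_derivative[OF r] and ds = Ck_upto_has_derivative[OF s]
    and dt = Ck_upto_has_derivative[OF t]
  have cO: "continuous_on \<Omega> g" if "Ck_upto k \<Omega> S g" for k g
    using Ck_upto_continuous_on[OF that] continuous_on_subset sub(1) by blast
  have m1: "d_xi \<Omega> q x = s x" if "x \<in> \<Omega>" for x
    by (rule mixed_partials_eq[OF assms(1) that dphi dp dq' cO[OF s] cO[OF s'], symmetric])
  have dq: "(q has_derivative lin (s x) (t x)) (at x)" if "x \<in> \<Omega>" for x
    using dq'[OF that] m1[OF that] by simp
  have m2: "d_eta \<Omega> r x = d_xi \<Omega> s x" if "x \<in> \<Omega>" for x
    by (rule mixed_partials_eq[OF assms(1) that dp dr ds cO[OF Ck_upto_d_eta[OF r]] cO[OF Ck_upto_d_xi[OF s]]])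
  have m3: "d_xi \<Omega> t x = d_eta \<Omega> s x" if "x \<in> \<Omega>" for x
    by (rule mixed_partials_eq[OF assms(1) that dq ds dt cO[OF Ck_upto_d_eta[OF s]] cO[OF Ck_upto_d_xi[OF t]], symmetric])
  show ?thesis
    unfolding p_def[symmetric] q_def[symmetric] r_def[symmetric] s_def[symmetric] t_def[symmetric]
  proof (unfold_locales)
    fix x assume x: "x \<in> \<Omega>"
    show "(p has_derivative lin (r x) (s x)) (at x)" by (rule dp[OF x])
    show "(q has_derivative lin (s x) (t x)) (at x)" by (rule dq[OF x])
    show "(r has_derivative lin (d_xi \<Omega> r x) (d_xi \<Omega> s x)) (at x)" using dr[OF x] m2[OF x] by simp
    show "(s has_derivative lin (d_xi \<Omega> s x) (d_eta \<Omega> s x)) (at x)" by (rule ds[OF x])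
    show "(t has_derivative lin (d_eta \<Omega> s x) (d_eta \<Omega> t x)) (at x)" using dt[OF x] m3[OF x] by simp
    show "(a11 has_derivative lin (d_xi \<Omega> a11 x) (d_eta \<Omega> a11 x)) (at x)"
      "(a12 has_derivative lin (d_xi \<Omega> a12 x) (d_eta \<Omega> a12 x)) (at x)"
      "(a22 has_derivative lin (d_xi \<Omega> a22 x) (d_eta \<Omega> a22 x)) (at x)"
      by (rule Ck_upto_has_derivative[OF _ x], rule a)+
    show "a11 x * r x + 2 * a12 x * s x + a22 x * t x = 0"
      using eq[OF x] by (simp add: p_def q_def r_def s_def t_def)
  qed (use assms(1) sub p q r s t a in \<open>auto intro: Ck_upto_continuous_on Ck_upto_d_xi Ck_upto_d_eta\<close>)
qed

section \<open>Geometry of the wedge\<close>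

text \<open>For angles between 0 and \<open>pi\<close> the wedge is the intersection of the two open
  half planes behind its faces, so its closure is the intersection of the closed ones.\<close>

lemma Lam_eq:
  assumes "0 < sg" and "sg < pi"
  shows "Lam sg = {x. 0 < snd x \<or> 0 < x \<bullet> (sin sg, cos sg)}"
proof -
  let ?n = "(sin sg, cos sg)"
  have s: "sin sg > 0" using assms by (rule sin_gt_zero)
  have c1: "cos sg > -1" using cos_monotone_0_pi[of sg pi] assms by simp
  have w: "wedge sg = {x. snd x < 0 \<and> x \<bullet> ?n < 0}"
    unfolding wedge_def using s by (auto simp: cot_def field_simps sin_diff cos_diff)
  have "closure (wedge sg) = {x. snd x \<le> 0 \<and> x \<bullet> ?n \<le> 0}" (is "_ = ?C")
  proof
    have "closed ?C"
      unfolding Collect_conj_eq by (intro closed_Int closed_Collect_le continuous_intros)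
    then show "closure (wedge sg) \<subseteq> ?C" by (rule closure_minimal[rotated]) (auto simp: w)
    show "?C \<subseteq> closure (wedge sg)"
    proof
      fix x assume x: "x \<in> ?C"
      \<comment> \<open>The sum of the normals \<open>(0, 1)\<close> and \<open>?n\<close>. Its
        inner product with either of them is \<open>1 + cos sg\<close>, so moving against it lowers
        both linear functions strictly.\<close>
      let ?d = "(sin sg, 1 + cos sg)"
      let ?f = "\<lambda>n. x - (1 / real (Suc n)) *\<^sub>R ?d"
      have "?f \<longlonglongrightarrow> x - 0 *\<^sub>R ?d"
        by (intro tendsto_intros) (rule LIMSEQ_inverse_real_of_nat[unfolded inverse_eq_divide])
      then have "?f \<longlonglongrightarrow> x" by (simp only: scaleR_zero_left diff_zero)
      moreover have "\<forall>n. ?f n \<in> wedge sg"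
      proof
        fix n
        have e: "1 / real (Suc n) > 0" by simp
        have "?d \<bullet> ?n = 1 + cos sg"
          using sin_cos_squared_add[of sg] by (simp add: power2_eq_square algebra_simps)
        then have "?f n \<bullet> ?n = x \<bullet> ?n - (1 / real (Suc n)) * (1 + cos sg)"
          by (simp only: inner_diff_left inner_scaleR_left)
        moreover have "snd (?f n) = snd x - (1 / real (Suc n)) * (1 + cos sg)" by simp
        moreover have "(1 / real (Suc n)) * (1 + cos sg) > 0" using e c1 by (intro mult_pos_pos) auto
        ultimately show "?f n \<in> wedge sg" using x unfolding w mem_Collect_eq by linarith
      qed
      ultimately have "(\<forall>n. ?f n \<in> wedge sg) \<and> ?f \<longlonglongrightarrow> x" by (rule conjI[rotated])
      then show "x \<in> closure (wedge sg)" unfolding closure_sequential by (rule exI[of _ ?f])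
    qed
  qed
  then show ?thesis
    unfolding Lam_def by (intro set_eqI) (simp only: Compl_iff mem_Collect_eq de_Morgan_conj not_le)
qed

lemma Gamma_wedge_disjoint_Lam:
  assumes "0 < sg" "sg < pi" "0 \<le> A" "0 \<le> T"
  shows "Gamma_wedge (- A, 0) (T *\<^sub>R (cos sg, - sin sg)) \<inter> Lam sg = {}"
proof -
  have s: "sin sg > 0" using assms(1,2) by (rule sin_gt_zero)
  then show ?thesis
    unfolding Gamma_wedge_def Lam_eq[OF assms(1,2)] closed_segment_def using assms(3,4)
    by (auto simp: mult_less_0_iff not_less)
qed

text \<open>The counterpart of \<open>flat_at\<close> for the geometry of \<open>Lam sg\<close>
  alone; \<open>neumann_face_at_wedge\<close> transfers it to \<open>\<Omega>\<close>.\<close>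

definition wedge_face_at :: "real \<Rightarrow> (real \<times> real) set \<Rightarrow> real \<times> real \<Rightarrow> real \<times> real \<Rightarrow> bool" where
  "wedge_face_at sg \<Gamma> x0 \<nu> \<longleftrightarrow> (\<exists>e>0. Lam sg \<inter> ball x0 e = {x \<in> ball x0 e. 0 < (x - x0) \<bullet> \<nu>} \<and>
     (\<forall>x\<in>ball x0 e. (x - x0) \<bullet> \<nu> = 0 \<longrightarrow> x \<in> \<Gamma> \<and> x \<noteq> corner \<and> wedge_normal sg x = \<nu>))"

lemma dist_inner_le:
  fixes x y :: "real \<times> real"
  assumes "norm \<nu> = 1"
  shows "\<bar>x \<bullet> \<nu> - y \<bullet> \<nu>\<bar> \<le> dist x y"
  using Cauchy_Schwarz_ineq2[of "x - y" \<nu>] assms by (simp add: inner_diff_left dist_norm)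

lemma wedge_face_at_upper:
  assumes "0 < sg" "sg < pi" "0 < a" "a < A"
  shows "wedge_face_at sg (Gamma_wedge (- A, 0) Q) (- a, 0) (0, 1)"
proof -
  let ?n = "(sin sg, cos sg)"
  have s: "sin sg > 0" using assms(1,2) by (rule sin_gt_zero)
  \<comment> \<open>\<open>a\<close> and \<open>A - a\<close> are the distances to the ends of the
    face, \<open>a * sin sg\<close> is the distance to the line carrying the other face.\<close>
  define e where "e = min (min a (A - a)) (a * sin sg)"
  have e: "e > 0" "e \<le> a" "e \<le> A - a" "e \<le> a * sin sg" using assms(3,4) s by (auto simp: e_def)
  have near: "fst x < 0 \<and> - A < fst x \<and> x \<bullet> ?n < 0" if "x \<in> ball (- a, 0) e" for x
  proof -
    have "\<bar>fst x + a\<bar> < e"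
      using dist_fst_le[of "(- a, 0)" x] that by (simp add: dist_real_def)
    moreover have "\<bar>x \<bullet> ?n - (- a, 0) \<bullet> ?n\<bar> < e"
      using dist_inner_le[of ?n x "(- a, 0)"] that by (simp add: dist_commute norm_Pair)
    then have "\<bar>x \<bullet> ?n + a * sin sg\<bar> < e" by simp
    ultimately show ?thesis using e by linarith
  qed
  show ?thesis unfolding wedge_face_at_def
  proof (intro exI[of _ e] conjI ballI impI e(1))
    show "Lam sg \<inter> ball (- a, 0) e = {x \<in> ball (- a, 0) e. 0 < (x - (- a, 0)) \<bullet> (0, 1)}"
      unfolding Lam_eq[OF assms(1,2)] using near by (auto simp: inner_diff_left) fastforce+
    fix x :: "real \<times> real" assume x: "x \<in> ball (- a, 0) e" "(x - (- a, 0)) \<bullet> (0, 1) = 0"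
    then have x0: "x = (fst x, 0)" by (cases x) (simp add: inner_real_def)
    note n = near[OF x(1)]
    have "x = (1 - (1 + fst x / A)) *\<^sub>R (- A, 0) + (1 + fst x / A) *\<^sub>R corner"
      using x0 assms(3,4) by (cases x) simp
    moreover have "0 \<le> 1 + fst x / A" "1 + fst x / A \<le> 1" using n assms(3,4) by (auto simp: field_simps)
    ultimately show "x \<in> Gamma_wedge (- A, 0) Q"
      unfolding Gamma_wedge_def closed_segment_def by blast
    show "x \<noteq> corner" using n by auto
    show "wedge_normal sg x = (0, 1)" by (subst x0) (simp add: wedge_normal_def)
  qed
qed

lemma wedge_face_at_lower:
  assumes "0 < sg" "sg < pi" "0 < a" "a < T"
  shows "wedge_face_at sg (Gamma_wedge Q (T *\<^sub>R (cos sg, - sin sg))) (a *\<^sub>R (cos sg, - sin sg)) (sin sg, cos sg)"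
proof -
  let ?n = "(sin sg, cos sg)" and ?t = "(cos sg, - sin sg)"
  let ?x0 = "a *\<^sub>R ?t"
  have s: "sin sg > 0" using assms(1,2) by (rule sin_gt_zero)
  have nt: "norm ?t = 1" by (simp add: norm_Pair)
  have tn: "?t \<bullet> ?n = 0" by simp
  have tt: "?t \<bullet> ?t = 1" using nt by (metis norm_eq_1)
  \<comment> \<open>Again the distances to the ends of the face and to the line carrying the other
    face, here the horizontal axis.\<close>
  define e where "e = min (min a (T - a)) (a * sin sg)"
  have e: "e > 0" "e \<le> a" "e \<le> T - a" "e \<le> a * sin sg" using assms(3,4) s by (auto simp: e_def)
  have near: "snd x < 0 \<and> 0 < x \<bullet> ?t \<and> x \<bullet> ?t < T" if "x \<in> ball ?x0 e" for x
  proof -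
    have "\<bar>snd x + a * sin sg\<bar> < e"
      using dist_snd_le[of ?x0 x] that by (simp add: dist_real_def)
    moreover have "\<bar>x \<bullet> ?t - ?x0 \<bullet> ?t\<bar> < e"
      using dist_inner_le[OF nt, of x ?x0] that by (simp only: dist_commute mem_ball)
    then have "\<bar>x \<bullet> ?t - a\<bar> < e" by (simp only: inner_scaleR_left tt mult_1_right)
    ultimately show ?thesis using e by linarith
  qed
  have x0n: "?x0 \<bullet> ?n = 0" by (simp only: inner_scaleR_left tn mult_zero_right)
  show ?thesis unfolding wedge_face_at_def
  proof (intro exI[of _ e] conjI ballI impI e(1))
    show "Lam sg \<inter> ball ?x0 e = {x \<in> ball ?x0 e. 0 < (x - ?x0) \<bullet> ?n}"
      unfolding Lam_eq[OF assms(1,2)] inner_diff_left x0n using near by fastforce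
    fix x assume x: "x \<in> ball ?x0 e" "(x - ?x0) \<bullet> ?n = 0"
    then have xn: "fst x * sin sg + snd x * cos sg = 0"
      unfolding inner_diff_left x0n by (cases x) simp
    note n = near[OF x(1)]
    define u where "u = x \<bullet> ?t"
    have u: "u = fst x * cos sg - snd x * sin sg" by (cases x) (simp add: u_def)
    have "u * cos sg = fst x * ((sin sg)\<^sup>2 + (cos sg)\<^sup>2) - sin sg * (fst x * sin sg + snd x * cos sg)"
      unfolding u by algebra
    then have f: "fst x = u * cos sg" using xn by simp
    have "u * - sin sg = snd x * ((sin sg)\<^sup>2 + (cos sg)\<^sup>2) - cos sg * (fst x * sin sg + snd x * cos sg)"
      unfolding u by algebra
    then have g: "snd x = u * - sin sg" using xn by simp
    have "x = (1 - u / T) *\<^sub>R corner + (u / T) *\<^sub>R (T *\<^sub>R ?t)"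
      using f g assms(3,4) by (cases x) simp
    moreover have "0 \<le> u / T" "u / T \<le> 1" using n assms(3,4) by (auto simp: field_simps u_def)
    ultimately show "x \<in> Gamma_wedge Q (T *\<^sub>R ?t)"
      unfolding Gamma_wedge_def closed_segment_def by blast
    show "x \<noteq> corner" using n by auto
    show "wedge_normal sg x = ?n" using n by (simp add: wedge_normal_def)
  qed
qed

lemma wedge_face_cases:
  assumes "0 < sg" "sg < pi" and x: "x \<in> Gamma_wedge (- A, 0) (T *\<^sub>R (cos sg, - sin sg))"
    and "0 < A" "0 < T" and ne: "x \<noteq> corner" "x \<noteq> (- A, 0)" "x \<noteq> T *\<^sub>R (cos sg, - sin sg)"
  obtains "wedge_face_at sg (Gamma_wedge (- A, 0) (T *\<^sub>R (cos sg, - sin sg))) x (0, 1)"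
    | "wedge_face_at sg (Gamma_wedge (- A, 0) (T *\<^sub>R (cos sg, - sin sg))) x (sin sg, cos sg)"
proof -
  consider (up) u where "0 \<le> u" "u \<le> 1" "x = (1 - u) *\<^sub>R (- A, 0) + u *\<^sub>R corner"
    | (low) u where "0 \<le> u" "u \<le> 1" "x = (1 - u) *\<^sub>R corner + u *\<^sub>R (T *\<^sub>R (cos sg, - sin sg))"
    using x unfolding Gamma_wedge_def closed_segment_def by blast
  then show thesis
  proof cases
    case up
    then have xa: "x = (- ((1 - u) * A), 0)" by simp
    have "u \<noteq> 0" "u \<noteq> 1" using ne xa by auto
    then have "0 < (1 - u) * A" "(1 - u) * A < A" using up assms(4) by auto
    from wedge_face_at_upper[OF assms(1,2) this] show ?thesis using that(1) xa by simp
  next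
    case low
    then have xa: "x = (u * T) *\<^sub>R (cos sg, - sin sg)" by simp
    have "u \<noteq> 0" "u \<noteq> 1" using ne xa by auto
    then have "0 < u * T" "u * T < T" using low assms(5) by auto
    from wedge_face_at_lower[OF assms(1,2) this] show ?thesis using that(2) xa by simp
  qed
qed

text \<open>Strict ellipticity is assumed on the interior relative to the whole frontier of
  \<open>Lam sg\<close>. That frontier could only leave the line through \<open>x0\<close> towards
  its far side, where points have neighbourhoods free of \<open>Lam sg\<close>.\<close>

lemma wedge_face_at_frontier:
  assumes "wedge_face_at sg \<Gamma> x0 \<nu>" and "open (Lam sg)" and "x0 \<in> closure (Lam sg)"
  shows "x0 \<in> (top_of_set (frontier (Lam sg))) interior_of \<Gamma>"
proof -
  obtain e where e: "e > 0" "Lam sg \<inter> ball x0 e = {x \<in> ball x0 e. 0 < (x - x0) \<bullet> \<nu>}"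
    "\<And>x. x \<in> ball x0 e \<Longrightarrow> (x - x0) \<bullet> \<nu> = 0 \<Longrightarrow> x \<in> \<Gamma>"
    using assms(1) unfolding wedge_face_at_def by blast
  have fr: "frontier (Lam sg) = closure (Lam sg) - Lam sg"
    using assms(2) by (simp add: frontier_def interior_open)
  have "frontier (Lam sg) \<inter> ball x0 e \<subseteq> \<Gamma>"
  proof
    fix x assume x: "x \<in> frontier (Lam sg) \<inter> ball x0 e"
    have "\<not> 0 < (x - x0) \<bullet> \<nu>" using x e(2) fr by blast
    moreover have "\<not> (x - x0) \<bullet> \<nu> < 0"
    proof
      assume neg: "(x - x0) \<bullet> \<nu> < 0"
      let ?V = "ball x0 e \<inter> {y. (y - x0) \<bullet> \<nu> < 0}"
      have "open ?V" by (intro open_Int open_ball open_Collect_less continuous_intros)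
      moreover have "?V \<inter> Lam sg = {}" using e(2) by force
      ultimately have "?V \<inter> closure (Lam sg) = {}" using open_Int_closure_eq_empty by blast
      then show False using x neg fr by blast
    qed
    ultimately show "x \<in> \<Gamma>" using e(3)[of x] x by auto
  qed
  moreover have "openin (top_of_set (frontier (Lam sg))) (frontier (Lam sg) \<inter> ball x0 e)" by blast
  moreover have "x0 \<notin> Lam sg"
  proof
    assume "x0 \<in> Lam sg"
    then have "x0 \<in> {x \<in> ball x0 e. 0 < (x - x0) \<bullet> \<nu>}" using e(1) unfolding e(2)[symmetric] by simp
    then show False by simp
  qed
  ultimately show ?thesis
    unfolding interior_of_def using e(1) assms(3) fr by auto
qed

context hodograph
begin

text \<open>A small half disc of \<open>Lam sg\<close> at \<open>x0\<close> belongs entirely to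
  \<open>\<Omega>\<close>: it is connected, it meets \<open>\<Omega>\<close> because
  \<open>x0\<close> is in the closure, and it avoids the frontier, which away from \<open>E\<close>
  is contained in \<open>\<Gamma>\<close> and so disjoint from \<open>Lam sg\<close>.\<close>

lemma neumann_face_at_wedge:
  assumes face: "wedge_face_at sg \<Gamma> x0 \<nu>" and "norm \<nu> = 1"
    and Lam: "\<Omega> \<subseteq> Lam sg" and \<Gamma>: "\<Gamma> \<inter> Lam sg = {}"
    and E: "closed E" "x0 \<notin> E" "frontier \<Omega> = E \<union> \<Gamma>" "S = closure \<Omega> - (E \<union> {corner})"
    and x0: "x0 \<in> closure \<Omega>"
    and neumann: "\<And>x. x \<in> \<Gamma> - {corner} \<Longrightarrow> (p x, q x) \<bullet> wedge_normal sg x = 0"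
    and ell: "\<And>y. y \<noteq> 0 \<Longrightarrow> quad_form a11 a12 a22 x0 y > 0"
  shows "neumann_face_at x0 \<nu>"
proof -
  obtain e1 where e1: "e1 > 0" "Lam sg \<inter> ball x0 e1 = {x \<in> ball x0 e1. 0 < (x - x0) \<bullet> \<nu>}"
    "\<And>x. x \<in> ball x0 e1 \<Longrightarrow> (x - x0) \<bullet> \<nu> = 0 \<Longrightarrow> x \<in> \<Gamma> \<and> x \<noteq> corner \<and> wedge_normal sg x = \<nu>"
    using face unfolding wedge_face_at_def by blast
  have "open (- E)" using E(1) by (simp add: open_Compl)
  then obtain e2 where e2: "e2 > 0" "ball x0 e2 \<subseteq> - E"
    using E(2) open_contains_ball by (metis Compl_iff)
  define e where "e = min e1 e2"
  have e: "e > 0" "ball x0 e \<subseteq> ball x0 e1" "ball x0 e \<inter> E = {}" using e1 e2 by (auto simp: e_def)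
  let ?H = "{x \<in> ball x0 e. 0 < (x - x0) \<bullet> \<nu>}"
  have H: "Lam sg \<inter> ball x0 e = ?H" using e1(2) e(2) by blast
  have "?H = ball x0 e \<inter> {x. \<nu> \<bullet> x > \<nu> \<bullet> x0}"
    by (auto simp: inner_diff_right inner_commute[of _ \<nu>])
  then have "convex ?H" by (simp add: convex_Int convex_halfspace_gt)
  then have conn: "connected ?H" by (rule convex_connected)
  have "?H \<inter> frontier \<Omega> = {}" unfolding E(3) H[symmetric] using \<Gamma> e(3) by blast
  moreover have "\<Omega> \<inter> ball x0 e \<noteq> {}"
    using x0 e(1) by (metis centre_in_ball closure_iff_nhds_not_empty inf_commute open_ball order_refl)
  then have "?H \<inter> \<Omega> \<noteq> {}" unfolding H[symmetric] using Lam by blast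
  ultimately have "?H \<subseteq> \<Omega>" using connected_Int_frontier[OF conn] by blast
  then have half: "\<Omega> \<inter> ball x0 e = ?H" using Lam H by blast
  have "half_ball x0 \<nu> e \<subseteq> S"
  proof
    fix x assume x: "x \<in> half_ball x0 \<nu> e"
    then have xb: "x \<in> ball x0 e" and "0 \<le> (x - x0) \<bullet> \<nu>" by (auto simp: half_ball_def)
    then consider "0 < (x - x0) \<bullet> \<nu>" | "(x - x0) \<bullet> \<nu> = 0" by linarith
    then show "x \<in> S"
    proof cases
      case 1
      then show ?thesis using xb half \<Omega>_S by blast
    next
      case 2
      then have "x \<in> \<Gamma>" "x \<noteq> corner" using e1(3) xb e(2) by blast+
      then have "x \<in> frontier \<Omega>" using E(3) by blast
      then have "x \<in> closure \<Omega>" by (simp add: frontier_def)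
      then show ?thesis using E(4) \<open>x \<noteq> corner\<close> xb e(3) by blast
    qed
  qed
  then have "flat_at x0 \<nu> e" unfolding flat_at_def using e(1) assms(2) half by blast
  moreover have "(p x, q x) \<bullet> \<nu> = 0" if "x \<in> ball x0 e" "(x - x0) \<bullet> \<nu> = 0" for x
  proof -
    have *: "x \<in> \<Gamma> \<and> x \<noteq> corner \<and> wedge_normal sg x = \<nu>" using that e(2) e1(3) by blast
    then have "(p x, q x) \<bullet> wedge_normal sg x = 0" by (intro neumann) simp
    then show ?thesis using * by simp
  qed
  ultimately show ?thesis unfolding neumann_face_at_def using ell by blast
qed

end

lemma zero_at_origin_if_zero_on_segment:
  fixes g :: "'a::real_normed_vector \<Rightarrow> real"
  assumes "continuous_on K g" and "0 \<in> K"
    and seg: "\<And>u. 0 < u \<Longrightarrow> u \<le> 1 \<Longrightarrow> u *\<^sub>R v \<in> K \<and> g (u *\<^sub>R v) = 0"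
  shows "g 0 = 0"
proof -
  let ?f = "\<lambda>n. inverse (real (Suc n)) *\<^sub>R v"
  have "?f \<longlonglongrightarrow> 0 *\<^sub>R v" by (intro tendsto_intros LIMSEQ_inverse_real_of_nat)
  then have "?f \<longlonglongrightarrow> 0" by simp
  moreover have f: "?f n \<in> K \<and> g (?f n) = 0" for n by (rule seg) (auto simp: inverse_le_1_iff)
  ultimately have "(\<lambda>n. g (?f n)) \<longlonglongrightarrow> g 0"
    by (intro continuous_on_tendsto_compose[OF assms(1) _ assms(2)]) (auto intro!: always_eventually)
  then show ?thesis using f by (simp add: LIMSEQ_const_iff)
qed

text \<open>Places the end point of the upper face in the closed set formed by the shock and the
  sonic arc. Near its foot the arc is parametrised by height.\<close>

lemma sonic_foot_in_closure:
  assumes "0 \<le> u1 gm rho0 rho1" and "u1 gm rho0 rho1 < sound_speed gm rho1" and "0 \<le> xi1 gm rho0 rho1"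
  shows "sonic_foot gm rho0 rho1 \<in> closure (Gamma_sonic gm rho0 rho1)"
proof -
  define u where "u = u1 gm rho0 rho1"
  define c where "c = sound_speed gm rho1"
  have uc: "0 \<le> u" "u < c" using assms by (auto simp: u_def c_def)
  then have "u\<^sup>2 < c\<^sup>2" by (intro power_strict_mono) auto
  \<comment> \<open>The height at which the left half circle crosses the vertical axis; below it the
    abscissa is negative, hence less than \<open>xi1\<close>.\<close>
  define b where "b = sqrt (c\<^sup>2 - u\<^sup>2)"
  have b: "b > 0" "b\<^sup>2 = c\<^sup>2 - u\<^sup>2" using \<open>u\<^sup>2 < c\<^sup>2\<close> by (auto simp: b_def)
  let ?f = "\<lambda>h. (u - sqrt (c\<^sup>2 - h\<^sup>2), h)"
  have "?f h \<in> Gamma_sonic gm rho0 rho1" if h: "h \<in> {0<..<b}" for h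
  proof -
    have "h\<^sup>2 < b\<^sup>2" using h by (intro power_strict_mono) auto
    then have lt: "u\<^sup>2 < c\<^sup>2 - h\<^sup>2" using b by simp
    then have "u < sqrt (c\<^sup>2 - h\<^sup>2)" by (rule real_less_rsqrt)
    moreover have "dist (u, 0) (?f h) = c"
    proof -
      have "c\<^sup>2 - h\<^sup>2 \<ge> 0" using lt by (smt (verit) zero_le_power2)
      then show ?thesis using uc by (simp add: dist_Pair_Pair dist_real_def)
    qed
    ultimately show ?thesis
      using h assms(3) unfolding Gamma_sonic_def u_def[symmetric] c_def[symmetric] by simp
  qed
  then have "?f ` {0<..<b} \<subseteq> closure (Gamma_sonic gm rho0 rho1)"
    using closure_subset[of "Gamma_sonic gm rho0 rho1"] by blast
  moreover have "continuous_on (closure {0<..<b}) ?f" by (intro continuous_intros)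
  ultimately have "?f ` closure {0<..<b} \<subseteq> closure (Gamma_sonic gm rho0 rho1)"
    by (intro image_closure_subset closed_closure)
  moreover have "0 \<in> closure {0<..<b}" using b(1) by simp
  ultimately have "?f 0 \<in> closure (Gamma_sonic gm rho0 rho1)"
    by (rule subsetD[OF _ imageI])
  moreover have "sqrt (c\<^sup>2 - 0\<^sup>2) = c" using uc by simp
  ultimately show ?thesis unfolding sonic_foot_def u_def[symmetric] c_def[symmetric] by (simp only:)
qed

lemma closure_open_C1_arc:
  assumes "open_C1_arc A p q"
  shows "closure A \<subseteq> insert p (insert q A)" and "q \<in> closure A"
proof -
  obtain g where g: "arc g" "g 0 = p" "g 1 = q" "A = g ` {0<..<1}"
    using assms unfolding open_C1_arc_def pathstart_def pathfinish_def by blast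
  have c: "continuous_on {0..1} g" using g(1) by (simp add: arc_def path_def)
  have "closed (g ` {0..1})"
    by (intro compact_imp_closed compact_continuous_image c compact_Icc)
  then have "closure A \<subseteq> g ` {0..1}" unfolding g(4) by (intro closure_minimal image_mono) auto
  also have "{0..1::real} = insert 0 (insert 1 {0<..<1})" by auto
  finally show "closure A \<subseteq> insert p (insert q A)" using g(2-4) by simp
  have "g ` closure {0<..<1} \<subseteq> closure A"
  proof (rule image_closure_subset)
    show "continuous_on (closure {0<..<1}) g" using c by simp
    show "g ` {0<..<1} \<subseteq> closure A" using closure_subset[of A] by (simp only: g(4))
  qed simp
  moreover have "1 \<in> closure {0<..<1::real}" by simp
  ultimately show "q \<in> closure A" unfolding g(3)[symmetric] by blast
qed

theorem lemma3p5:
  fixes gm rho0 rho1 sg sgt :: real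
    and P2 :: "real \<times> real"
    and \<Gamma>shock \<Gamma>sonic \<Gamma>wedge \<Gamma>wedge0 \<Omega> S :: "(real \<times> real) set"
    and phi a11 a12 a22 :: "real \<times> real \<Rightarrow> real"
  defines "\<Gamma>sonic \<equiv> Gamma_sonic gm rho0 rho1"
    and "\<Gamma>wedge \<equiv> Gamma_wedge (sonic_foot gm rho0 rho1) P2"
    and "\<Gamma>wedge0 \<equiv> Gamma_wedge_interior sg (sonic_foot gm rho0 rho1) P2"
    and "S \<equiv> closure \<Omega> - (closure \<Gamma>sonic \<union> closure \<Gamma>shock \<union> {corner})"
  assumes "gm > 1" and "0 < sg" and "sg < pi"
    and "0 < rho0" and "rho0 < rho1"
    and "u1 gm rho0 rho1 < sound_speed gm rho1"
    and "P2 \<in> lower_face sg"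
    and "open_C1_arc \<Gamma>shock (P1 gm rho0 rho1) P2"
    and "\<Gamma>shock \<subseteq> Lam sg"
    and "open \<Omega>" and "connected \<Omega>" and "bounded \<Omega>" and "\<Omega> \<subseteq> Lam sg"
    and "frontier \<Omega> = closure \<Gamma>shock \<union> closure \<Gamma>sonic \<union> \<Gamma>wedge"
    and "Ck_upto 3 \<Omega> S phi" and "Ck_upto 1 \<Omega> (closure \<Omega>) phi"
    and "\<not> phi constant_on closure \<Omega>"
    and "Ck_upto 1 \<Omega> S a11" and "Ck_upto 1 \<Omega> S a12" and "Ck_upto 1 \<Omega> S a22"
    and "\<forall>x\<in>\<Omega>. a11 x * d_xi \<Omega> (d_xi \<Omega> phi) x + 2 * a12 x * d_eta \<Omega> (d_xi \<Omega> phi) x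
               + a22 x * d_eta \<Omega> (d_eta \<Omega> phi) x = 0"
    and "uniformly_elliptic_near corner \<Omega> a11 a12 a22"
    and "strictly_elliptic_on (\<Omega> \<union> \<Gamma>wedge0 - {corner}) a11 a12 a22"
    and "\<forall>x\<in>\<Gamma>wedge - {corner}. grad_upto \<Omega> phi x \<bullet> wedge_normal sg x = 0"
    and "sg < sgt" and "sgt < pi"
    and "\<forall>x\<in>\<Gamma>shock \<union> \<Gamma>sonic. grad_upto \<Omega> phi x \<bullet> (sin sgt, cos sgt) \<ge> 0"
  shows "\<forall>x\<in>(\<Omega> \<union> \<Gamma>wedge) - {corner}. grad_upto \<Omega> phi x \<bullet> (sin sgt, cos sgt) > 0"
proof -
  note phi3 = assms(19)[unfolded numeral_3_eq_3] and phi1 = assms(20)[unfolded One_nat_def]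
    and a = assms(22-24)[unfolded One_nat_def]
  define p where "p = d_xi \<Omega> phi"
  define q where "q = d_eta \<Omega> phi"
  define E where "E = closure \<Gamma>shock \<union> closure \<Gamma>sonic"
  define A where "A = sound_speed gm rho1 - u1 gm rho0 rho1"
  let ?n = "(sin sg, cos sg)" and ?g = "(sin sgt, cos sgt)"
  have sg: "0 < sg" "sg < pi" by fact+
  have s: "sin sg > 0" using sg by (rule sin_gt_zero)
  have st: "sin sgt > 0" using \<open>sg < sgt\<close> \<open>0 < sg\<close> \<open>sgt < pi\<close> by (intro sin_gt_zero) auto
  have sd: "sin (sgt - sg) > 0" using \<open>sg < sgt\<close> \<open>0 < sg\<close> \<open>sgt < pi\<close> by (intro sin_gt_zero) auto
  have grad: "grad_upto \<Omega> phi x = (p x, q x)" for x by (simp add: grad_upto_def p_def q_def)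
  have zero: "corner = 0" by (simp add: zero_prod_def)

  \<comment> \<open>Position of the wedge boundary, the arcs and the corner\<close>
  obtain T where T: "T > 0" "P2 = T *\<^sub>R (cos sg, - sin sg)"
    using \<open>P2 \<in> lower_face sg\<close> by (auto simp: lower_face_def)
  have "A > 0" using assms(10) by (simp add: A_def)
  have foot: "sonic_foot gm rho0 rho1 = (- A, 0)" by (simp add: sonic_foot_def A_def)
  have \<Gamma>w: "\<Gamma>wedge = Gamma_wedge (- A, 0) (T *\<^sub>R (cos sg, - sin sg))"
    and \<Gamma>w0: "\<Gamma>wedge0 = (top_of_set (frontier (Lam sg))) interior_of \<Gamma>wedge"
    unfolding assms(2,3) Gamma_wedge_interior_def foot T(2) by auto
  have \<Gamma>Lam: "\<Gamma>wedge \<inter> Lam sg = {}"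
    unfolding \<Gamma>w by (rule Gamma_wedge_disjoint_Lam) (use sg \<open>A > 0\<close> T(1) in auto)
  have "open (Lam sg)" by (simp add: Lam_def open_Compl)
  have c1: "sound_speed gm rho1 > 0"
    using \<open>0 < rho0\<close> \<open>rho0 < rho1\<close> by (simp add: sound_speed_def)
  have xi: "xi1 gm rho0 rho1 \<ge> 0"
  proof -
    have "0 \<le> (sound_speed gm rho1)\<^sup>2 - (sound_speed gm rho0)\<^sup>2"
      using \<open>gm > 1\<close> \<open>0 < rho0\<close> \<open>rho0 < rho1\<close> by (simp add: sound_speed_def powr_mono2)
    moreover have "0 \<le> rho1\<^sup>2 - rho0\<^sup>2" using \<open>0 < rho0\<close> \<open>rho0 < rho1\<close> by (simp add: power_mono)
    ultimately show ?thesis using \<open>gm > 1\<close> by (simp add: xi1_def)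
  qed
  have u0: "u1 gm rho0 rho1 \<ge> 0" using xi \<open>0 < rho0\<close> \<open>rho0 < rho1\<close> by (simp add: u1_def)
  have footE: "(- A, 0) \<in> E"
    using sonic_foot_in_closure[OF u0 assms(10) xi] unfolding E_def foot assms(1) by blast
  have P2E: "P2 \<in> E" using closure_open_C1_arc(2)[OF assms(12)] by (simp add: E_def)
  have "corner \<in> \<Gamma>wedge" unfolding \<Gamma>w by (simp add: Gamma_wedge_def)
  have cE: "corner \<notin> E"
  proof -
    have "corner \<notin> closure \<Gamma>shock"
    proof
      assume "corner \<in> closure \<Gamma>shock"
      then have "corner \<in> insert (P1 gm rho0 rho1) (insert P2 \<Gamma>shock)"
        using closure_open_C1_arc(1)[OF assms(12)] by (rule subsetD[rotated])
      moreover have "corner \<notin> \<Gamma>shock" using \<open>corner \<in> \<Gamma>wedge\<close> \<Gamma>Lam assms(13) by blast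
      moreover have "corner \<noteq> P2" using T s by auto
      moreover have "corner \<noteq> P1 gm rho0 rho1"
      proof
        assume P1: "corner = P1 gm rho0 rho1"
        \<comment> \<open>If \<open>xi1\<close> is zero, so is \<open>u1\<close>, and
          \<open>eta1\<close> is then the positive sound speed.\<close>
        then have "xi1 gm rho0 rho1 = 0" "eta1 gm rho0 rho1 = 0" by (simp_all add: P1_def)
        then show False using c1 by (simp add: u1_def eta1_def)
      qed
      ultimately show False by blast
    qed
    moreover have "\<Gamma>sonic \<subseteq> sphere (u1 gm rho0 rho1, 0) (sound_speed gm rho1)"
      unfolding assms(1) Gamma_sonic_def by blast
    then have "closure \<Gamma>sonic \<subseteq> sphere (u1 gm rho0 rho1, 0) (sound_speed gm rho1)"
      by (rule closure_minimal) simp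
    \<comment> \<open>The corner has distance \<open>u1\<close> from the centre, which is
      nonnegative and less than the radius.\<close>
    moreover have "corner \<notin> sphere (u1 gm rho0 rho1, 0) (sound_speed gm rho1)"
      using u0 assms(10) by (simp add: dist_Pair_Pair dist_real_def)
    ultimately show ?thesis unfolding E_def by blast
  qed
  have "closed E" unfolding E_def by (intro closed_Un closed_closure)
  have frO: "frontier \<Omega> = E \<union> \<Gamma>wedge" using assms(18) by (simp add: E_def)
  have SE: "S = closure \<Omega> - (E \<union> {corner})" by (auto simp: assms(4) E_def)
  have open\<Omega>: "open \<Omega>" by fact
  have "\<Omega> \<inter> frontier \<Omega> = {}" using open\<Omega> by (auto simp: frontier_def interior_open)
  then have OS: "\<Omega> \<subseteq> S" unfolding SE using frO \<open>corner \<in> \<Gamma>wedge\<close> closure_subset[of \<Omega>] by blast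
  have Scl: "S \<subseteq> closure \<Omega>" unfolding SE by blast
  have frcl: "frontier \<Omega> \<subseteq> closure \<Omega>" by (simp add: frontier_def)
  have clO: "closure \<Omega> = \<Omega> \<union> E \<union> \<Gamma>wedge"
    using frO frcl closure_subset[of \<Omega>] open\<Omega> by (auto simp: frontier_def interior_open)
  have clW: "x \<in> closure \<Omega>" if "x \<in> \<Gamma>wedge" for x using that unfolding clO by simp
  have cl_cases: "x \<in> \<Omega> \<or> x \<in> E \<or> x \<in> \<Gamma>wedge" if "x \<in> closure \<Omega>" for x
    using that unfolding clO by simp
  have ccl: "corner \<in> closure \<Omega>" by (rule clW) fact

  \<comment> \<open>The gradient map and the open faces\<close>
  interpret h: hodograph \<Omega> S p q "d_xi \<Omega> p" "d_eta \<Omega> p" "d_eta \<Omega> q"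
    "d_xi \<Omega> (d_xi \<Omega> p)" "d_xi \<Omega> (d_eta \<Omega> p)" "d_eta \<Omega> (d_eta \<Omega> p)" "d_eta \<Omega> (d_eta \<Omega> q)"
    a11 a12 a22 "d_xi \<Omega> a11" "d_xi \<Omega> a12" "d_xi \<Omega> a22" "d_eta \<Omega> a11" "d_eta \<Omega> a12" "d_eta \<Omega> a22"
    unfolding p_def q_def
    by (rule hodograph_of_solution[OF open\<Omega> OS Scl phi3 a]) (use assms(25) in blast)
  have contp: "continuous_on (closure \<Omega>) p" and contq: "continuous_on (closure \<Omega>) q"
    using phi1 by (auto simp: p_def q_def)
  have neumann: "(p x, q x) \<bullet> wedge_normal sg x = 0" if "x \<in> \<Gamma>wedge - {corner}" for x
    using assms(28) that unfolding grad by blast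

  have face_ex: "\<exists>\<nu>\<in>{(0, 1), ?n}. h.neumann_face_at x \<nu>" and upper: "snd x = 0 \<Longrightarrow> h.neumann_face_at x (0, 1)"
    if x: "x \<in> \<Gamma>wedge" "x \<notin> E" "x \<noteq> corner" for x
  proof -
    have xc: "x \<in> closure \<Omega>" by (rule clW[OF x(1)])
    have nf: "h.neumann_face_at x \<nu>" if f: "wedge_face_at sg \<Gamma>wedge x \<nu>" "norm \<nu> = 1" for \<nu>
    proof (rule h.neumann_face_at_wedge[OF f assms(17) \<Gamma>Lam \<open>closed E\<close> x(2) frO SE xc neumann])
      have "x \<in> closure (Lam sg)" using xc closure_mono[OF assms(17)] by blast
      then have "x \<in> \<Gamma>wedge0" unfolding \<Gamma>w0 by (rule wedge_face_at_frontier[OF f(1) \<open>open (Lam sg)\<close>])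
      then show "quad_form a11 a12 a22 x y > 0" if "y \<noteq> 0" for y
        using assms(27) x(3) that unfolding strictly_elliptic_on_def by blast
    qed
    have "x \<noteq> (- A, 0)" "x \<noteq> T *\<^sub>R (cos sg, - sin sg)" using x(2) footE P2E T(2) by auto
    then consider "wedge_face_at sg \<Gamma>wedge x (0, 1)" | "wedge_face_at sg \<Gamma>wedge x ?n"
      using wedge_face_cases[OF sg x(1)[unfolded \<Gamma>w] \<open>A > 0\<close> T(1) x(3)] unfolding \<Gamma>w by blast
    then have "\<exists>\<nu>\<in>{(0, 1), ?n}. wedge_face_at sg \<Gamma>wedge x \<nu>" by cases auto
    then obtain \<nu> where \<nu>: "\<nu> \<in> {(0, 1), ?n}" "wedge_face_at sg \<Gamma>wedge x \<nu>" by blast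
    have n1: "norm \<nu> = 1" using \<nu>(1) by (auto simp: norm_Pair)
    show "\<exists>\<nu>\<in>{(0, 1), ?n}. h.neumann_face_at x \<nu>" using nf[OF \<nu>(2) n1] \<nu>(1) by blast
    assume x0: "snd x = 0"
    obtain e where "e > 0" "\<And>y. y \<in> ball x e \<Longrightarrow> (y - x) \<bullet> \<nu> = 0 \<Longrightarrow> wedge_normal sg y = \<nu>"
      using \<nu>(2) unfolding wedge_face_at_def by blast
    from this(2)[of x] this(1) have "wedge_normal sg x = \<nu>" by simp
    then have "\<nu> = (0, 1)" using x0 by (simp add: wedge_normal_def)
    then show "h.neumann_face_at x (0, 1)" using nf[OF \<nu>(2) n1] by simp
  qed
  \<comment> \<open>The two determinants are \<open>sin sgt\<close> and
    \<open>sin (sgt - sg)\<close>; both are positive because \<open>sgt\<close> lies between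
    \<open>sg\<close> and \<open>pi\<close>.\<close>
  have indep: "sin sgt * snd \<nu> - cos sgt * fst \<nu> \<noteq> 0" if "\<nu> \<in> {(0, 1), ?n}" for \<nu>
    using that st sd by (auto simp: sin_diff)

  \<comment> \<open>Vanishing of the gradient at the corner\<close>
  have corner0: "p corner = 0" "q corner = 0"
  proof -
    have up: "u *\<^sub>R (- A, 0) \<in> \<Gamma>wedge - {corner}" if "0 < u" "u \<le> 1" for u
    proof -
      have "u *\<^sub>R (- A, 0) = (1 - (1 - u)) *\<^sub>R (- A, 0) + (1 - u) *\<^sub>R corner" by simp
      moreover have "0 \<le> 1 - u" "1 - u \<le> 1" using that by auto
      ultimately have "u *\<^sub>R (- A, 0) \<in> closed_segment (- A, 0) corner"
        unfolding closed_segment_def by blast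
      then show ?thesis using that \<open>A > 0\<close> by (auto simp: \<Gamma>w Gamma_wedge_def)
    qed
    have low: "u *\<^sub>R P2 \<in> \<Gamma>wedge - {corner}" if "0 < u" "u \<le> 1" for u
    proof -
      have "u *\<^sub>R P2 = (1 - u) *\<^sub>R corner + u *\<^sub>R P2" by (simp add: zero)
      then have "u *\<^sub>R P2 \<in> closed_segment corner P2"
        unfolding closed_segment_def using that by fastforce
      then show ?thesis using that T s by (auto simp: \<Gamma>w Gamma_wedge_def)
    qed
    \<comment> \<open>The Neumann condition of each face passes to the corner by continuity, and the
      two normals are independent since \<open>sin sg\<close> is positive.\<close>
    have "q 0 = 0"
    proof (rule zero_at_origin_if_zero_on_segment[OF contq])
      show "0 \<in> closure \<Omega>" using ccl zero by simp
      show "u *\<^sub>R (- A, 0) \<in> closure \<Omega> \<and> q (u *\<^sub>R (- A, 0)) = 0" if "0 < u" "u \<le> 1" for u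
        using clW[of "u *\<^sub>R (- A, 0)"] up[OF that] neumann[OF up[OF that]] by (simp add: wedge_normal_def)
    qed
    moreover have "p 0 * sin sg + q 0 * cos sg = 0"
    proof (rule zero_at_origin_if_zero_on_segment)
      show "continuous_on (closure \<Omega>) (\<lambda>x. p x * sin sg + q x * cos sg)"
        by (intro continuous_intros contp contq)
      show "0 \<in> closure \<Omega>" using ccl zero by simp
      show "u *\<^sub>R P2 \<in> closure \<Omega> \<and> p (u *\<^sub>R P2) * sin sg + q (u *\<^sub>R P2) * cos sg = 0" if "0 < u" "u \<le> 1" for u
      proof -
        have "snd (u *\<^sub>R P2) \<noteq> 0" using that T s by simp
        then have "wedge_normal sg (u *\<^sub>R P2) = ?n" by (simp add: wedge_normal_def)
        then show ?thesis using clW[of "u *\<^sub>R P2"] low[OF that] neumann[OF low[OF that]] by simp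
      qed
    qed
    ultimately show "p corner = 0" "q corner = 0" using s zero by auto
  qed

  \<comment> \<open>Positivity of the directional derivative away from the arcs\<close>
  have ellO: "quad_form a11 a12 a22 x y > 0" if "x \<in> \<Omega>" "y \<noteq> 0" for x y
  proof -
    have "x \<noteq> corner" using that(1) OS SE by blast
    then show ?thesis using assms(27) that unfolding strictly_elliptic_on_def by blast
  qed
  \<comment> \<open>The sign condition on the open arcs extends by continuity to their end points,
    as a weak inequality.\<close>
  have wE: "0 \<le> (p x, q x) \<bullet> ?g" if "x \<in> E" for x
  proof (rule continuous_ge_on_closure_subset[of "closure \<Omega>" _ x "\<Gamma>shock \<union> \<Gamma>sonic"])
    show "continuous_on (closure \<Omega>) (\<lambda>x. (p x, q x) \<bullet> ?g)" by (intro continuous_intros contp contq)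
    show "x \<in> closure \<Omega>" using that clO by blast
    show "x \<in> closure (\<Gamma>shock \<union> \<Gamma>sonic)" using that by (simp add: E_def)
    show "\<Gamma>shock \<union> \<Gamma>sonic \<subseteq> closure \<Omega>" using clO closure_subset unfolding E_def by blast
    show "0 \<le> (p y, q y) \<bullet> ?g" if "y \<in> \<Gamma>shock \<union> \<Gamma>sonic" for y
      using assms(31) that unfolding grad by blast
  qed
  have nonconst: "\<exists>x\<in>\<Omega>. (p x, q x) \<noteq> 0"
  proof (rule ccontr)
    assume "\<not> ?thesis"
    then have z: "p x = 0" "q x = 0" if "x \<in> \<Omega>" for x using that by (auto simp: zero_prod_def)
    have "\<Omega> \<noteq> {}" using ccl by auto
    then obtain y where y: "y \<in> \<Omega>" by blast
    have "phi x = phi y" if "x \<in> \<Omega>" for x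
    proof (rule has_derivative_zero_unique_connected[OF open\<Omega> assms(15) _ that y])
      fix x assume "x \<in> \<Omega>"
      then show "(phi has_derivative (\<lambda>h. 0)) (at x)"
        using Ck_upto_has_derivative[OF phi1, of x, folded p_def q_def] z[of x] by simp
    qed
    then have "phi x = phi y" if "x \<in> closure \<Omega>" for x
      by (rule continuous_constant_on_closure[OF Ck_upto_continuous_on[OF phi1] _ that])
    then have "phi constant_on closure \<Omega>" unfolding constant_on_def by (intro exI[of _ "phi y"] ballI)
    then show False using assms(21) by simp
  qed
  have bdry: "x \<in> \<Omega> \<or> 0 \<le> (p x, q x) \<bullet> ?g \<or>
      (\<exists>n1 n2. h.neumann_face_at x (n1, n2) \<and> sin sgt * n2 - cos sgt * n1 \<noteq> 0)" if xc: "x \<in> closure \<Omega>" for x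
  proof -
    consider "x \<in> \<Omega>" | "x \<in> E" | "x = corner" | "x \<in> \<Gamma>wedge" "x \<notin> E" "x \<noteq> corner"
      using cl_cases[OF xc] by blast
    then show ?thesis
    proof cases
      case 1
      then show ?thesis by (rule disjI1)
    next
      case 2
      then show ?thesis by (intro disjI2 disjI1 wE)
    next
      case 3
      then show ?thesis by (simp add: corner0)
    next
      case 4
      obtain \<nu> where \<nu>: "\<nu> \<in> {(0, 1), ?n}" "h.neumann_face_at x \<nu>"
        using face_ex[OF 4] by (elim bexE)
      then have "h.neumann_face_at x (fst \<nu>, snd \<nu>)" by simp
      then show ?thesis using indep[OF \<nu>(1)] by (intro disjI2 exI conjI)
    qed
  qed
  have g0: "?g \<noteq> 0" using st by (auto simp: zero_prod_def)
  note pos = h.directional_derivative_positive[OF assms(15,16) contp contq ellO ccl corner0 nonconst bdry g0]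
  have pos_closure: "0 \<le> (p x, q x) \<bullet> ?g" if "x \<in> closure \<Omega>" for x by (rule pos(1)) (assumption | rule that)+
  have pos_\<Omega>: "0 < (p x, q x) \<bullet> ?g" if "x \<in> \<Omega>" for x by (rule pos(2)) (assumption | rule that)+
  have pos_face: "0 < (p x, q x) \<bullet> ?g"
    if "h.neumann_face_at x (n1, n2)" "sin sgt * n2 - cos sgt * n1 \<noteq> 0" for x n1 n2
    by (rule pos(3)) (assumption | rule that)+
  have wpos: "0 < (p x, q x) \<bullet> ?g" if x: "x \<in> closure \<Omega>" "x \<notin> E" "x \<noteq> corner" for x
  proof (cases "x \<in> \<Omega>")
    case True
    then show ?thesis by (rule pos_\<Omega>)
  next
    case False
    then have "x \<in> \<Gamma>wedge" using cl_cases[OF x(1)] x(2) by simp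
    obtain \<nu> where \<nu>: "\<nu> \<in> {(0, 1), ?n}" "h.neumann_face_at x \<nu>"
      using face_ex[OF \<open>x \<in> \<Gamma>wedge\<close> x(2,3)] by (elim bexE)
    then have "h.neumann_face_at x (fst \<nu>, snd \<nu>)" by simp
    then show ?thesis by (rule pos_face) (rule indep[OF \<nu>(1)])
  qed

  \<comment> \<open>Small gradients near the corner\<close>
  have "open (- E)" using \<open>closed E\<close> by (simp add: open_Compl)
  then obtain e0 where e0: "e0 > 0" "ball 0 e0 \<subseteq> - E"
    using cE open_contains_ball unfolding zero by (metis Compl_iff)
  define R where "R = e0 / 2"
  have R: "R > 0" "R < e0" using e0 by (auto simp: R_def)
  have farE: "x \<notin> E" if "norm x \<le> R" for x
  proof -
    have "x \<in> ball 0 e0" using that R by simp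
    then show ?thesis using e0(2) by blast
  qed
  \<comment> \<open>On the circle that cuts off the corner the component along \<open>?g\<close> is
    positive, so the gradient is nonzero there and, by compactness, stays outside a disc of some
    radius \<open>d\<close>.\<close>
  have "\<exists>d>0. \<forall>x\<in>closure \<Omega> \<inter> sphere 0 R. d \<le> norm (p x, q x)"
  proof (cases "closure \<Omega> \<inter> sphere 0 R = {}")
    case True
    then show ?thesis by (intro exI[of _ 1]) simp
  next
    case False
    have "compact (closure \<Omega> \<inter> sphere 0 R)" by (intro closed_Int_compact) auto
    moreover have "continuous_on (closure \<Omega> \<inter> sphere 0 R) (\<lambda>x. norm (p x, q x))"
      by (intro continuous_intros continuous_on_subset[OF contp] continuous_on_subset[OF contq]) auto
    ultimately have "\<exists>x\<in>closure \<Omega> \<inter> sphere 0 R. \<forall>y\<in>closure \<Omega> \<inter> sphere 0 R. norm (p x, q x) \<le> norm (p y, q y)"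
      using continuous_attains_inf False by blast
    then obtain x where x: "x \<in> closure \<Omega>" "norm x = R"
      "\<And>y. y \<in> closure \<Omega> \<inter> sphere 0 R \<Longrightarrow> norm (p x, q x) \<le> norm (p y, q y)" by force
    have "x \<noteq> corner" using x(2) R zero by auto
    then have "0 < (p x, q x) \<bullet> ?g" using wpos[OF x(1)] farE[of x] x(2) by simp
    then have "(p x, q x) \<noteq> 0" by (metis inner_zero_left less_irrefl)
    then show ?thesis using x(3) by (intro exI[of _ "norm (p x, q x)"]) auto
  qed
  then obtain d where d: "d > 0" "\<And>x. x \<in> closure \<Omega> \<Longrightarrow> norm x = R \<Longrightarrow> d \<le> norm (p x, q x)" by auto

  have qle: "q x \<le> 0" if x: "x \<in> \<Gamma>wedge" for x
  proof (cases "x = corner")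
    case True
    then show ?thesis using corner0 by simp
  next
    case False
    then have n: "(p x, q x) \<bullet> wedge_normal sg x = 0" using neumann x by blast
    show ?thesis
    proof (cases "snd x = 0")
      case True
      then show ?thesis using n by (simp add: wedge_normal_def)
    next
      case False
      then have e: "p x * sin sg = - q x * cos sg" using n by (simp add: wedge_normal_def)
      have "0 \<le> (p x, q x) \<bullet> ?g" by (rule pos_closure[OF clW[OF x]])
      \<comment> \<open>On the lower face the gradient is tangential, and \<open>sin sg\<close>
        times its component along \<open>?g\<close> equals
        \<open>- (q x * sin (sgt - sg))\<close>.\<close>
      then have "0 \<le> sin sg * (p x * sin sgt + q x * cos sgt)" using s by simp
      also have "\<dots> = sin sgt * (p x * sin sg) + q x * (sin sg * cos sgt)" by (simp add: algebra_simps)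
      also have "\<dots> = - (q x * sin (sgt - sg))" unfolding e sin_diff by (simp add: algebra_simps)
      finally show ?thesis using sd by (simp add: mult_le_0_iff)
    qed
  qed
  let ?D = "\<Omega> \<inter> ball 0 R"
  have clD: "closure ?D \<subseteq> closure \<Omega> \<inter> cball 0 R"
  proof (rule Int_greatest)
    show "closure ?D \<subseteq> closure \<Omega>" by (rule closure_mono) (rule Int_lower1)
    show "closure ?D \<subseteq> cball 0 R" by (rule closure_minimal) auto
  qed
  have small: "q x \<le> 0" if x: "x \<in> ?D" "norm (p x, q x) < d" for x
  \<comment> \<open>The omitted value lies in the upper half disc of radius \<open>d\<close>, but
    its inner product with \<open>?g\<close> is \<open>- (d / 2) * sin (sgt / 2)\<close>. Replacing
    the half angle by any angle strictly between 0 and \<open>sgt\<close> would also give a negative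
    product.\<close>
  proof (rule h.small_gradient_sign[of ?D d "(d / 2) *\<^sub>R (- cos (sgt / 2), sin (sgt / 2))"])
    show "open ?D" using open\<Omega> by (simp add: open_Int)
    show "bounded ?D" by (rule bounded_subset[OF bounded_ball]) (rule Int_lower2)
    show "continuous_on (closure ?D) p" "continuous_on (closure ?D) q"
      using clD continuous_on_subset[OF contp] continuous_on_subset[OF contq] by blast+
    show "quad_form a11 a12 a22 x y > 0" if "x \<in> ?D" "y \<noteq> 0" for x y using ellO that by blast
    show "q y \<le> 0 \<or> d \<le> norm (p y, q y)" if y: "y \<in> closure ?D - ?D" for y
    proof -
      have yc: "y \<in> closure \<Omega>" "norm y \<le> R" using y clD by auto
      show ?thesis
      proof (cases "norm y = R")
        case True
        then show ?thesis using d(2) yc by blast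
      next
        case False
        then have "y \<notin> \<Omega>" using y yc by auto
        then have "y \<in> \<Gamma>wedge" using cl_cases[OF yc(1)] farE[OF yc(2)] by simp
        then show ?thesis using qle by blast
      qed
    qed
    have "norm (- cos (sgt / 2), sin (sgt / 2)) = 1" by (simp add: norm_Pair)
    then show "norm ((d / 2) *\<^sub>R (- cos (sgt / 2), sin (sgt / 2))) < d"
      unfolding norm_scaleR using d(1) by simp
    have "sgt > 0" using \<open>sg < sgt\<close> \<open>0 < sg\<close> by simp
    then have s2: "sin (sgt / 2) > 0" using \<open>sgt < pi\<close> by (intro sin_gt_zero) auto
    then show "0 < snd ((d / 2) *\<^sub>R (- cos (sgt / 2), sin (sgt / 2)))" using d(1) by simp
    show "(p y, q y) \<noteq> (d / 2) *\<^sub>R (- cos (sgt / 2), sin (sgt / 2))" if "y \<in> closure ?D" for y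
    proof
      assume eq: "(p y, q y) = (d / 2) *\<^sub>R (- cos (sgt / 2), sin (sgt / 2))"
      have "0 \<le> (p y, q y) \<bullet> ?g" by (rule pos_closure) (use that clD in blast)
      also have "(p y, q y) \<bullet> ?g = - (d / 2) * (sin sgt * cos (sgt / 2) - cos sgt * sin (sgt / 2))"
        unfolding eq by (simp add: algebra_simps)
      also have "sin sgt * cos (sgt / 2) - cos sgt * sin (sgt / 2) = sin (sgt / 2)"
        using sin_diff[of sgt "sgt / 2"] by simp
      finally show False using d(1) s2 by (simp add: mult_le_0_iff)
    qed
  qed (use x in auto)

  obtain e1 where e1: "e1 > 0" "\<And>x. x \<in> closure \<Omega> \<Longrightarrow> dist x corner < e1 \<Longrightarrow> norm (p x, q x) < d"
  proof -
    have "continuous_on (closure \<Omega>) (\<lambda>x. norm (p x, q x))" by (intro continuous_intros contp contq)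
    then show ?thesis
      using continuous_on_locally_less[OF _ ccl, of "\<lambda>x. norm (p x, q x)" d] corner0 d(1) that
      by (auto simp flip: zero_prod_def)
  qed
  define e2 where "e2 = min e1 R"
  have e2: "e2 > 0" "e2 \<le> e1" "e2 \<le> R" using e1 R by (auto simp: e2_def)
  have qneg: "q x \<le> 0" if "x \<in> \<Omega>" "x \<in> ball 0 e2" for x
  proof (rule small)
    show "x \<in> ?D" using that e2 by auto
    show "norm (p x, q x) < d"
      by (rule e1(2)) (use that e2 closure_subset[of \<Omega>] in \<open>auto simp: zero\<close>)
  qed

  \<comment> \<open>Monotonicity along the upper face\<close>
  define b where "b = min e2 A / 2"
  have b: "b > 0" "b < e2" "b < A" using e2 \<open>A > 0\<close> by (auto simp: b_def)
  have segW: "(u, 0) \<in> \<Gamma>wedge" if "- b \<le> u" "u \<le> 0" for u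
  proof -
    have "(u, 0) = (1 - (1 + u / A)) *\<^sub>R (- A, 0) + (1 + u / A) *\<^sub>R corner" using \<open>A > 0\<close> by simp
    moreover have "0 \<le> 1 + u / A" "1 + u / A \<le> 1" using that b by (auto simp: field_simps)
    ultimately have "(u, 0) \<in> closed_segment (- A, 0) corner" unfolding closed_segment_def by blast
    then show ?thesis by (simp add: \<Gamma>w Gamma_wedge_def)
  qed
  have segE: "(u, 0) \<notin> E" if "- b \<le> u" "u \<le> 0" for u :: real
    by (rule farE) (use that b e2 in \<open>simp add: norm_Pair\<close>)
  have "p (- b, 0) \<le> p (0, 0)"
  \<comment> \<open>Second derivatives exist up to the face only away from the corner, so the slope
    is used on the open segment and continuity of \<open>p\<close> at its ends.\<close>
  proof (rule DERIV_nonneg_imp_increasing_open[of "- b" 0 "\<lambda>u. p (u, 0)"])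
    show "- b \<le> 0" using b by simp
    have "(\<lambda>u. (u, 0)) ` {- b..0} \<subseteq> closure \<Omega>" using segW clW by auto
    then show "continuous_on {- b..0} (\<lambda>u. p (u, 0))"
      by (intro continuous_on_compose2[OF contp] continuous_intros)
    fix u assume u: "- b < u" "u < 0"
    let ?x = "(u, 0) :: real \<times> real"
    have "h.neumann_face_at ?x (0, 1)"
      by (rule upper) (use segW segE u in auto)
    then obtain e where e: "h.flat_at ?x (0, 1) e"
      "\<And>y. y \<in> ball ?x e \<Longrightarrow> (y - ?x) \<bullet> (0, 1) = 0 \<Longrightarrow> (p y, q y) \<bullet> (0, 1) = 0"
      and ell: "\<And>y. y \<noteq> 0 \<Longrightarrow> quad_form a11 a12 a22 ?x y > 0"
      unfolding h.neumann_face_at_def by blast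
    have "e > 0" using e(1) by (simp add: h.flat_at_def)
    \<comment> \<open>The point \<open>?x\<close> is at distance at most \<open>b\<close> from the
      corner; the bound \<open>e2 - b\<close> keeps the disc about it in the region where
      \<open>q\<close> is nonpositive.\<close>
    define e' where "e' = min e (e2 - b)"
    have e': "e' > 0" "e' \<le> e" "e' \<le> e2 - b" using \<open>e > 0\<close> b by (auto simp: e'_def)
    have sub: "y \<in> ball 0 e2" if "y \<in> ball ?x e'" for y
    proof -
      have "dist 0 y \<le> dist 0 ?x + dist ?x y" by (rule dist_triangle)
      moreover have "dist 0 ?x \<le> b" using u by (simp add: norm_Pair)
      ultimately show ?thesis using that e' by simp
    qed
    have flat: "h.flat_at ?x (0, 1) e'" using h.flat_at_mono[OF e(1) e'(1,2)] .
    have neu: "q y = 0" if "y \<in> ball ?x e'" "(y - ?x) \<bullet> (0, 1) = 0" for y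
      using e(2)[of y] that e'(2) by simp
    have "q y \<le> 0" if "y \<in> \<Omega> \<inter> ball ?x e'" for y using qneg sub that by blast
    note sl = h.flat_boundary_slope[OF flat neu ell this]
    have "((\<lambda>v. p (v, 0)) has_real_derivative d_xi \<Omega> p ?x) (at (0 + u))"
      unfolding DERIV_shift using sl(1) by (simp add: add.commute)
    then show "\<exists>y. ((\<lambda>u. p (u, 0)) has_real_derivative y) (at u) \<and> 0 \<le> y"
      using sl(2) by auto
  qed
  moreover have "0 < (p (- b, 0), q (- b, 0)) \<bullet> ?g"
    by (rule wpos) (use clW[OF segW[of "- b"]] segE[of "- b"] b in auto)
  moreover have "q (- b, 0) = 0"
    using neumann[of "(- b, 0)"] segW[of "- b"] b by (simp add: wedge_normal_def)
  ultimately have False using corner0 st by (simp add: zero_less_mult_iff)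
  then show ?thesis ..
qed

end
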